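(* Let $(G,P)$ be a quasi-lattice ordered group and let $E$ be a compactly-aligned product system over $P$. (1) The universal map $i_E:E\to C^*_{\mathrm{cov}}(P,E)$ is covariant. (2) If $\sigma$ is a unital representation of $C^*_{\mathrm{cov}}(P,E)$, then $\sigma\circ i_E$ is covariant.
   Context: Inner products are linear in the first variable; homomorphisms of $C^*$-algebras are $*$-homomorphisms. $P$ is a countable discrete semigroup with identity $e$. Product systems. A product system over $P$ is a family $p:E\to P$ of nontrivial separable complex Hilbert spaces $E_t:=p^{-1}(t)$ with an associative multiplication $E\times E\to E$ such that $p(xy)=p(x)p(y)$ and for all $s,t\in P$ the map $x\otimes y\in E_s\otimes E_t\mapsto xy\in E_{st}$ extends to a unitary isomorphism; also $\dim E_e=1$, so $E$ has an identity. For $S\in\mathcal B(E_s)$, $S\otimes 1$ denotes the operator on $E_{st}$ with $(S\otimes 1)(xy)=(Sx)y$ for $x\in E_s$, $y\in E_t$. $\mathcal K(E_s)$ denotes the compact operators and, for $x,y\in E_s$, $x\otimes\overline y$ is the operator $z\mapsto\langle z,y\rangle x$. Representations. A representation of $E$ in a unital $C^*$-algebra $B$ is a map $\phi:E\to B$ with (i) $\phi(xy)=\phi(x)\phi(y)$ for all $x,y\in E$, and (ii) $\phi(y)^*\phi(x)=\langle x,y\rangle 1$ if $p(x)=p(y)$. For each $s\in P$ there is a unique homomorphism $\rho^\phi_s:\mathcal K(E_s)\to B$ with $\rho^\phi_s(x\otimes\overline y)=\phi(x)\phi(y)^*$. When $B=\mathcal B(\mathcal H)$, $\rho^\phi_s$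 has a unique normal extension to $\mathcal B(E_s)$, also denoted $\rho_s^\phi$. Orders. $(G,P)$ is quasi-lattice ordered if $P$ is a subsemigroup of the group $G$ with $P\cap P^{-1}=\{e\}$ and, for the left-invariant partial order $s\le t\iff s^{-1}t\in P$ on $G$, every finite subset of $G$ with an upper bound in $P$ has a least upper bound in $P$. For $s,t\in P$, $s\vee t$ is the least upper bound if a common upper bound exists (written $s\vee t<\infty$); otherwise $s\vee t=\infty$. Covariance. A representation $\phi$ of $E$ on a Hilbert space is covariant if, for all $s,t\in P$, $\rho^\phi_s(1)\rho^\phi_t(1)=\rho^\phi_{s\vee t}(1)$ when $s\vee t<\infty$ and $\rho^\phi_s(1)\rho^\phi_t(1)=0$ when $s\vee t=\infty$. $E$ is compactly aligned if whenever $s,t\in P$ satisfy $s\vee t<\infty$ and $S\in\mathcal K(E_s)$, $T\in\mathcal K(E_t)$, the operator $(S\otimes1)(T\otimes1)$ is compact on $E_{s\vee t}$. For compactly aligned $E$, a representation $\phi$ of $E$ in a $C^*$-algebra $B$ is covariant if, for all $s,t\in P$, $S\in\mathcal K(E_s)$, $T\in\mathcal K(E_t)$, $\rho^\phi_s(S)\rho^\phi_t(T)$ equals $\rho^\phi_{s\vee t}((S\otimes 1)(T\otimes 1))$ if $s\vee t<\infty$ and $0$ if $s\vee t=\infty$ (for $B=\mathcal B(\mathcal H)$ the two definitions agree). Universal algebra. $(C^*_{\mathrm{cov}}(P,E),i_E)$ is the pair of a unital $C^*$-algebra and a representation $i_E$ of $E$ in it such that: (a) there is a faithful unital representation $\sigma$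 of $C^*_{\mathrm{cov}}(P,E)$ on a Hilbert space with $\sigma\circ i_E$ covariant (in the Hilbert space sense); (b) for every covariant representation $\phi$ of $E$ on a Hilbert space there is a unital representation $\phi_*$ of $C^*_{\mathrm{cov}}(P,E)$ with $\phi=\phi_*\circ i_E$; (c) $C^*_{\mathrm{cov}}(P,E)$ is generated as a $C^*$-algebra by $i_E(E)$. *)

theory Defs
  imports "HOL-Analysis.Analysis" "HOL-Algebra.Module" "HOL-Algebra.Lattice"
begin

section \<open>Complex Hilbert spaces and unital C*-algebras on carrier sets\<close>

definition complex_ring :: "complex ring" where
  "complex_ring = \<lparr>carrier = UNIV, mult = (*), one = 1, zero = 0, add = (+)\<rparr>"

text \<open>The distance induced by a norm. It is set to 0 off the carrier because
  the locale Metric_space asks for nonnegativity and symmetry on the whole type.\<close>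

definition norm_dist :: "('a, 'm) ring_scheme \<Rightarrow> ('a \<Rightarrow> real) \<Rightarrow> 'a \<Rightarrow> 'a \<Rightarrow> real" where
  "norm_dist V N x y =
     (if x \<in> carrier V \<and> y \<in> carrier V then N (x \<ominus>\<^bsub>V\<^esub> y) else 0)"

text \<open>The fields for ring multiplication and one, inherited from the library's module record,
  are not used for Hilbert spaces.\<close>

record 'a hilbert = "(complex, 'a) module" +
  cinner :: "'a \<Rightarrow> 'a \<Rightarrow> complex"

definition hnorm :: "('a, 'm) hilbert_scheme \<Rightarrow> 'a \<Rightarrow> real" where
  "hnorm H x = sqrt (Re (cinner H x x))"

definition htop :: "('a, 'm) hilbert_scheme \<Rightarrow> 'a topology" where
  "htop H = Metric_space.mtopology (carrier H) (norm_dist H (hnorm H))"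

locale hilbert_space = module complex_ring H for H :: "('a, 'm) hilbert_scheme" (structure) +
  assumes cinner_add:
      "\<lbrakk>x \<in> carrier H; y \<in> carrier H; z \<in> carrier H\<rbrakk> \<Longrightarrow>
        cinner H (x \<oplus> y) z = cinner H x z + cinner H y z"
    and cinner_smult:
      "\<lbrakk>x \<in> carrier H; y \<in> carrier H\<rbrakk> \<Longrightarrow> cinner H (c \<odot> x) y = c * cinner H x y"
    and cinner_commute:
      "\<lbrakk>x \<in> carrier H; y \<in> carrier H\<rbrakk> \<Longrightarrow> cinner H y x = cnj (cinner H x y)"
    and cinner_nonneg: "x \<in> carrier H \<Longrightarrow> 0 \<le> Re (cinner H x x)"
    and cinner_eq_0: "\<lbrakk>x \<in> carrier H; cinner H x x = 0\<rbrakk> \<Longrightarrow> x = \<zero>"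
    and complete: "Metric_space.mcomplete (carrier H) (norm_dist H (hnorm H))"

record 'a cstar = "(complex, 'a) module" +
  star :: "'a \<Rightarrow> 'a"
  anorm :: "'a \<Rightarrow> real"

locale unital_cstar_algebra =
  ring A + module complex_ring A for A :: "('a, 'm) cstar_scheme" (structure) +
  assumes smult_mult_left:
      "\<lbrakk>x \<in> carrier A; y \<in> carrier A\<rbrakk> \<Longrightarrow> (c \<odot> x) \<otimes> y = c \<odot> (x \<otimes> y)"
    and smult_mult_right:
      "\<lbrakk>x \<in> carrier A; y \<in> carrier A\<rbrakk> \<Longrightarrow> x \<otimes> (c \<odot> y) = c \<odot> (x \<otimes> y)"
    and star_closed: "x \<in> carrier A \<Longrightarrow> star A x \<in> carrier A"
    and star_star: "x \<in> carrier A \<Longrightarrow> star A (star A x) = x"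
    and star_add:
      "\<lbrakk>x \<in> carrier A; y \<in> carrier A\<rbrakk> \<Longrightarrow> star A (x \<oplus> y) = star A x \<oplus> star A y"
    and star_smult: "x \<in> carrier A \<Longrightarrow> star A (c \<odot> x) = cnj c \<odot> star A x"
    and star_mult:
      "\<lbrakk>x \<in> carrier A; y \<in> carrier A\<rbrakk> \<Longrightarrow> star A (x \<otimes> y) = star A y \<otimes> star A x"
    and anorm_nonneg: "x \<in> carrier A \<Longrightarrow> 0 \<le> anorm A x"
    and anorm_eq_0: "x \<in> carrier A \<Longrightarrow> anorm A x = 0 \<longleftrightarrow> x = \<zero>"
    and anorm_triangle:
      "\<lbrakk>x \<in> carrier A; y \<in> carrier A\<rbrakk> \<Longrightarrow> anorm A (x \<oplus> y) \<le> anorm A x + anorm A y"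
    and anorm_smult: "x \<in> carrier A \<Longrightarrow> anorm A (c \<odot> x) = cmod c * anorm A x"
    and anorm_mult:
      "\<lbrakk>x \<in> carrier A; y \<in> carrier A\<rbrakk> \<Longrightarrow> anorm A (x \<otimes> y) \<le> anorm A x * anorm A y"
    and cstar_identity: "x \<in> carrier A \<Longrightarrow> anorm A (star A x \<otimes> x) = (anorm A x)\<^sup>2"
    and complete: "Metric_space.mcomplete (carrier A) (norm_dist A (anorm A))"

text \<open>Homomorphisms are *-homomorphisms, not required to be unital; the unit fields of the
  records play no role, so the definition also applies to non-unital algebras such as the
  compact operators.\<close>

definition star_hom ::
    "('a, 'm) cstar_scheme \<Rightarrow> ('b, 'n) cstar_scheme \<Rightarrow> ('a \<Rightarrow> 'b) \<Rightarrow> bool" where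
  "star_hom A B f \<longleftrightarrow>
     f \<in> carrier A \<rightarrow> carrier B \<and>
     (\<forall>x\<in>carrier A. \<forall>y\<in>carrier A. f (x \<oplus>\<^bsub>A\<^esub> y) = f x \<oplus>\<^bsub>B\<^esub> f y) \<and>
     (\<forall>c. \<forall>x\<in>carrier A. f (c \<odot>\<^bsub>A\<^esub> x) = c \<odot>\<^bsub>B\<^esub> f x) \<and>
     (\<forall>x\<in>carrier A. \<forall>y\<in>carrier A. f (x \<otimes>\<^bsub>A\<^esub> y) = f x \<otimes>\<^bsub>B\<^esub> f y) \<and>
     (\<forall>x\<in>carrier A. f (star A x) = star B (f x))"

definition cstar_subalgebra :: "('a, 'm) cstar_scheme \<Rightarrow> 'a set \<Rightarrow> bool" where
  "cstar_subalgebra A S \<longleftrightarrow>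
     submodule S complex_ring A \<and>
     (\<forall>x\<in>S. \<forall>y\<in>S. x \<otimes>\<^bsub>A\<^esub> y \<in> S) \<and>
     (\<forall>x\<in>S. star A x \<in> S) \<and>
     closedin (Metric_space.mtopology (carrier A) (norm_dist A (anorm A))) S"


section \<open>Operators on a Hilbert space\<close>

definition bounded_ops :: "('a, 'm) hilbert_scheme \<Rightarrow> ('a \<Rightarrow> 'a) set" where
  "bounded_ops H = {T \<in> carrier H \<rightarrow>\<^sub>E carrier H.
     (\<forall>x\<in>carrier H. \<forall>y\<in>carrier H. T (x \<oplus>\<^bsub>H\<^esub> y) = T x \<oplus>\<^bsub>H\<^esub> T y) \<and>
     (\<forall>c. \<forall>x\<in>carrier H. T (c \<odot>\<^bsub>H\<^esub> x) = c \<odot>\<^bsub>H\<^esub> T x) \<and>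
     (\<exists>C. \<forall>x\<in>carrier H. hnorm H (T x) \<le> C * hnorm H x)}"

definition unit_ball :: "('a, 'm) hilbert_scheme \<Rightarrow> 'a set" where
  "unit_ball H = {x \<in> carrier H. hnorm H x \<le> 1}"

definition adjoint_op :: "('a, 'm) hilbert_scheme \<Rightarrow> ('a \<Rightarrow> 'a) \<Rightarrow> 'a \<Rightarrow> 'a" where
  "adjoint_op H T = (THE S. S \<in> bounded_ops H \<and>
     (\<forall>x\<in>carrier H. \<forall>y\<in>carrier H. cinner H (T x) y = cinner H x (S y)))"

definition Bop :: "('a, 'm) hilbert_scheme \<Rightarrow> ('a \<Rightarrow> 'a) cstar" where
  "Bop H = \<lparr>carrier = bounded_ops H,
     mult = (\<lambda>S T. compose (carrier H) S T),
     one = (\<lambda>x\<in>carrier H. x),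
     zero = (\<lambda>x\<in>carrier H. \<zero>\<^bsub>H\<^esub>),
     add = (\<lambda>S T. \<lambda>x\<in>carrier H. S x \<oplus>\<^bsub>H\<^esub> T x),
     smult = (\<lambda>c T. \<lambda>x\<in>carrier H. c \<odot>\<^bsub>H\<^esub> T x),
     star = adjoint_op H,
     anorm = (\<lambda>T. SUP x\<in>unit_ball H. hnorm H (T x))\<rparr>"

definition compact_ops :: "('a, 'm) hilbert_scheme \<Rightarrow> ('a \<Rightarrow> 'a) set" where
  "compact_ops H =
     {T \<in> bounded_ops H. compactin (htop H) (htop H closure_of (T ` unit_ball H))}"

definition Kop :: "('a, 'm) hilbert_scheme \<Rightarrow> ('a \<Rightarrow> 'a) cstar" where
  "Kop H = (Bop H)\<lparr>carrier := compact_ops H\<rparr>"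

definition rank_one :: "('a, 'm) hilbert_scheme \<Rightarrow> 'a \<Rightarrow> 'a \<Rightarrow> 'a \<Rightarrow> 'a" where
  "rank_one H x y = (\<lambda>z\<in>carrier H. cinner H z y \<odot>\<^bsub>H\<^esub> x)"

text \<open>The self-adjoint operators with their usual order: \<open>S \<le> T\<close> iff \<open>T - S\<close> is positive,
  i.e. iff the (real) numbers \<open>\<langle>S x, x\<rangle>\<close> are bounded by \<open>\<langle>T x, x\<rangle>\<close>.\<close>

definition sa_order :: "('a, 'm) hilbert_scheme \<Rightarrow> ('a \<Rightarrow> 'a) gorder" where
  "sa_order H = \<lparr>carrier = {T \<in> bounded_ops H. adjoint_op H T = T},
     eq = (=),
     le = (\<lambda>S T. \<forall>x\<in>carrier H. Re (cinner H (S x) x) \<le> Re (cinner H (T x) x))\<rparr>"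

text \<open>A homomorphism between the bounded operators on \<open>K\<close> and on \<open>H\<close> is normal if it preserves
  suprema of increasing nets (here: upward directed sets) of self-adjoint operators.\<close>

definition normal_map ::
    "('a, 'm) hilbert_scheme \<Rightarrow> ('b, 'n) hilbert_scheme \<Rightarrow> (('a \<Rightarrow> 'a) \<Rightarrow> 'b \<Rightarrow> 'b) \<Rightarrow> bool" where
  "normal_map K H f \<longleftrightarrow>
     (\<forall>D S. D \<subseteq> carrier (sa_order K) \<longrightarrow> D \<noteq> {} \<longrightarrow>
        (\<forall>S1\<in>D. \<forall>S2\<in>D. \<exists>S3\<in>D. S1 \<sqsubseteq>\<^bsub>sa_order K\<^esub> S3 \<and> S2 \<sqsubseteq>\<^bsub>sa_order K\<^esub> S3) \<longrightarrow>
        least (sa_order K) S (Upper (sa_order K) D) \<longrightarrow>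
        least (sa_order H) (f S) (Upper (sa_order H) (f ` D)))"

text \<open>The bilinear map \<open>m\<close> makes \<open>L\<close> a Hilbert space tensor product of \<open>H\<close> and \<open>K\<close>; that is,
  \<open>x \<otimes> y \<mapsto> m x y\<close> is well defined on the algebraic tensor product, is isometric for the tensor
  inner product, and has dense range, so that it extends to a unitary from the completed tensor
  product onto \<open>L\<close>.\<close>

definition hilbert_tensor ::
    "('a, 'm) hilbert_scheme \<Rightarrow> ('b, 'n) hilbert_scheme \<Rightarrow> ('c, 'k) hilbert_scheme \<Rightarrow>
     ('a \<Rightarrow> 'b \<Rightarrow> 'c) \<Rightarrow> bool" where
  "hilbert_tensor H K L m \<longleftrightarrow>
     (\<forall>x\<in>carrier H. \<forall>y\<in>carrier K. m x y \<in> carrier L) \<and>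
     (\<forall>x\<in>carrier H. \<forall>x'\<in>carrier H. \<forall>y\<in>carrier K. m (x \<oplus>\<^bsub>H\<^esub> x') y = m x y \<oplus>\<^bsub>L\<^esub> m x' y) \<and>
     (\<forall>x\<in>carrier H. \<forall>y\<in>carrier K. \<forall>y'\<in>carrier K. m x (y \<oplus>\<^bsub>K\<^esub> y') = m x y \<oplus>\<^bsub>L\<^esub> m x y') \<and>
     (\<forall>c. \<forall>x\<in>carrier H. \<forall>y\<in>carrier K. m (c \<odot>\<^bsub>H\<^esub> x) y = c \<odot>\<^bsub>L\<^esub> m x y \<and>
                                       m x (c \<odot>\<^bsub>K\<^esub> y) = c \<odot>\<^bsub>L\<^esub> m x y) \<and>
     (\<forall>x\<in>carrier H. \<forall>x'\<in>carrier H. \<forall>y\<in>carrier K. \<forall>y'\<in>carrier K.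
        cinner L (m x y) (m x' y') = cinner H x x' * cinner K y y') \<and>
     htop L closure_of
       ((\<lambda>W. submodule W complex_ring L) hull {m x y | x y. x \<in> carrier H \<and> y \<in> carrier K})
       = carrier L"


section \<open>Product systems and their representations\<close>

record ('p, 'e) prod_system =
  total :: "'e set"
  proj :: "'e \<Rightarrow> 'p"
  fiber :: "'p \<Rightarrow> 'e hilbert"
  pmult :: "'e \<Rightarrow> 'e \<Rightarrow> 'e"

text \<open>Here \<open>M\<close> is the semigroup \<open>P\<close> with identity, as a monoid.\<close>

locale product_system = monoid M
  for M :: "('p, 'm) monoid_scheme" (structure) and E :: "('p, 'e) prod_system" +
  assumes proj_closed: "proj E \<in> total E \<rightarrow> carrier M"
    and fiber_carrier: "t \<in> carrier M \<Longrightarrow> carrier (fiber E t) = {x \<in> total E. proj E x = t}"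
    and fiber_hilbert: "t \<in> carrier M \<Longrightarrow> hilbert_space (fiber E t)"
    and fiber_nontrivial: "t \<in> carrier M \<Longrightarrow> carrier (fiber E t) \<noteq> {\<zero>\<^bsub>fiber E t\<^esub>}"
    and fiber_separable: "t \<in> carrier M \<Longrightarrow> separable_space (htop (fiber E t))"
    and pmult_closed: "\<lbrakk>x \<in> total E; y \<in> total E\<rbrakk> \<Longrightarrow> pmult E x y \<in> total E"
    and pmult_assoc:
      "\<lbrakk>x \<in> total E; y \<in> total E; z \<in> total E\<rbrakk> \<Longrightarrow>
        pmult E (pmult E x y) z = pmult E x (pmult E y z)"
    and proj_pmult:
      "\<lbrakk>x \<in> total E; y \<in> total E\<rbrakk> \<Longrightarrow> proj E (pmult E x y) = proj E x \<otimes> proj E y"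
    and pmult_tensor:
      "\<lbrakk>s \<in> carrier M; t \<in> carrier M\<rbrakk> \<Longrightarrow>
        hilbert_tensor (fiber E s) (fiber E t) (fiber E (s \<otimes> t)) (pmult E)"
    and fiber_one_dim:
      "\<exists>u\<in>carrier (fiber E \<one>). u \<noteq> \<zero>\<^bsub>fiber E \<one>\<^esub> \<and>
         (\<forall>x\<in>carrier (fiber E \<one>). \<exists>c. x = c \<odot>\<^bsub>fiber E \<one>\<^esub> u)"

definition representation ::
    "('p, 'e) prod_system \<Rightarrow> ('b, 'n) cstar_scheme \<Rightarrow> ('e \<Rightarrow> 'b) \<Rightarrow> bool" where
  "representation E B \<phi> \<longleftrightarrow>
     \<phi> \<in> total E \<rightarrow> carrier B \<and>
     (\<forall>x\<in>total E. \<forall>y\<in>total E. \<phi> (pmult E x y) = \<phi> x \<otimes>\<^bsub>B\<^esub> \<phi> y) \<and>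
     (\<forall>x\<in>total E. \<forall>y\<in>total E. proj E x = proj E y \<longrightarrow>
        star B (\<phi> y) \<otimes>\<^bsub>B\<^esub> \<phi> x = cinner (fiber E (proj E x)) x y \<odot>\<^bsub>B\<^esub> \<one>\<^bsub>B\<^esub>)"

definition rho ::
    "('p, 'e) prod_system \<Rightarrow> ('b, 'n) cstar_scheme \<Rightarrow> ('e \<Rightarrow> 'b) \<Rightarrow> 'p \<Rightarrow> ('e \<Rightarrow> 'e) \<Rightarrow> 'b" where
  "rho E B \<phi> s = (THE f. f \<in> extensional (carrier (Kop (fiber E s))) \<and>
     star_hom (Kop (fiber E s)) B f \<and>
     (\<forall>x\<in>carrier (fiber E s). \<forall>y\<in>carrier (fiber E s).
        f (rank_one (fiber E s) x y) = \<phi> x \<otimes>\<^bsub>B\<^esub> star B (\<phi> y)))"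

text \<open>The normal extension of \<open>rho\<close> to all bounded operators, for representations on \<open>H\<close>.\<close>

definition rho_normal ::
    "('p, 'e) prod_system \<Rightarrow> ('h, 'n) hilbert_scheme \<Rightarrow> ('e \<Rightarrow> 'h \<Rightarrow> 'h) \<Rightarrow> 'p \<Rightarrow>
     ('e \<Rightarrow> 'e) \<Rightarrow> 'h \<Rightarrow> 'h" where
  "rho_normal E H \<phi> s = (THE f. f \<in> extensional (carrier (Bop (fiber E s))) \<and>
     star_hom (Bop (fiber E s)) (Bop H) f \<and>
     normal_map (fiber E s) H f \<and>
     (\<forall>T\<in>carrier (Kop (fiber E s)). f T = rho E (Bop H) \<phi> s T))"


section \<open>Quasi-lattice ordered groups\<close>

definition left_order :: "('g, 'm) monoid_scheme \<Rightarrow> 'g set \<Rightarrow> 'g gorder" where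
  "left_order G P = \<lparr>carrier = carrier G, eq = (=), le = (\<lambda>s t. inv\<^bsub>G\<^esub> s \<otimes>\<^bsub>G\<^esub> t \<in> P)\<rparr>"

text \<open>The least upper bound in \<open>P\<close> of a finite set is the least one among the upper bounds
  in \<open>P\<close>. For subsets of \<open>P\<close> all upper bounds lie in \<open>P\<close>, so that it is then the least upper
  bound in \<open>G\<close> as well.\<close>

locale quasi_lattice_ordered = group G
  for G :: "('g, 'm) monoid_scheme" (structure) and P :: "'g set" +
  assumes P_subset: "P \<subseteq> carrier G"
    and P_closed: "\<lbrakk>s \<in> P; t \<in> P\<rbrakk> \<Longrightarrow> s \<otimes> t \<in> P"
    and P_pointed: "P \<inter> (\<lambda>s. inv s) ` P = {\<one>}"
    and lub_exists:
      "\<lbrakk>finite F; F \<subseteq> carrier G; Upper (left_order G P) F \<inter> P \<noteq> {}\<rbrakk> \<Longrightarrow>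
        \<exists>r. least (left_order G P) r (Upper (left_order G P) F \<inter> P)"

definition bounded_pair :: "('g, 'm) monoid_scheme \<Rightarrow> 'g set \<Rightarrow> 'g \<Rightarrow> 'g \<Rightarrow> bool" where
  "bounded_pair G P s t \<longleftrightarrow> Upper (left_order G P) {s, t} \<noteq> {}"

definition vee :: "('g, 'm) monoid_scheme \<Rightarrow> 'g set \<Rightarrow> 'g \<Rightarrow> 'g \<Rightarrow> 'g" where
  "vee G P s t = s \<squnion>\<^bsub>left_order G P\<^esub> t"


section \<open>Compact alignment and covariance\<close>

text \<open>For \<open>s \<le> r\<close> this is the operator \<open>S \<otimes> 1\<close> on the fiber over \<open>r = s (s\<inverse> r)\<close>.\<close>

definition amplify ::
    "('p, 'm) monoid_scheme \<Rightarrow> ('p, 'e) prod_system \<Rightarrow> 'p \<Rightarrow> 'p \<Rightarrow> ('e \<Rightarrow> 'e) \<Rightarrow> 'e \<Rightarrow> 'e" where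
  "amplify G E s r S = (THE T. T \<in> bounded_ops (fiber E r) \<and>
     (\<forall>x\<in>carrier (fiber E s). \<forall>y\<in>carrier (fiber E (inv\<^bsub>G\<^esub> s \<otimes>\<^bsub>G\<^esub> r)).
        T (pmult E x y) = pmult E (S x) y))"

definition amplified_product ::
    "('p, 'm) monoid_scheme \<Rightarrow> 'p set \<Rightarrow> ('p, 'e) prod_system \<Rightarrow> 'p \<Rightarrow> 'p \<Rightarrow>
     ('e \<Rightarrow> 'e) \<Rightarrow> ('e \<Rightarrow> 'e) \<Rightarrow> 'e \<Rightarrow> 'e" where
  "amplified_product G P E s t S T =
     amplify G E s (vee G P s t) S \<otimes>\<^bsub>Bop (fiber E (vee G P s t))\<^esub> amplify G E t (vee G P s t) T"

definition compactly_aligned ::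
    "('p, 'm) monoid_scheme \<Rightarrow> 'p set \<Rightarrow> ('p, 'e) prod_system \<Rightarrow> bool" where
  "compactly_aligned G P E \<longleftrightarrow>
     (\<forall>s\<in>P. \<forall>t\<in>P. bounded_pair G P s t \<longrightarrow>
       (\<forall>S\<in>compact_ops (fiber E s). \<forall>T\<in>compact_ops (fiber E t).
          amplified_product G P E s t S T \<in> compact_ops (fiber E (vee G P s t))))"

text \<open>Covariance is defined by the projections \<open>\<rho>\<^sub>s(1)\<close> for representations on a Hilbert space,
  and by compact operators for representations of a compactly aligned system in a C*-algebra.\<close>

definition covariant_on ::
    "('p, 'm) monoid_scheme \<Rightarrow> 'p set \<Rightarrow> ('p, 'e) prod_system \<Rightarrow> ('h, 'n) hilbert_scheme \<Rightarrow>
     ('e \<Rightarrow> 'h \<Rightarrow> 'h) \<Rightarrow> bool" where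
  "covariant_on G P E H \<phi> \<longleftrightarrow>
     representation E (Bop H) \<phi> \<and>
     (\<forall>s\<in>P. \<forall>t\<in>P.
        rho_normal E H \<phi> s \<one>\<^bsub>Bop (fiber E s)\<^esub> \<otimes>\<^bsub>Bop H\<^esub> rho_normal E H \<phi> t \<one>\<^bsub>Bop (fiber E t)\<^esub> =
        (if bounded_pair G P s t
         then rho_normal E H \<phi> (vee G P s t) \<one>\<^bsub>Bop (fiber E (vee G P s t))\<^esub>
         else \<zero>\<^bsub>Bop H\<^esub>))"

definition covariant_in ::
    "('p, 'm) monoid_scheme \<Rightarrow> 'p set \<Rightarrow> ('p, 'e) prod_system \<Rightarrow> ('b, 'n) cstar_scheme \<Rightarrow>
     ('e \<Rightarrow> 'b) \<Rightarrow> bool" where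
  "covariant_in G P E B \<phi> \<longleftrightarrow>
     representation E B \<phi> \<and>
     (\<forall>s\<in>P. \<forall>t\<in>P. \<forall>S\<in>compact_ops (fiber E s). \<forall>T\<in>compact_ops (fiber E t).
        rho E B \<phi> s S \<otimes>\<^bsub>B\<^esub> rho E B \<phi> t T =
        (if bounded_pair G P s t
         then rho E B \<phi> (vee G P s t) (amplified_product G P E s t S T)
         else \<zero>\<^bsub>B\<^esub>))"


section \<open>The universal algebra for covariant representations\<close>

definition unital_rep ::
    "('b, 'n) cstar_scheme \<Rightarrow> ('h, 'k) hilbert_scheme \<Rightarrow> ('b \<Rightarrow> 'h \<Rightarrow> 'h) \<Rightarrow> bool" where
  "unital_rep A H \<sigma> \<longleftrightarrow> star_hom A (Bop H) \<sigma> \<and> \<sigma> \<one>\<^bsub>A\<^esub> = \<one>\<^bsub>Bop H\<^esub>"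

text \<open>\<open>(A, i)\<close> is the universal pair for covariant representations of \<open>E\<close>. A formula cannot
  quantify over types: the type arguments \<open>'h\<close> and \<open>'k\<close> host the Hilbert space of the faithful
  representation and the Hilbert spaces of the universal property, respectively.\<close>

definition covariant_algebra ::
    "'h itself \<Rightarrow> 'k itself \<Rightarrow> ('p, 'm) monoid_scheme \<Rightarrow> 'p set \<Rightarrow> ('p, 'e) prod_system \<Rightarrow>
     ('b, 'n) cstar_scheme \<Rightarrow> ('e \<Rightarrow> 'b) \<Rightarrow> bool" where
  "covariant_algebra TYPE('h) TYPE('k) G P E A i \<longleftrightarrow>
     unital_cstar_algebra A \<and> representation E A i \<and>
     (\<exists>(H :: 'h hilbert) \<sigma>. hilbert_space H \<and> unital_rep A H \<sigma> \<and> inj_on \<sigma> (carrier A) \<and>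
        covariant_on G P E H (\<sigma> \<circ> i)) \<and>
     (\<forall>(H :: 'k hilbert) \<phi>. hilbert_space H \<longrightarrow> covariant_on G P E H \<phi> \<longrightarrow>
        (\<exists>\<phi>'. unital_rep A H \<phi>' \<and> (\<forall>x\<in>total E. \<phi> x = \<phi>' (i x)))) \<and>
     cstar_subalgebra A hull (i ` total E) = carrier A"

end

theory Submission
  imports Defs
begin


text \<open>The homomorphisms from operators on a fiber to operators on a Hilbert space that occur here have one
  description.
  Let \<open>m : X \<times> K \<rightarrow> H\<close> satisfy \<open>\<langle>m(x, k), m(x', k')\<rangle> = \<langle>x, x'\<rangle>\<langle>k, k'\<rangle>\<close>. Then every bounded operator \<open>T\<close>
  on \<open>X\<close> gives an operator \<open>amp T\<close> on \<open>H\<close> that sends \<open>m(x, k)\<close> to \<open>m(T x, k)\<close> and vanishes on the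
  orthogonal complement of the range of \<open>m\<close>; its norm is controlled by a power trick
  (\<open>squaring_bound\<close>, \<open>wsum_bound\<close>). For a representation \<open>\<phi>\<close> on \<open>H\<close> the choice \<open>m(x, h) = \<phi>(x) h\<close> gives
  \<open>\<rho>\<^sub>s\<close> and its normal extension, and for \<open>m(x, y) = x y\<close> it gives \<open>S \<otimes> 1\<close>.

  To identify \<open>amp\<close> with \<open>\<rho>\<^sub>s\<close> on compact operators one needs that homomorphisms from the compact
  operators to \<open>B(H)\<close> are contractive (\<open>compact_hom_bound\<close>), which follows from the existence of
  quasi-inverses, and that compact operators are norm limits of operators of finite rank. To identify
  it with the normal extension one needs that \<open>amp\<close> preserves suprema of upward directed sets
  (\<open>normal_amp\<close>) and that the identity is the supremum of the projections of finite rank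
  (\<open>fin_proj_lub\<close>, \<open>normal_hom_unique\<close>).

  On a Hilbert space, both \<open>\<rho>\<^sub>s(S)\<close> and \<open>\<rho>\<^sub>r(S \<otimes> 1)\<close> send \<open>\<phi>(x y) h\<close> to \<open>\<phi>((S x) y) h\<close>, so that
  \<open>\<rho>\<^sub>r(S \<otimes> 1) = \<rho>\<^sub>s(S) \<rho>\<^sub>r(1) = \<rho>\<^sub>r(1) \<rho>\<^sub>s(S)\<close> for \<open>s \<le> r\<close> (\<open>rep_op_amplify\<close>). With \<open>r = s \<or> t\<close>,
  covariance in terms of compact operators therefore says that
  \<open>\<rho>\<^sub>s(S) \<rho>\<^sub>t(T) = \<rho>\<^sub>s(S) \<rho>\<^sub>r(1) \<rho>\<^sub>t(T)\<close>, which is equivalent to \<open>\<rho>\<^sub>s(1) \<rho>\<^sub>t(1) = \<rho>\<^sub>r(1)\<close>; this is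
  \<open>covariant_on_iff_in\<close>.

  Finally let \<open>\<sigma>\<close> be the faithful representation of the universal algebra \<open>A\<close> for which \<open>\<sigma> \<circ> i\<close> is
  covariant. The operators \<open>\<rho>\<^sub>s(T)\<close> of \<open>\<sigma> \<circ> i\<close> with \<open>T\<close> compact lie in the range of \<open>\<sigma>\<close>
  (\<open>compact_lift\<close>), so that \<open>\<rho>\<^sub>s\<close> exists in \<open>A\<close> and is intertwined with the one on the Hilbert space
  (\<open>rho_algebra\<close>). Injectivity of \<open>\<sigma>\<close> turns covariance of \<open>\<sigma> \<circ> i\<close> into covariance of \<open>i\<close>, and every
  other unital representation carries it over to its Hilbert space (\<open>hom_rho\<close>).\<close>

section \<open>Positive forms and Hilbert spaces\<close>

lemma complex_ring_simps [simp]: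
  "carrier complex_ring = UNIV" "mult complex_ring = (*)" "one complex_ring = 1"
  "zero complex_ring = 0" "add complex_ring = (+)"
  by (simp_all add: complex_ring_def)

lemma real_quadratic_bound:
  fixes a b c :: real
  assumes "0 \<le> a" "\<And>t. 0 \<le> a - 2 * t * b + t\<^sup>2 * b * c" "0 \<le> b" "0 \<le> c"
  shows "b \<le> a * c"
proof (cases "c = 0")
  case True
  have "b = 0"
  proof (rule ccontr)
    assume "b \<noteq> 0"
    then have "b > 0" using assms by simp
    then show False using assms(2)[of "(a + 1) / (2 * b)"] True by simp
  qed
  then show ?thesis using True by simp
next
  case False
  then have "c > 0" using assms by simp
  then show ?thesis using assms(2)[of "1 / c"]
    by (simp add: power2_eq_square field_simps)
qed

text \<open>The Cauchy-Schwarz inequality for a positive Hermitian form on a complex module.\<close>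

lemma cauchy_schwarz_form:
  fixes M (structure) and B :: "_ \<Rightarrow> _ \<Rightarrow> complex"
  assumes M: "module complex_ring M"
    and add: "\<And>x y z. \<lbrakk>x \<in> carrier M; y \<in> carrier M; z \<in> carrier M\<rbrakk> \<Longrightarrow> B (x \<oplus>\<^bsub>M\<^esub> y) z = B x z + B y z"
    and smult: "\<And>c x y. \<lbrakk>x \<in> carrier M; y \<in> carrier M\<rbrakk> \<Longrightarrow> B (c \<odot>\<^bsub>M\<^esub> x) y = c * B x y"
    and herm: "\<And>x y. \<lbrakk>x \<in> carrier M; y \<in> carrier M\<rbrakk> \<Longrightarrow> B y x = cnj (B x y)"
    and pos: "\<And>x. x \<in> carrier M \<Longrightarrow> 0 \<le> Re (B x x)"
    and x: "x \<in> carrier M" and y: "y \<in> carrier M"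
  shows "(cmod (B x y))\<^sup>2 \<le> Re (B x x) * Re (B y y)"
proof (rule real_quadratic_bound)
  interpret module complex_ring M by (rule M)
  note sc = smult_closed[simplified]
  show "0 \<le> Re (B x x)" "0 \<le> Re (B y y)" using pos x y by auto
  show "0 \<le> (cmod (B x y))\<^sup>2" by simp
  fix t :: real
  define c where "c = - (of_real t * B x y)"
  have cy: "c \<odot>\<^bsub>M\<^esub> y \<in> carrier M" using sc y by simp
  have right: "B u (x \<oplus>\<^bsub>M\<^esub> c \<odot>\<^bsub>M\<^esub> y) = B u x + cnj c * B u y" if "u \<in> carrier M" for u
  proof -
    have "B u (x \<oplus>\<^bsub>M\<^esub> c \<odot>\<^bsub>M\<^esub> y) = cnj (B (x \<oplus>\<^bsub>M\<^esub> c \<odot>\<^bsub>M\<^esub> y) u)"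
      using that x y cy by (intro herm) auto
    also have "\<dots> = cnj (B x u) + cnj c * cnj (B y u)"
      using that x y cy by (simp add: add smult)
    finally show ?thesis using herm[of x u] herm[of y u] that x y by simp
  qed
  have "0 \<le> Re (B (x \<oplus>\<^bsub>M\<^esub> c \<odot>\<^bsub>M\<^esub> y) (x \<oplus>\<^bsub>M\<^esub> c \<odot>\<^bsub>M\<^esub> y))"
    using x cy by (intro pos) auto
  also have "B (x \<oplus>\<^bsub>M\<^esub> c \<odot>\<^bsub>M\<^esub> y) (x \<oplus>\<^bsub>M\<^esub> c \<odot>\<^bsub>M\<^esub> y)
      = B x x + cnj c * B x y + c * cnj (B x y) + c * cnj c * B y y"
    using x y cy herm[of x y] by (simp add: add smult right algebra_simps)
  also have "Re \<dots> = Re (B x x) - 2 * t * (cmod (B x y))\<^sup>2 + t\<^sup>2 * (cmod (B x y))\<^sup>2 * Re (B y y)"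
  proof -
    have "Im (B y y) = 0" using herm[of y y] y by (auto simp: complex_eq_iff)
    then show ?thesis
      unfolding c_def cmod_power2 by (simp add: power2_eq_square algebra_simps)
  qed
  finally show "0 \<le> Re (B x x) - 2 * t * (cmod (B x y))\<^sup>2 + t\<^sup>2 * (cmod (B x y))\<^sup>2 * Re (B y y)" .
qed

context hilbert_space begin

lemma smult_cl [simp, intro]: "x \<in> carrier H \<Longrightarrow> c \<odot> x \<in> carrier H"
  using smult_closed by simp

lemma smult_0 [simp]: "x \<in> carrier H \<Longrightarrow> 0 \<odot> x = \<zero>"
  using smult_l_null by simp

lemma cinner_zero_left [simp]: "y \<in> carrier H \<Longrightarrow> cinner H \<zero> y = 0"
  using cinner_add[of \<zero> \<zero> y] by simp

lemma cinner_zero_right [simp]: "y \<in> carrier H \<Longrightarrow> cinner H y \<zero> = 0"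
  using cinner_commute[of \<zero> y] by simp

lemma cinner_uminus: "x \<in> carrier H \<Longrightarrow> y \<in> carrier H \<Longrightarrow> cinner H (\<ominus> x) y = - cinner H x y"
  using cinner_add[of x "\<ominus> x" y] by (simp add: r_neg add_eq_0_iff)

lemma cinner_minus: "x \<in> carrier H \<Longrightarrow> y \<in> carrier H \<Longrightarrow> z \<in> carrier H \<Longrightarrow>
    cinner H (x \<ominus> y) z = cinner H x z - cinner H y z"
  by (simp add: a_minus_def cinner_add cinner_uminus)

lemma cinner_add_right: "x \<in> carrier H \<Longrightarrow> y \<in> carrier H \<Longrightarrow> z \<in> carrier H \<Longrightarrow>
    cinner H z (x \<oplus> y) = cinner H z x + cinner H z y"
  using cinner_commute[of "x \<oplus> y" z] cinner_commute[of x z] cinner_commute[of y z]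
  by (simp add: cinner_add)

lemma cinner_smult_right: "x \<in> carrier H \<Longrightarrow> z \<in> carrier H \<Longrightarrow>
    cinner H z (c \<odot> x) = cnj c * cinner H z x"
  using cinner_commute[of "c \<odot> x" z] cinner_commute[of x z]
  by (simp add: cinner_smult)

lemma cinner_uminus_right: "x \<in> carrier H \<Longrightarrow> y \<in> carrier H \<Longrightarrow> cinner H y (\<ominus> x) = - cinner H y x"
  using cinner_commute[of "\<ominus> x" y] cinner_commute[of x y] by (simp add: cinner_uminus)

lemma cinner_minus_right: "x \<in> carrier H \<Longrightarrow> y \<in> carrier H \<Longrightarrow> z \<in> carrier H \<Longrightarrow>
    cinner H z (x \<ominus> y) = cinner H z x - cinner H z y"
  by (simp add: a_minus_def cinner_add_right cinner_uminus_right)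

lemmas cinner_simps = cinner_add cinner_smult cinner_uminus cinner_minus
  cinner_add_right cinner_smult_right cinner_uminus_right cinner_minus_right

lemma minus_cl [simp, intro]: "x \<in> carrier H \<Longrightarrow> y \<in> carrier H \<Longrightarrow> x \<ominus> y \<in> carrier H"
  by (rule minus_closed)

lemma minus_eq_zero_iff: "x \<in> carrier H \<Longrightarrow> y \<in> carrier H \<Longrightarrow> x \<ominus> y = \<zero> \<longleftrightarrow> x = y"
  by (metis a_minus_def add.inv_closed minus_equality minus_minus r_neg)

lemma cinner_ext:
  assumes "x \<in> carrier H" "y \<in> carrier H" "\<And>z. z \<in> carrier H \<Longrightarrow> cinner H x z = cinner H y z"
  shows "x = y"
proof -
  have "cinner H (x \<ominus> y) (x \<ominus> y) = 0" using assms by (simp add: cinner_minus)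
  then have "x \<ominus> y = \<zero>" using assms by (intro cinner_eq_0) auto
  then show ?thesis using assms minus_eq_zero_iff by blast
qed

lemma cinner_ext_right:
  assumes "x \<in> carrier H" "y \<in> carrier H" "\<And>z. z \<in> carrier H \<Longrightarrow> cinner H z x = cinner H z y"
  shows "x = y"
  using assms by (metis cinner_commute cinner_ext)

lemma hnorm_nonneg [simp]: "x \<in> carrier H \<Longrightarrow> 0 \<le> hnorm H x"
  by (simp add: hnorm_def cinner_nonneg)

lemma hnorm_sq: "x \<in> carrier H \<Longrightarrow> (hnorm H x)\<^sup>2 = Re (cinner H x x)"
  by (simp add: hnorm_def cinner_nonneg)

lemma cinner_self: "x \<in> carrier H \<Longrightarrow> cinner H x x = of_real ((hnorm H x)\<^sup>2)"
  using cinner_commute[of x x] by (auto simp: hnorm_sq complex_eq_iff)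

lemma hnorm_zero [simp]: "hnorm H \<zero> = 0"
  by (simp add: hnorm_def)

lemma hnorm_eq_0: "x \<in> carrier H \<Longrightarrow> hnorm H x = 0 \<longleftrightarrow> x = \<zero>"
  using cinner_self[of x] cinner_eq_0[of x] by auto

lemma cauchy_schwarz:
  assumes "x \<in> carrier H" "y \<in> carrier H"
  shows "cmod (cinner H x y) \<le> hnorm H x * hnorm H y"
proof (rule power2_le_imp_le)
  have "(cmod (cinner H x y))\<^sup>2 \<le> Re (cinner H x x) * Re (cinner H y y)"
    by (rule cauchy_schwarz_form[OF module_axioms])
      (auto simp: cinner_add cinner_smult cinner_nonneg assms intro: cinner_commute)
  then show "(cmod (cinner H x y))\<^sup>2 \<le> (hnorm H x * hnorm H y)\<^sup>2"
    using assms by (simp add: power_mult_distrib hnorm_sq)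
qed (use assms in simp)

lemma hnorm_add_sq: "x \<in> carrier H \<Longrightarrow> y \<in> carrier H \<Longrightarrow>
   (hnorm H (x \<oplus> y))\<^sup>2 = (hnorm H x)\<^sup>2 + 2 * Re (cinner H x y) + (hnorm H y)\<^sup>2"
  using cinner_commute[of x y] by (simp add: hnorm_sq cinner_simps)

lemma hnorm_minus_sq: "x \<in> carrier H \<Longrightarrow> y \<in> carrier H \<Longrightarrow>
   (hnorm H (x \<ominus> y))\<^sup>2 = (hnorm H x)\<^sup>2 - 2 * Re (cinner H x y) + (hnorm H y)\<^sup>2"
  using cinner_commute[of x y] by (simp add: hnorm_sq cinner_simps)

lemma hnorm_triangle:
  assumes "x \<in> carrier H" "y \<in> carrier H"
  shows "hnorm H (x \<oplus> y) \<le> hnorm H x + hnorm H y"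
proof (rule power2_le_imp_le)
  have "Re (cinner H x y) \<le> hnorm H x * hnorm H y"
    using cauchy_schwarz[OF assms] complex_Re_le_cmod order_trans by blast
  then show "(hnorm H (x \<oplus> y))\<^sup>2 \<le> (hnorm H x + hnorm H y)\<^sup>2"
    using assms by (simp add: hnorm_add_sq power2_sum)
qed (use assms in simp)

lemma hnorm_smult: "x \<in> carrier H \<Longrightarrow> hnorm H (c \<odot> x) = cmod c * hnorm H x"
proof -
  assume x: "x \<in> carrier H"
  have "(hnorm H (c \<odot> x))\<^sup>2 = (cmod c * hnorm H x)\<^sup>2"
  proof -
    have "c * (cnj c * cinner H x x) = of_real ((cmod c)\<^sup>2 * (hnorm H x)\<^sup>2)"
      using cinner_self[OF x] complex_norm_square[of c] by simp
    then have "Re (cinner H (c \<odot> x) (c \<odot> x)) = (cmod c)\<^sup>2 * (hnorm H x)\<^sup>2"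
      using x by (simp only: cinner_smult cinner_smult_right smult_cl mult.left_commute Re_complex_of_real)
    then show ?thesis
      using x by (simp add: hnorm_sq[of "c \<odot> x"] power_mult_distrib)
  qed
  then show ?thesis using x by (simp add: power2_eq_iff_nonneg)
qed

lemma hnorm_uminus: "x \<in> carrier H \<Longrightarrow> hnorm H (\<ominus> x) = hnorm H x"
  by (simp add: hnorm_def cinner_simps)

lemma hnorm_minus_commute: "x \<in> carrier H \<Longrightarrow> y \<in> carrier H \<Longrightarrow> hnorm H (x \<ominus> y) = hnorm H (y \<ominus> x)"
  by (simp add: hnorm_def cinner_simps algebra_simps)

lemma minus_trans: "x \<in> carrier H \<Longrightarrow> y \<in> carrier H \<Longrightarrow> z \<in> carrier H \<Longrightarrow>
    (x \<ominus> y) \<oplus> (y \<ominus> z) = x \<ominus> z"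
  by (rule cinner_ext) (auto simp: cinner_simps)

lemma hnorm_triangle3: "x \<in> carrier H \<Longrightarrow> y \<in> carrier H \<Longrightarrow> z \<in> carrier H \<Longrightarrow>
    hnorm H (x \<ominus> z) \<le> hnorm H (x \<ominus> y) + hnorm H (y \<ominus> z)"
  using hnorm_triangle[of "x \<ominus> y" "y \<ominus> z"] by (simp add: minus_trans)

lemma hnorm_le_minus: "x \<in> carrier H \<Longrightarrow> y \<in> carrier H \<Longrightarrow>
    hnorm H x \<le> hnorm H (x \<ominus> y) + hnorm H y"
  using hnorm_triangle[of "x \<ominus> y" y] by (simp add: a_minus_def a_assoc l_neg)

lemma hnorm_minus_le: "x \<in> carrier H \<Longrightarrow> y \<in> carrier H \<Longrightarrow>
    hnorm H (x \<ominus> y) \<le> hnorm H x + hnorm H y"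
  using hnorm_triangle[of x "\<ominus> y"] by (simp add: a_minus_def hnorm_uminus)

lemma metric: "Metric_space (carrier H) (norm_dist H (hnorm H))"
proof
  fix x y show "0 \<le> norm_dist H (hnorm H) x y"
    by (auto simp: norm_dist_def)
  show "norm_dist H (hnorm H) x y = norm_dist H (hnorm H) y x"
    by (auto simp: norm_dist_def hnorm_minus_commute)
next
  fix x y assume "x \<in> carrier H" "y \<in> carrier H"
  then show "norm_dist H (hnorm H) x y = 0 \<longleftrightarrow> x = y"
    by (auto simp: norm_dist_def hnorm_eq_0 minus_eq_zero_iff)
next
  fix x y z assume "x \<in> carrier H" "y \<in> carrier H" "z \<in> carrier H"
  then show "norm_dist H (hnorm H) x z \<le> norm_dist H (hnorm H) x y + norm_dist H (hnorm H) y z"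
    by (auto simp: norm_dist_def hnorm_triangle3)
qed

lemma cauchy_converges:
  assumes w: "\<And>n. w n \<in> carrier H"
    and C: "\<And>\<epsilon>. \<epsilon> > 0 \<Longrightarrow> \<exists>N. \<forall>m\<ge>N. \<forall>n\<ge>N. hnorm H (w m \<ominus> w n) < \<epsilon>"
  obtains u where "u \<in> carrier H" "(\<lambda>n. hnorm H (w n \<ominus> u)) \<longlonglongrightarrow> 0"
proof -
  interpret M: Metric_space "carrier H" "norm_dist H (hnorm H)" by (rule metric)
  have "M.MCauchy w"
    using w C by (auto simp: M.MCauchy_def norm_dist_def)
  then obtain u where u: "limitin M.mtopology w u sequentially"
    using complete by (auto simp: M.mcomplete_def)
  then have "u \<in> carrier H" by (simp add: M.limitin_metric)
  moreover have "(\<lambda>n. hnorm H (w n \<ominus> u)) \<longlonglongrightarrow> 0"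
    using u w by (auto simp: M.limitin_metric_dist_null norm_dist_def)
  ultimately show ?thesis using that by blast
qed

lemma tendsto_cinner_left:
  assumes "\<And>n. w n \<in> carrier H" "u \<in> carrier H" "(\<lambda>n. hnorm H (w n \<ominus> u)) \<longlonglongrightarrow> 0" "v \<in> carrier H"
  shows "(\<lambda>n. cinner H (w n) v) \<longlonglongrightarrow> cinner H u v"
proof -
  have "(\<lambda>n. cinner H (w n) v - cinner H u v) \<longlonglongrightarrow> 0"
  proof (rule Lim_null_comparison)
    show "\<forall>\<^sub>F n in sequentially. norm (cinner H (w n) v - cinner H u v) \<le> hnorm H (w n \<ominus> u) * hnorm H v"
      using assms cauchy_schwarz[of "w _ \<ominus> u" v] by (simp add: cinner_minus)
    show "(\<lambda>n. hnorm H (w n \<ominus> u) * hnorm H v) \<longlonglongrightarrow> 0"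
      using tendsto_mult_right[OF assms(3), of "hnorm H v"] by simp
  qed
  then show ?thesis by (simp add: LIM_zero_iff)
qed

text \<open>A bounded linear functional on a subspace, given by its graph, a linear relation \<open>R\<close> between
  vectors and scalars, is represented by a vector in the closure of that subspace. The vector is the limit of
  a minimizing sequence of \<open>\<parallel>w\<parallel>\<^sup>2 - 2 Re c\<close> over the pairs \<open>(w, c)\<close> of the relation.\<close>

lemma riesz_relation:
  assumes R: "R \<subseteq> carrier H \<times> UNIV" "(\<zero>, 0) \<in> R"
    and Radd: "\<And>w c w' c'. (w, c) \<in> R \<Longrightarrow> (w', c') \<in> R \<Longrightarrow> (w \<oplus> w', c + c') \<in> R"
    and Rsmult: "\<And>w c a. (w, c) \<in> R \<Longrightarrow> (a \<odot> w, a * c) \<in> R"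
    and bound: "\<And>w c. (w, c) \<in> R \<Longrightarrow> cmod c \<le> C * hnorm H w"
  obtains u where "u \<in> carrier H" "\<And>w c. (w, c) \<in> R \<Longrightarrow> c = cinner H w u"
    "\<And>\<epsilon>. \<epsilon> > 0 \<Longrightarrow> \<exists>w c. (w, c) \<in> R \<and> hnorm H (u \<ominus> w) < \<epsilon>" "hnorm H u \<le> \<bar>C\<bar>"
proof -
  define J where "J p = (hnorm H (fst p))\<^sup>2 - 2 * Re (snd p)" for p :: "'a \<times> complex"
  have Rc: "(w, c) \<in> R \<Longrightarrow> w \<in> carrier H" for w c using R by auto
  have Jlow: "- C\<^sup>2 \<le> J p" if "p \<in> R" for p
  proof -
    obtain w c where p: "p = (w, c)" by force
    have "Re c \<le> C * hnorm H w" using bound[of w c] that p complex_Re_le_cmod[of c] by simp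
    moreover have "0 \<le> (hnorm H w - C)\<^sup>2" by simp
    ultimately show ?thesis by (simp add: J_def p power2_diff mult.commute)
  qed
  define I where "I = Inf (J ` R)"
  have bdd: "bdd_below (J ` R)" using Jlow by (intro bdd_belowI[of _ "- C\<^sup>2"]) blast
  have I_le: "I \<le> J p" if "p \<in> R" for p
    unfolding I_def using bdd that by (intro cInf_lower) auto
  have "\<exists>p\<in>R. J p < I + 1 / real (Suc n)" for n
  proof -
    have "\<exists>y\<in>J ` R. y < I + 1 / real (Suc n)"
      unfolding I_def using R(2) by (intro cInf_lessD) auto
    then show ?thesis by auto
  qed
  then obtain p where p: "\<And>n. p n \<in> R" "\<And>n. J (p n) < I + 1 / real (Suc n)" by metis
  define w where "w n = fst (p n)" for n
  define c where "c n = snd (p n)" for n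
  have wc: "(w n, c n) \<in> R" for n using p(1)[of n] by (simp add: w_def c_def)
  have w: "w n \<in> carrier H" for n using Rc[OF wc] .
  have Jwc: "(hnorm H (w n))\<^sup>2 - 2 * Re (c n) < I + 1 / real (Suc n)" for n
    using p(2)[of n] by (simp add: J_def w_def c_def)
  have dist: "(hnorm H (w m \<ominus> w n))\<^sup>2 \<le> 2 * (1 / real (Suc m)) + 2 * (1 / real (Suc n))" for m n
  proof -
    have "(of_real (1/2) \<odot> (w m \<oplus> w n), of_real (1/2) * (c m + c n)) \<in> R"
      using Rsmult[OF Radd[OF wc[of m] wc[of n]], of "of_real (1/2)"] .
    from I_le[OF this] have "I \<le> (1/4) * (hnorm H (w m \<oplus> w n))\<^sup>2 - Re (c m + c n)"
      using w by (simp add: J_def hnorm_smult power_divide add_divide_distrib)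
    moreover have "(hnorm H (w m \<ominus> w n))\<^sup>2 + (hnorm H (w m \<oplus> w n))\<^sup>2
        = 2 * (hnorm H (w m))\<^sup>2 + 2 * (hnorm H (w n))\<^sup>2"
      using w by (simp add: hnorm_minus_sq hnorm_add_sq)
    ultimately show ?thesis using Jwc[of m] Jwc[of n] unfolding plus_complex.sel by linarith
  qed
  obtain u where u: "u \<in> carrier H" "(\<lambda>n. hnorm H (w n \<ominus> u)) \<longlonglongrightarrow> 0"
  proof (rule cauchy_converges[OF w])
    fix \<epsilon> :: real assume e: "\<epsilon> > 0"
    obtain N where N: "1 / real (Suc N) < \<epsilon>\<^sup>2 / 4"
      using e nat_approx_posE[of "\<epsilon>\<^sup>2 / 4"] by (metis zero_less_divide_iff zero_less_numeral zero_less_power)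
    have "hnorm H (w m \<ominus> w n) < \<epsilon>" if "m \<ge> N" "n \<ge> N" for m n
    proof (rule power2_less_imp_less)
      have "1 / real (Suc m) \<le> 1 / real (Suc N)" "1 / real (Suc n) \<le> 1 / real (Suc N)"
        using that by (auto simp: frac_le)
      then show "(hnorm H (w m \<ominus> w n))\<^sup>2 < \<epsilon>\<^sup>2" using dist[of m n] N by simp
    qed (use e in simp)
    then show "\<exists>N. \<forall>m\<ge>N. \<forall>n\<ge>N. hnorm H (w m \<ominus> w n) < \<epsilon>" by blast
  qed
  have rep: "d = cinner H v u" if vd: "(v, d) \<in> R" for v d
  proof -
    have v: "v \<in> carrier H" using Rc vd .
    have ineq: "0 \<le> 2 * Re (a * (cinner H v u - d)) + (cmod a)\<^sup>2 * (hnorm H v)\<^sup>2" for a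
    proof (rule LIMSEQ_le)
      show "(\<lambda>n. - (1 / real (Suc n))) \<longlonglongrightarrow> 0"
        using LIMSEQ_inverse_real_of_nat tendsto_minus[of "\<lambda>n. 1 / real (Suc n)" 0] by (simp add: inverse_eq_divide)
      have "(\<lambda>n. cinner H (w n) v) \<longlonglongrightarrow> cinner H u v"
        by (rule tendsto_cinner_left[OF w u v])
      then have "(\<lambda>n. cnj (cinner H (w n) v)) \<longlonglongrightarrow> cnj (cinner H u v)" by (rule tendsto_cnj)
      then have "(\<lambda>n. cinner H v (w n)) \<longlonglongrightarrow> cinner H v u"
        using cinner_commute w u(1) v by (metis (no_types, lifting) ext)
      then show "(\<lambda>n. 2 * Re (a * (cinner H v (w n) - d)) + (cmod a)\<^sup>2 * (hnorm H v)\<^sup>2)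
          \<longlonglongrightarrow> 2 * Re (a * (cinner H v u - d)) + (cmod a)\<^sup>2 * (hnorm H v)\<^sup>2"
        by (intro tendsto_intros)
      have "- (1 / real (Suc n)) \<le> 2 * Re (a * (cinner H v (w n) - d)) + (cmod a)\<^sup>2 * (hnorm H v)\<^sup>2" for n
      proof -
        have "I \<le> J (w n \<oplus> a \<odot> v, c n + a * d)"
          by (rule I_le[OF Radd[OF wc Rsmult[OF vd]]])
        also have "\<dots> = (hnorm H (w n))\<^sup>2 - 2 * Re (c n) + 2 * Re (a * cinner H v (w n))
           + (cmod a)\<^sup>2 * (hnorm H v)\<^sup>2 - 2 * Re (a * d)"
        proof -
          have "Re (cinner H (w n) (a \<odot> v)) = Re (a * cinner H v (w n))"
            using cinner_commute[of "w n" "v"] w v by (simp add: cinner_simps)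
          then show ?thesis
            using w v by (simp add: J_def hnorm_add_sq hnorm_smult power_mult_distrib)
        qed
        finally show ?thesis using Jwc[of n] by (simp add: algebra_simps)
      qed
      then show "\<exists>N. \<forall>n\<ge>N. - (1 / real (Suc n)) \<le> 2 * Re (a * (cinner H v (w n) - d)) + (cmod a)\<^sup>2 * (hnorm H v)\<^sup>2"
        by blast
    qed
    \<comment> \<open>The quadratic inequality fails for small multiples of \<open>- cnj k\<close> unless \<open>k = 0\<close>.\<close>
    define k where "k = cinner H v u - d"
    define s where "s = 1 / (1 + (hnorm H v)\<^sup>2)"
    have s: "s > 0" "s * (hnorm H v)\<^sup>2 \<le> 1" 
      by (auto simp: s_def field_simps add_pos_nonneg)
    have "0 \<le> - (2 * s * (cmod k)\<^sup>2) + s\<^sup>2 * (cmod k)\<^sup>2 * (hnorm H v)\<^sup>2"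
    proof -
      have "2 * Re (- (of_real s * cnj k) * k) = - (2 * s * (cmod k)\<^sup>2)"
        unfolding cmod_power2 by (simp add: power2_eq_square algebra_simps)
      moreover have "(cmod (- (of_real s * cnj k)))\<^sup>2 = s\<^sup>2 * (cmod k)\<^sup>2"
        using s(1) by (simp add: norm_mult power_mult_distrib)
      ultimately show ?thesis using ineq[of "- (of_real s * cnj k)"] unfolding k_def[symmetric] by simp
    qed
    also have "\<dots> = s * (cmod k)\<^sup>2 * (s * (hnorm H v)\<^sup>2 - 2)"
      by (simp add: power2_eq_square algebra_simps)
    also have "\<dots> \<le> s * (cmod k)\<^sup>2 * (-1)"
      using s by (intro mult_left_mono) auto
    finally have "s * (cmod k)\<^sup>2 \<le> 0" by simp
    then have "k = 0" using s by (simp add: mult_le_0_iff)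
    then show ?thesis by (simp add: k_def)
  qed
  have close: "\<exists>w c. (w, c) \<in> R \<and> hnorm H (u \<ominus> w) < \<epsilon>" if "\<epsilon> > 0" for \<epsilon>
  proof -
    have "\<forall>\<^sub>F n in sequentially. hnorm H (w n \<ominus> u) < \<epsilon>"
      using order_tendstoD(2)[OF u(2) that] .
    then obtain n where "hnorm H (w n \<ominus> u) < \<epsilon>" by (auto simp: eventually_sequentially)
    then show ?thesis using wc[of n] hnorm_minus_commute[OF w u(1)] by auto
  qed
  have "hnorm H u \<le> \<bar>C\<bar>"
  proof -
    have "(hnorm H u)\<^sup>2 \<le> \<bar>C\<bar> * hnorm H u"
    proof (rule LIMSEQ_le)
      have "(\<lambda>n. cmod (cinner H (w n) u)) \<longlonglongrightarrow> cmod (cinner H u u)"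
        by (intro tendsto_norm tendsto_cinner_left[OF w u u(1)])
      then show "(\<lambda>n. cmod (cinner H (w n) u)) \<longlonglongrightarrow> (hnorm H u)\<^sup>2"
        using u(1) by (simp add: cinner_self norm_power)
      have "(\<lambda>n. \<bar>C\<bar> * (hnorm H (w n \<ominus> u) + hnorm H u)) \<longlonglongrightarrow> \<bar>C\<bar> * (0 + hnorm H u)"
        by (intro tendsto_intros u)
      then show "(\<lambda>n. \<bar>C\<bar> * (hnorm H (w n \<ominus> u) + hnorm H u)) \<longlonglongrightarrow> \<bar>C\<bar> * hnorm H u" by simp
      have "cmod (cinner H (w n) u) \<le> \<bar>C\<bar> * (hnorm H (w n \<ominus> u) + hnorm H u)" for n
      proof -
        have "cmod (cinner H (w n) u) \<le> C * hnorm H (w n)"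
          using rep[OF wc[of n]] bound[OF wc[of n]] by simp
        also have "\<dots> \<le> \<bar>C\<bar> * hnorm H (w n)" using w by (intro mult_right_mono) auto
        also have "\<dots> \<le> \<bar>C\<bar> * (hnorm H (w n \<ominus> u) + hnorm H u)"
          using w u(1) hnorm_le_minus by (intro mult_left_mono) auto
        finally show ?thesis .
      qed
      then show "\<exists>N. \<forall>n\<ge>N. cmod (cinner H (w n) u) \<le> \<bar>C\<bar> * (hnorm H (w n \<ominus> u) + hnorm H u)" by blast
    qed
    then show ?thesis
      using u(1) hnorm_nonneg[OF u(1)]
        mult_right_le_imp_le[of "hnorm H u" "hnorm H u" "\<bar>C\<bar>"]
      by (cases "hnorm H u = 0") (auto simp: power2_eq_square)
  qed
  then show ?thesis using that u(1) rep close by blast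
qed

end


section \<open>Bounded operators and adjoints\<close>

lemma Bop_simps [simp]:
  "carrier (Bop H) = bounded_ops H"
  "mult (Bop H) S T = compose (carrier H) S T"
  "one (Bop H) = (\<lambda>x\<in>carrier H. x)"
  "zero (Bop H) = (\<lambda>x\<in>carrier H. \<zero>\<^bsub>H\<^esub>)"
  "add (Bop H) S T = (\<lambda>x\<in>carrier H. S x \<oplus>\<^bsub>H\<^esub> T x)"
  "smult (Bop H) c T = (\<lambda>x\<in>carrier H. c \<odot>\<^bsub>H\<^esub> T x)"
  "star (Bop H) = adjoint_op H"
  by (simp_all add: Bop_def)

lemma Kop_simps [simp]:
  "carrier (Kop H) = compact_ops H"
  "mult (Kop H) S T = compose (carrier H) S T"
  "one (Kop H) = (\<lambda>x\<in>carrier H. x)"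
  "zero (Kop H) = (\<lambda>x\<in>carrier H. \<zero>\<^bsub>H\<^esub>)"
  "add (Kop H) S T = (\<lambda>x\<in>carrier H. S x \<oplus>\<^bsub>H\<^esub> T x)"
  "smult (Kop H) c T = (\<lambda>x\<in>carrier H. c \<odot>\<^bsub>H\<^esub> T x)"
  "star (Kop H) = adjoint_op H"
  by (simp_all add: Kop_def Bop_def)

text \<open>\<open>C\<close> is a bound for the operator norm of \<open>T\<close>. Working with bounds instead of the norm itself avoids
  suprema.\<close>

definition op_bound :: "('a, 'm) hilbert_scheme \<Rightarrow> ('a \<Rightarrow> 'a) \<Rightarrow> real \<Rightarrow> bool" where
  "op_bound H T C \<longleftrightarrow> 0 \<le> C \<and> (\<forall>x\<in>carrier H. hnorm H (T x) \<le> C * hnorm H x)"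

context hilbert_space begin

lemma bounded_opsD:
  assumes "T \<in> bounded_ops H"
  shows bounded_ops_closed: "x \<in> carrier H \<Longrightarrow> T x \<in> carrier H"
    and bounded_ops_add: "x \<in> carrier H \<Longrightarrow> y \<in> carrier H \<Longrightarrow> T (x \<oplus> y) = T x \<oplus> T y"
    and bounded_ops_smult: "x \<in> carrier H \<Longrightarrow> T (c \<odot> x) = c \<odot> T x"
  using assms by (auto simp: bounded_ops_def)

lemma bounded_ops_minus:
  assumes "T \<in> bounded_ops H" "x \<in> carrier H" "y \<in> carrier H"
  shows "T (x \<ominus> y) = T x \<ominus> T y"
proof -
  have e: "u \<ominus> v = u \<oplus> (-1) \<odot> v" if "u \<in> carrier H" "v \<in> carrier H" for u v
    by (rule cinner_ext) (use that in \<open>auto simp: cinner_simps\<close>)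
  show ?thesis using assms by (simp add: e bounded_opsD)
qed

lemma bounded_ops_zero: "T \<in> bounded_ops H \<Longrightarrow> T \<zero> = \<zero>"
  using bounded_ops_smult[of T \<zero> 0] bounded_ops_closed[of T \<zero>] by simp

lemma bounded_ops_bound:
  assumes "T \<in> bounded_ops H"
  obtains C where "op_bound H T C"
proof -
  obtain C where C: "\<And>x. x \<in> carrier H \<Longrightarrow> hnorm H (T x) \<le> C * hnorm H x"
    using assms unfolding bounded_ops_def by blast
  have "op_bound H T \<bar>C\<bar>"
    unfolding op_bound_def
  proof (intro conjI ballI)
    fix x assume x: "x \<in> carrier H"
    have "C * hnorm H x \<le> \<bar>C\<bar> * hnorm H x" using x by (intro mult_right_mono) auto
    then show "hnorm H (T x) \<le> \<bar>C\<bar> * hnorm H x" using C[OF x] by simp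
  qed simp
  then show ?thesis using that by blast
qed

lemma bounded_opsI:
  assumes "T \<in> extensional (carrier H)"
    and cl: "\<And>x. x \<in> carrier H \<Longrightarrow> T x \<in> carrier H"
    and add: "\<And>x y z. x \<in> carrier H \<Longrightarrow> y \<in> carrier H \<Longrightarrow> z \<in> carrier H \<Longrightarrow>
      cinner H (T (x \<oplus> y)) z = cinner H (T x) z + cinner H (T y) z"
    and smult: "\<And>c x z. x \<in> carrier H \<Longrightarrow> z \<in> carrier H \<Longrightarrow>
      cinner H (T (c \<odot> x)) z = c * cinner H (T x) z"
    and bound: "op_bound H T C"
  shows "T \<in> bounded_ops H"
proof -
  have "T (x \<oplus> y) = T x \<oplus> T y" if "x \<in> carrier H" "y \<in> carrier H" for x y
    by (rule cinner_ext) (use that cl add in \<open>auto simp: cinner_simps\<close>)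
  moreover have "T (c \<odot> x) = c \<odot> T x" if "x \<in> carrier H" for c x
    by (rule cinner_ext) (use that cl smult in \<open>auto simp: cinner_simps\<close>)
  ultimately show ?thesis
    using assms by (auto simp: bounded_ops_def PiE_def op_bound_def)
qed

lemma bounded_ops_ext: "T \<in> bounded_ops H \<Longrightarrow> T \<in> extensional (carrier H)"
  unfolding bounded_ops_def PiE_def by blast

lemma bounded_ops_eqI:
  assumes "S \<in> bounded_ops H" "T \<in> bounded_ops H"
    and "\<And>x y. x \<in> carrier H \<Longrightarrow> y \<in> carrier H \<Longrightarrow> cinner H (S x) y = cinner H (T x) y"
  shows "S = T"
proof (rule extensionalityI[where A = "carrier H"])
  show "S x = T x" if "x \<in> carrier H" for x
    using that assms by (intro cinner_ext) (auto simp: bounded_opsD)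
qed (use assms in \<open>auto simp: bounded_ops_ext\<close>)

lemma op_boundD: "op_bound H T C \<Longrightarrow> x \<in> carrier H \<Longrightarrow> hnorm H (T x) \<le> C * hnorm H x"
  by (simp add: op_bound_def)

lemma adjoint_unique:
  assumes "T \<in> bounded_ops H" "S \<in> bounded_ops H" "S' \<in> bounded_ops H"
    and "\<And>x y. x \<in> carrier H \<Longrightarrow> y \<in> carrier H \<Longrightarrow> cinner H (T x) y = cinner H x (S y)"
    and "\<And>x y. x \<in> carrier H \<Longrightarrow> y \<in> carrier H \<Longrightarrow> cinner H (T x) y = cinner H x (S' y)"
  shows "S = S'"
proof (rule bounded_ops_eqI)
  fix x y assume "x \<in> carrier H" "y \<in> carrier H"
  then have "cinner H y (S x) = cinner H y (S' x)" using assms by metis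
  then show "cinner H (S x) y = cinner H (S' x) y"
    using \<open>x \<in> carrier H\<close> \<open>y \<in> carrier H\<close> assms(2,3) cinner_commute[of y "S x"] cinner_commute[of y "S' x"]
    by (simp add: bounded_opsD)
qed (use assms in auto)

text \<open>A bounded sesquilinear form is given by an operator in its second argument. This yields adjoints,
  for \<open>B x y = \<langle>T x, y\<rangle>\<close>, and below the weak limits of operators.\<close>

lemma adjoint_exists_form:
  assumes cl: "\<And>y x. x \<in> carrier H \<Longrightarrow> y \<in> carrier H \<Longrightarrow> cmod (B x y) \<le> C * hnorm H x * hnorm H y"
    and C: "0 \<le> C"
    and add: "\<And>x x' y. x \<in> carrier H \<Longrightarrow> x' \<in> carrier H \<Longrightarrow> y \<in> carrier H \<Longrightarrow> B (x \<oplus> x') y = B x y + B x' y"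
    and smult: "\<And>c x y. x \<in> carrier H \<Longrightarrow> y \<in> carrier H \<Longrightarrow> B (c \<odot> x) y = c * B x y"
    and add': "\<And>x y y'. x \<in> carrier H \<Longrightarrow> y \<in> carrier H \<Longrightarrow> y' \<in> carrier H \<Longrightarrow> B x (y \<oplus> y') = B x y + B x y'"
    and smult': "\<And>c x y. x \<in> carrier H \<Longrightarrow> y \<in> carrier H \<Longrightarrow> B x (c \<odot> y) = cnj c * B x y"
  obtains S where "S \<in> bounded_ops H" "op_bound H S C"
    "\<And>x y. x \<in> carrier H \<Longrightarrow> y \<in> carrier H \<Longrightarrow> B x y = cinner H x (S y)"
proof -
  have "\<exists>u\<in>carrier H. (\<forall>x\<in>carrier H. B x y = cinner H x u) \<and> hnorm H u \<le> C * hnorm H y"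
    if y: "y \<in> carrier H" for y
  proof (rule riesz_relation[of "(\<lambda>x. (x, B x y)) ` carrier H" "C * hnorm H y"])
    show "(\<zero>, 0) \<in> (\<lambda>x. (x, B x y)) ` carrier H"
      using smult[of \<zero> y 0] y by (auto simp: image_iff intro!: bexI[of _ \<zero>])
    show "cmod c \<le> C * hnorm H y * hnorm H w" if "(w, c) \<in> (\<lambda>x. (x, B x y)) ` carrier H" for w c
      using that cl[of w y] y by (auto simp: mult.commute mult.left_commute)
  qed (use y C add smult in \<open>auto simp: image_iff\<close>)
  then obtain S where S: "\<And>y. y \<in> carrier H \<Longrightarrow> S y \<in> carrier H"
    "\<And>x y. x \<in> carrier H \<Longrightarrow> y \<in> carrier H \<Longrightarrow> B x y = cinner H x (S y)"
    "\<And>y. y \<in> carrier H \<Longrightarrow> hnorm H (S y) \<le> C * hnorm H y" by metis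
  have S': "cinner H (S y) x = cnj (B x y)" if "x \<in> carrier H" "y \<in> carrier H" for x y
    using S that cinner_commute[of x "S y"] by simp
  define S0 where "S0 = restrict S (carrier H)"
  have ob: "op_bound H S0 C" using S C by (auto simp: op_bound_def S0_def)
  have "S0 \<in> bounded_ops H"
    by (rule bounded_opsI[OF _ _ _ _ ob]) (simp_all add: S0_def S S' add' smult' del: S(2))
  moreover have "B x y = cinner H x (S0 y)" if "x \<in> carrier H" "y \<in> carrier H" for x y
    using S that by (simp add: S0_def)
  ultimately show ?thesis using that ob by blast
qed

lemma adjoint_op:
  assumes T: "T \<in> bounded_ops H"
  shows adjoint_closed [simp]: "adjoint_op H T \<in> bounded_ops H"
    and adjoint: "\<And>x y. x \<in> carrier H \<Longrightarrow> y \<in> carrier H \<Longrightarrow> cinner H (T x) y = cinner H x (adjoint_op H T y)"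
    and adjoint_bound: "\<And>C. op_bound H T C \<Longrightarrow> op_bound H (adjoint_op H T) C"
proof -
  have ex: "\<exists>S\<in>bounded_ops H. op_bound H S C \<and> (\<forall>x\<in>carrier H. \<forall>y\<in>carrier H. cinner H (T x) y = cinner H x (S y))"
    if C: "op_bound H T C" for C
  proof (rule adjoint_exists_form[of "\<lambda>x y. cinner H (T x) y" C])
    fix x y assume xy: "x \<in> carrier H" "y \<in> carrier H"
    have "cmod (cinner H (T x) y) \<le> hnorm H (T x) * hnorm H y"
      using xy T by (intro cauchy_schwarz) (auto simp: bounded_opsD)
    also have "\<dots> \<le> C * hnorm H x * hnorm H y"
      using op_boundD[OF C xy(1)] xy by (intro mult_right_mono) auto
    finally show "cmod (cinner H (T x) y) \<le> C * hnorm H x * hnorm H y" .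
  qed (use C T in \<open>auto simp: op_bound_def bounded_opsD cinner_simps\<close>)
  have uniq: "adjoint_op H T = S" if "S \<in> bounded_ops H" "\<forall>x\<in>carrier H. \<forall>y\<in>carrier H. cinner H (T x) y = cinner H x (S y)" for S
    unfolding adjoint_op_def using that adjoint_unique[OF T]
    by (intro the_equality) blast+
  obtain C0 where "op_bound H T C0" using bounded_ops_bound[OF T] .
  from ex[OF this] obtain S where S: "S \<in> bounded_ops H"
    "\<forall>x\<in>carrier H. \<forall>y\<in>carrier H. cinner H (T x) y = cinner H x (S y)" by blast
  show "adjoint_op H T \<in> bounded_ops H"
    "\<And>x y. x \<in> carrier H \<Longrightarrow> y \<in> carrier H \<Longrightarrow> cinner H (T x) y = cinner H x (adjoint_op H T y)"
    using S uniq[OF S] by auto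
  show "op_bound H (adjoint_op H T) C" if "op_bound H T C" for C
    using ex[OF that] uniq by blast
qed

lemma adjoint_eqI:
  assumes "T \<in> bounded_ops H" "S \<in> bounded_ops H"
    and "\<And>x y. x \<in> carrier H \<Longrightarrow> y \<in> carrier H \<Longrightarrow> cinner H (T x) y = cinner H x (S y)"
  shows "adjoint_op H T = S"
  using adjoint_unique[OF assms(1) adjoint_closed[OF assms(1)] assms(2)] adjoint[OF assms(1)] assms(3) by blast

lemma adjoint':
  assumes "T \<in> bounded_ops H" "x \<in> carrier H" "y \<in> carrier H"
  shows "cinner H (adjoint_op H T x) y = cinner H x (T y)"
  using adjoint[OF assms(1,3,2)] assms cinner_commute[of "T y" x] cinner_commute[of y "adjoint_op H T x"]
  by (simp add: bounded_opsD)

lemma adjoint_adjoint [simp]: "T \<in> bounded_ops H \<Longrightarrow> adjoint_op H (adjoint_op H T) = T"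
  by (intro adjoint_eqI) (auto simp: adjoint')

lemma op_id [simp]: "(\<lambda>x\<in>carrier H. x) \<in> bounded_ops H"
  by (rule bounded_opsI[where C = 1]) (auto simp: op_bound_def cinner_simps)

lemma op_zero [simp]: "(\<lambda>x\<in>carrier H. \<zero>) \<in> bounded_ops H"
  by (rule bounded_opsI[where C = 0]) (auto simp: op_bound_def cinner_simps)

lemma op_bound_compose:
  "op_bound H S C \<Longrightarrow> op_bound H T D \<Longrightarrow> T \<in> bounded_ops H \<Longrightarrow> op_bound H (compose (carrier H) S T) (C * D)"
  unfolding op_bound_def compose_def
  by (auto simp: bounded_opsD mult.assoc) (meson bounded_ops_closed mult_left_mono order_trans)

lemma op_compose [simp]:
  assumes "S \<in> bounded_ops H" "T \<in> bounded_ops H"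
  shows "compose (carrier H) S T \<in> bounded_ops H"
proof -
  obtain C D where "op_bound H S C" "op_bound H T D" using assms bounded_ops_bound by metis
  from op_bound_compose[OF this] show ?thesis
    using assms by (intro bounded_opsI) (auto simp: compose_def bounded_opsD cinner_simps)
qed

lemma op_bound_add:
  assumes "op_bound H S C" "op_bound H T D" "S \<in> bounded_ops H" "T \<in> bounded_ops H"
  shows "op_bound H (\<lambda>x\<in>carrier H. S x \<oplus> T x) (C + D)"
  unfolding op_bound_def
proof (intro conjI ballI)
  fix x assume x: "x \<in> carrier H"
  have "hnorm H (S x \<oplus> T x) \<le> hnorm H (S x) + hnorm H (T x)"
    using x assms by (intro hnorm_triangle) (auto simp: bounded_opsD)
  also have "\<dots> \<le> (C + D) * hnorm H x"
    using op_boundD[OF assms(1) x] op_boundD[OF assms(2) x] by (simp add: algebra_simps)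
  finally show "hnorm H ((\<lambda>x\<in>carrier H. S x \<oplus> T x) x) \<le> (C + D) * hnorm H x" using x by simp
qed (use assms in \<open>simp add: op_bound_def\<close>)

lemma op_add [simp]:
  assumes "S \<in> bounded_ops H" "T \<in> bounded_ops H"
  shows "(\<lambda>x\<in>carrier H. S x \<oplus> T x) \<in> bounded_ops H"
proof -
  obtain C D where "op_bound H S C" "op_bound H T D" using assms bounded_ops_bound by metis
  from op_bound_add[OF this assms] show ?thesis
    using assms by (intro bounded_opsI) (auto simp: bounded_opsD cinner_simps algebra_simps)
qed

lemma op_bound_smult:
  assumes "op_bound H T C" "T \<in> bounded_ops H"
  shows "op_bound H (\<lambda>x\<in>carrier H. c \<odot> T x) (cmod c * C)"
  using assms by (auto simp: op_bound_def hnorm_smult bounded_opsD mult.assoc intro: mult_left_mono)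

lemma op_smult [simp]:
  assumes "T \<in> bounded_ops H"
  shows "(\<lambda>x\<in>carrier H. c \<odot> T x) \<in> bounded_ops H"
proof -
  obtain C where "op_bound H T C" using assms bounded_ops_bound by metis
  from op_bound_smult[OF this assms] show ?thesis
    using assms by (intro bounded_opsI) (auto simp: bounded_opsD cinner_simps algebra_simps)
qed

lemma rank_one_bound:
  assumes "x \<in> carrier H" "y \<in> carrier H"
  shows "op_bound H (rank_one H x y) (hnorm H x * hnorm H y)"
  unfolding op_bound_def
proof (intro conjI ballI)
  fix z assume z: "z \<in> carrier H"
  have "cmod (cinner H z y) * hnorm H x \<le> (hnorm H z * hnorm H y) * hnorm H x"
    using z assms cauchy_schwarz by (intro mult_right_mono) auto
  then show "hnorm H (rank_one H x y z) \<le> hnorm H x * hnorm H y * hnorm H z"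
    using z assms by (simp add: rank_one_def hnorm_smult algebra_simps)
qed (use assms in simp)

lemma op_rank_one [simp]:
  assumes "x \<in> carrier H" "y \<in> carrier H"
  shows "rank_one H x y \<in> bounded_ops H"
  using assms
  by (intro bounded_opsI[OF _ _ _ _ rank_one_bound]) (auto simp: rank_one_def cinner_simps algebra_simps)

lemma adjoint_id [simp]: "adjoint_op H (\<lambda>x\<in>carrier H. x) = (\<lambda>x\<in>carrier H. x)"
  by (rule adjoint_eqI) auto

lemma adjoint_zero [simp]: "adjoint_op H (\<lambda>x\<in>carrier H. \<zero>) = (\<lambda>x\<in>carrier H. \<zero>)"
  by (rule adjoint_eqI) auto

lemma adjoint_compose:
  "S \<in> bounded_ops H \<Longrightarrow> T \<in> bounded_ops H \<Longrightarrow>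
    adjoint_op H (compose (carrier H) S T) = compose (carrier H) (adjoint_op H T) (adjoint_op H S)"
  by (rule adjoint_eqI) (simp_all, simp_all add: compose_def bounded_opsD adjoint)

lemma adjoint_add:
  "S \<in> bounded_ops H \<Longrightarrow> T \<in> bounded_ops H \<Longrightarrow>
    adjoint_op H (\<lambda>x\<in>carrier H. S x \<oplus> T x) = (\<lambda>x\<in>carrier H. adjoint_op H S x \<oplus> adjoint_op H T x)"
  by (rule adjoint_eqI) (auto simp: bounded_opsD cinner_simps adjoint)

lemma adjoint_smult:
  "T \<in> bounded_ops H \<Longrightarrow>
    adjoint_op H (\<lambda>x\<in>carrier H. c \<odot> T x) = (\<lambda>x\<in>carrier H. cnj c \<odot> adjoint_op H T x)"
  by (rule adjoint_eqI) (auto simp: bounded_opsD cinner_simps adjoint)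

lemma adjoint_rank_one:
  "x \<in> carrier H \<Longrightarrow> y \<in> carrier H \<Longrightarrow> adjoint_op H (rank_one H x y) = rank_one H y x"
  by (rule adjoint_eqI) (simp_all, simp_all add: rank_one_def cinner_simps cinner_commute[of _ x] mult.commute)

lemma op_bound_mono: "op_bound H T C \<Longrightarrow> C \<le> D \<Longrightarrow> op_bound H T D"
  unfolding op_bound_def by (meson hnorm_nonneg mult_right_mono order_trans)

text \<open>The norm of a positive operator is bounded by its numerical range, by the Cauchy-Schwarz
  inequality for the form \<open>\<langle>T x, y\<rangle>\<close> at \<open>y = T x\<close>.\<close>

lemma positive_op_bound:
  assumes T: "T \<in> bounded_ops H" "adjoint_op H T = T"
    and pos: "\<And>x. x \<in> carrier H \<Longrightarrow> 0 \<le> Re (cinner H (T x) x)"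
    and C: "0 \<le> C" "\<And>x. x \<in> carrier H \<Longrightarrow> Re (cinner H (T x) x) \<le> C * (hnorm H x)\<^sup>2"
  shows "op_bound H T C"
  unfolding op_bound_def
proof (intro conjI ballI)
  fix x assume x: "x \<in> carrier H"
  have Tx: "T x \<in> carrier H" using T x by (simp add: bounded_opsD)
  have "(cmod (cinner H (T x) (T x)))\<^sup>2 \<le> Re (cinner H (T x) x) * Re (cinner H (T (T x)) (T x))"
  proof (rule cauchy_schwarz_form[OF module_axioms, of "\<lambda>x y. cinner H (T x) y"])
    fix x y assume xy: "x \<in> carrier H" "y \<in> carrier H"
    then have "cinner H (T y) x = cinner H y (T x)" using adjoint[OF T(1), of y x] T by simp
    also have "\<dots> = cnj (cinner H (T x) y)" using xy T by (intro cinner_commute) (auto simp: bounded_opsD)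
    finally show "cinner H (T y) x = cnj (cinner H (T x) y)" .
  qed (use x Tx T pos in \<open>auto simp: bounded_opsD cinner_simps\<close>)
  also have "\<dots> \<le> (C * (hnorm H x)\<^sup>2) * (C * (hnorm H (T x))\<^sup>2)"
    using x Tx C pos by (intro mult_mono) auto
  finally have "((hnorm H (T x))\<^sup>2)\<^sup>2 \<le> (C * hnorm H x)\<^sup>2 * (hnorm H (T x))\<^sup>2"
    using Tx cinner_self[OF Tx] by (simp add: norm_power power_mult_distrib power2_eq_square algebra_simps norm_mult del: of_real_mult)
  then have "(hnorm H (T x))\<^sup>2 \<le> (C * hnorm H x)\<^sup>2"
  proof (cases "hnorm H (T x) = 0")
    case False
    then have "0 < (hnorm H (T x))\<^sup>2" by simp
    moreover have "(hnorm H (T x))\<^sup>2 * (hnorm H (T x))\<^sup>2 \<le> (C * hnorm H x)\<^sup>2 * (hnorm H (T x))\<^sup>2"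
      using \<open>((hnorm H (T x))\<^sup>2)\<^sup>2 \<le> _\<close> by (simp only: power2_eq_square[of "(hnorm H (T x))\<^sup>2"])
    ultimately show ?thesis by (rule mult_right_le_imp_le[rotated])
  qed simp
  then show "hnorm H (T x) \<le> C * hnorm H x"
    using C x by (intro power2_le_imp_le[of "hnorm H (T x)"]) auto
qed (use C in simp)

text \<open>If a self-adjoint operator \<open>T\<close> has norm below 1, then \<open>1 - T\<close> has a bounded right inverse \<open>Z\<close>: the
  operator \<open>1 - T\<close> is bounded below, so that \<open>(1 - T) v \<mapsto> \<langle>v, g\<rangle>\<close> is a bounded functional for each \<open>g\<close>,
  and it is represented by \<open>Z g\<close>.\<close>

lemma neumann_selfadjoint:
  assumes T: "T \<in> bounded_ops H" "adjoint_op H T = T" and b: "op_bound H T c" and c: "c < 1"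
  obtains Z where "Z \<in> bounded_ops H" "\<And>y. y \<in> carrier H \<Longrightarrow> Z y = y \<oplus> T (Z y)"
proof -
  have c0: "0 \<le> c" using b by (simp add: op_bound_def)
  define D where "D x = x \<ominus> T x" for x
  have Dcl: "D x \<in> carrier H" if "x \<in> carrier H" for x using that T by (simp add: D_def bounded_opsD)
  have Dadd: "D (x \<oplus> y) = D x \<oplus> D y" if "x \<in> carrier H" "y \<in> carrier H" for x y
    using that T Dcl by (intro cinner_ext) (auto simp: D_def bounded_opsD cinner_simps)
  have Dsm: "D (a \<odot> x) = a \<odot> D x" if "x \<in> carrier H" for a x
    using that T Dcl by (intro cinner_ext) (auto simp: D_def bounded_opsD cinner_simps algebra_simps)
  have Dlow: "(1 - c) * hnorm H x \<le> hnorm H (D x)" if "x \<in> carrier H" for x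
  proof -
    have "hnorm H x \<le> hnorm H (D x) + hnorm H (T x)"
      unfolding D_def using that T by (intro hnorm_le_minus) (auto simp: bounded_opsD)
    then show ?thesis using op_boundD[OF b that] by (simp add: algebra_simps)
  qed
  have Dadj: "cinner H (D x) y = cinner H x (D y)" if "x \<in> carrier H" "y \<in> carrier H" for x y
    using that T adjoint[OF T(1), of x y] by (simp add: D_def bounded_opsD cinner_simps)
  have inj: "x = y" if "x \<in> carrier H" "y \<in> carrier H" "D x = D y" for x y
  proof -
    have "D (x \<ominus> y) = D x \<ominus> D y"
      using that(1,2) T Dcl by (intro cinner_ext) (auto simp: D_def bounded_ops_minus bounded_opsD cinner_simps)
    then have "D (x \<ominus> y) = \<zero>" using that Dcl by (simp add: minus_eq_zero_iff)
    then have "(1 - c) * hnorm H (x \<ominus> y) \<le> 0" using Dlow[of "x \<ominus> y"] that by simp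
    then have "hnorm H (x \<ominus> y) = 0"
      using c that(1,2) hnorm_nonneg[of "x \<ominus> y"] by (simp add: mult_le_0_iff order_antisym)
    then show ?thesis using that by (simp add: hnorm_eq_0 minus_eq_zero_iff)
  qed
  have "\<exists>u\<in>carrier H. D u = g \<and> hnorm H u \<le> hnorm H g / (1 - c)" if g: "g \<in> carrier H" for g
  proof (rule riesz_relation[of "(\<lambda>v. (D v, cinner H v g)) ` carrier H" "hnorm H g / (1 - c)"])
    show "(\<zero>, 0) \<in> (\<lambda>v. (D v, cinner H v g)) ` carrier H"
      using T g by (auto simp: image_iff D_def bounded_ops_zero minus_eq_zero_iff[THEN iffD2] intro!: bexI[of _ \<zero>])
    show "(w \<oplus> w', d + d') \<in> (\<lambda>v. (D v, cinner H v g)) ` carrier H"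
      if "(w, d) \<in> (\<lambda>v. (D v, cinner H v g)) ` carrier H" "(w', d') \<in> (\<lambda>v. (D v, cinner H v g)) ` carrier H" for w d w' d'
      using that Dadd g by (auto simp: image_iff cinner_simps) (metis add.m_closed cinner_add)
    show "(a \<odot> w, a * d) \<in> (\<lambda>v. (D v, cinner H v g)) ` carrier H"
      if "(w, d) \<in> (\<lambda>v. (D v, cinner H v g)) ` carrier H" for w d a
      using that Dsm g by (auto simp: image_iff cinner_simps) (metis smult_cl cinner_smult)
    show "cmod d \<le> hnorm H g / (1 - c) * hnorm H w" if wd: "(w, d) \<in> (\<lambda>v. (D v, cinner H v g)) ` carrier H" for w d
    proof -
      obtain v where v: "v \<in> carrier H" "w = D v" "d = cinner H v g" using wd by auto
      have "cmod d \<le> hnorm H v * hnorm H g" using v g cauchy_schwarz by simp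
      also have "\<dots> \<le> (hnorm H w / (1 - c)) * hnorm H g"
        using Dlow[OF v(1)] v c g by (intro mult_right_mono) (auto simp: field_simps)
      finally show ?thesis by (simp add: mult.commute)
    qed
    fix u assume u: "u \<in> carrier H" "\<And>w d. (w, d) \<in> (\<lambda>v. (D v, cinner H v g)) ` carrier H \<Longrightarrow> d = cinner H w u"
      "hnorm H u \<le> \<bar>hnorm H g / (1 - c)\<bar>"
    have "D u = g"
    proof (rule cinner_ext_right)
      fix z assume z: "z \<in> carrier H"
      then have "cinner H z g = cinner H (D z) u" by (intro u(2)) auto
      then show "cinner H z (D u) = cinner H z g" using Dadj z u(1) by simp
    qed (use u g Dcl in auto)
    then show "\<exists>u\<in>carrier H. D u = g \<and> hnorm H u \<le> hnorm H g / (1 - c)" using u g c by auto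
  qed (use Dcl in auto)
  then obtain Z where Z: "\<And>g. g \<in> carrier H \<Longrightarrow> Z g \<in> carrier H" "\<And>g. g \<in> carrier H \<Longrightarrow> D (Z g) = g"
    "\<And>g. g \<in> carrier H \<Longrightarrow> hnorm H (Z g) \<le> hnorm H g / (1 - c)" by metis
  define Z0 where "Z0 = restrict Z (carrier H)"
  have Zadd: "Z (x \<oplus> y) = Z x \<oplus> Z y" if "x \<in> carrier H" "y \<in> carrier H" for x y
    by (rule inj) (use that Z Dadd in auto)
  have Zsm: "Z (a \<odot> x) = a \<odot> Z x" if "x \<in> carrier H" for a x
    by (rule inj) (use that Z Dsm in auto)
  have "op_bound H Z0 (1 / (1 - c))" using Z c by (auto simp: op_bound_def Z0_def)
  then have "Z0 \<in> bounded_ops H"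
    by (intro bounded_opsI) (auto simp: Z0_def Z Zadd Zsm cinner_simps)
  moreover have "Z0 y = y \<oplus> T (Z0 y)" if y: "y \<in> carrier H" for y
  proof (rule cinner_ext)
    fix z assume z: "z \<in> carrier H"
    have "cinner H (D (Z y)) z = cinner H y z" using Z y by simp
    then show "cinner H (Z0 y) z = cinner H (y \<oplus> T (Z0 y)) z"
      using y z T Z by (simp add: D_def Z0_def bounded_opsD cinner_simps algebra_simps)
  qed (use y Z T in \<open>auto simp: Z0_def bounded_opsD\<close>)
  ultimately show ?thesis using that by blast
qed

end


section \<open>Isometric tensor maps and amplified operators\<close>

text \<open>The power trick: iterating \<open>a\<^sub>k\<^sup>2 \<le> a\<^sub>k\<^sub>+\<^sub>1 b\<close> and taking roots removes the constant \<open>M\<close> from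
  the growth estimate.\<close>

lemma squaring_bound:
  fixes a :: "nat \<Rightarrow> real"
  assumes nonneg: "\<And>k. 0 \<le> a k" and sq: "\<And>k. (a k)\<^sup>2 \<le> a (Suc k) * b"
    and growth: "\<And>k. a k \<le> M * D ^ (2 ^ k)" and b: "0 \<le> b" and D: "0 \<le> D"
  shows "a 0 \<le> D * b"
proof (cases "b = 0")
  case True
  then show ?thesis using sq[of 0] by simp
next
  case False
  then have b: "b > 0" using b by simp
  have pow: "(a 0 / b) ^ (2 ^ k) \<le> a k / b" for k
  proof (induction k)
    case (Suc k)
    have "(a 0 / b) ^ (2 ^ Suc k) = ((a 0 / b) ^ (2 ^ k))\<^sup>2"
      by (simp add: power_mult[symmetric] mult.commute)
    also have "\<dots> \<le> (a k / b)\<^sup>2"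
      using Suc nonneg b by (intro power_mono) auto
    also have "\<dots> \<le> a (Suc k) / b"
      using sq[of k] b by (simp add: power_divide power2_eq_square field_simps)
    finally show ?case .
  qed simp
  show ?thesis
  proof (rule ccontr)
    assume "\<not> a 0 \<le> D * b"
    then have gt: "D < a 0 / b" using b by (simp add: field_simps)
    show False
    proof (cases "D = 0")
      case True
      then show False using growth[of 0] gt nonneg[of 0] b by simp
    next
      case False
      then have D: "D > 0" using D by simp
      define r where "r = a 0 / b / D"
      have r: "r > 1" unfolding r_def less_divide_eq_1_pos[OF D] using gt .
      then obtain n where n: "M / b < r ^ n" using real_arch_pow by blast
      have "r ^ n \<le> r ^ (2 ^ n)" using r by (intro power_increasing) auto
      also have "\<dots> = (a 0 / b) ^ (2 ^ n) / D ^ (2 ^ n)" unfolding r_def by (rule power_divide)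
      also have "\<dots> \<le> (a n / b) / D ^ (2 ^ n)" using pow[of n] D by (intro divide_right_mono) auto
      also have "\<dots> \<le> (M * D ^ (2 ^ n) / b) / D ^ (2 ^ n)"
        using growth[of n] b D by (intro divide_right_mono) auto
      also have "\<dots> = M / b" using D by simp
      finally show False using n by simp
    qed
  qed
qed

text \<open>A map \<open>m\<close> that makes elementary tensors of \<open>X\<close> and \<open>K\<close> vectors of \<open>H\<close>, isometrically but
  not necessarily with dense span. Bilinearity is a consequence of the inner product formula.\<close>

locale tensor_map = X: hilbert_space X + K: hilbert_space K + H: hilbert_space H
  for X :: "('a, 'm) hilbert_scheme" and K :: "('b, 'n) hilbert_scheme"
    and H :: "('c, 'k) hilbert_scheme" +
  fixes m :: "'a \<Rightarrow> 'b \<Rightarrow> 'c"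
  assumes m_closed [simp, intro]: "x \<in> carrier X \<Longrightarrow> k \<in> carrier K \<Longrightarrow> m x k \<in> carrier H"
    and m_inner: "\<lbrakk>x \<in> carrier X; x' \<in> carrier X; k \<in> carrier K; k' \<in> carrier K\<rbrakk> \<Longrightarrow>
      cinner H (m x k) (m x' k') = cinner X x x' * cinner K k k'"
begin

lemma m_add:
  assumes "x \<in> carrier X" "x' \<in> carrier X" "k \<in> carrier K"
  shows "m (x \<oplus>\<^bsub>X\<^esub> x') k = m x k \<oplus>\<^bsub>H\<^esub> m x' k"
proof -
  let ?d = "m (x \<oplus>\<^bsub>X\<^esub> x') k \<ominus>\<^bsub>H\<^esub> (m x k \<oplus>\<^bsub>H\<^esub> m x' k)"
  have "cinner H ?d ?d = 0"
    using assms by (simp add: H.cinner_simps m_inner X.cinner_simps algebra_simps)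
  then have "?d = \<zero>\<^bsub>H\<^esub>" using assms by (intro H.cinner_eq_0) auto
  then show ?thesis using assms by (subst (asm) H.minus_eq_zero_iff) auto
qed

lemma m_smult:
  assumes "x \<in> carrier X" "k \<in> carrier K"
  shows "m (c \<odot>\<^bsub>X\<^esub> x) k = c \<odot>\<^bsub>H\<^esub> m x k"
proof -
  let ?d = "m (c \<odot>\<^bsub>X\<^esub> x) k \<ominus>\<^bsub>H\<^esub> (c \<odot>\<^bsub>H\<^esub> m x k)"
  have "cinner H ?d ?d = 0"
    using assms by (simp add: H.cinner_simps m_inner X.cinner_simps algebra_simps)
  then have "?d = \<zero>\<^bsub>H\<^esub>" using assms by (intro H.cinner_eq_0) auto
  then show ?thesis using assms by (subst (asm) H.minus_eq_zero_iff) auto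
qed

lemma m_norm: "x \<in> carrier X \<Longrightarrow> k \<in> carrier K \<Longrightarrow> hnorm H (m x k) = hnorm X x * hnorm K k"
proof -
  assume a: "x \<in> carrier X" "k \<in> carrier K"
  have "(hnorm H (m x k))\<^sup>2 = (hnorm X x * hnorm K k)\<^sup>2"
    using a m_inner[of x x k k] X.cinner_self[of x] K.cinner_self[of k]
    by (simp add: H.hnorm_sq power_mult_distrib del: of_real_power)
  then show ?thesis using a by (simp add: power2_eq_iff_nonneg)
qed

text \<open>The identity of \<open>X\<close>.\<close>

definition idX :: "'a \<Rightarrow> 'a" where "idX = (\<lambda>x\<in>carrier X. x)"

lemma idX_op [simp]: "idX \<in> bounded_ops X" by (simp add: idX_def)

lemma idX_apply [simp]: "x \<in> carrier X \<Longrightarrow> idX x = x" by (simp add: idX_def)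

text \<open>The sum of the vectors \<open>m (T x) k\<close> over a list of pairs \<open>(x, k)\<close>; for \<open>T = 1\<close> these are the elements
  of the linear span of the elementary tensors. Lists represent the sums, so that nothing has to be
  checked for well-definedness.\<close>

primrec wsum :: "('a \<Rightarrow> 'a) \<Rightarrow> ('a \<times> 'b) list \<Rightarrow> 'c" where
  "wsum T [] = \<zero>\<^bsub>H\<^esub>"
| "wsum T (p # ps) = m (T (fst p)) (snd p) \<oplus>\<^bsub>H\<^esub> wsum T ps"

text \<open>The lists of pairs of vectors of \<open>X\<close> and \<open>K\<close>.\<close>

definition pairs :: "('a \<times> 'b) list set" where "pairs = lists (carrier X \<times> carrier K)"

lemma pairs_Nil [simp]: "[] \<in> pairs" by (simp add: pairs_def)

lemma pairs_Cons [simp]: "p # ps \<in> pairs \<longleftrightarrow> fst p \<in> carrier X \<and> snd p \<in> carrier K \<and> ps \<in> pairs"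
  by (cases p) (auto simp: pairs_def)

lemma pairs_append [simp]: "ps @ qs \<in> pairs \<longleftrightarrow> ps \<in> pairs \<and> qs \<in> pairs"
  by (auto simp: pairs_def)

lemma wsum_closed [simp]: "T \<in> bounded_ops X \<Longrightarrow> ps \<in> pairs \<Longrightarrow> wsum T ps \<in> carrier H"
  by (induction ps) (auto simp: X.bounded_ops_closed)

lemma wsum_append: "T \<in> bounded_ops X \<Longrightarrow> ps \<in> pairs \<Longrightarrow> qs \<in> pairs \<Longrightarrow>
    wsum T (ps @ qs) = wsum T ps \<oplus>\<^bsub>H\<^esub> wsum T qs"
  by (induction ps) (simp_all add: X.bounded_ops_closed H.a_assoc)

lemma wsum_scale: "T \<in> bounded_ops X \<Longrightarrow> ps \<in> pairs \<Longrightarrow>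
    wsum T (map (\<lambda>(x, k). (c \<odot>\<^bsub>X\<^esub> x, k)) ps) = c \<odot>\<^bsub>H\<^esub> wsum T ps"
proof (induction ps)
  case (Cons p ps)
  have "c \<odot>\<^bsub>H\<^esub> (u \<oplus>\<^bsub>H\<^esub> v) = c \<odot>\<^bsub>H\<^esub> u \<oplus>\<^bsub>H\<^esub> c \<odot>\<^bsub>H\<^esub> v" if "u \<in> carrier H" "v \<in> carrier H" for u v
    using H.smult_r_distr[of c u v] that by simp
  then show ?case using Cons by (cases p) (simp add: X.bounded_opsD m_smult)
qed simp

lemma pairs_scale: "ps \<in> pairs \<Longrightarrow> map (\<lambda>(x, k). (c \<odot>\<^bsub>X\<^esub> x, k)) ps \<in> pairs"
  by (induction ps) auto

lemma wsum_inner_m: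
  assumes "x \<in> carrier X" "k \<in> carrier K" "T \<in> bounded_ops X" "qs \<in> pairs"
  shows "cinner H (m x k) (wsum T qs) = cinner H (m (adjoint_op X T x) k) (wsum idX qs)"
  using assms(4)
proof (induction qs)
  case (Cons q qs)
  then have "fst q \<in> carrier X" "snd q \<in> carrier K" "qs \<in> pairs" by auto
  then show ?case using Cons.IH assms
    by (simp add: H.cinner_simps m_inner X.bounded_ops_closed X.adjoint')
qed (use assms in \<open>simp add: X.bounded_ops_closed\<close>)

lemma wsum_inner:
  assumes "S \<in> bounded_ops X" "T \<in> bounded_ops X" "ps \<in> pairs" "qs \<in> pairs"
  shows "cinner H (wsum S ps) (wsum T qs)
    = cinner H (wsum (compose (carrier X) (adjoint_op X T) S) ps) (wsum idX qs)"
  using assms(3)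
proof (induction ps)
  case (Cons p ps)
  then have "fst p \<in> carrier X" "snd p \<in> carrier K" "ps \<in> pairs" by auto
  moreover have "compose (carrier X) (adjoint_op X T) S x = adjoint_op X T (S x)" if "x \<in> carrier X" for x
    using that by (simp add: compose_def)
  ultimately show ?case using Cons.IH assms wsum_inner_m[of "S (fst p)" "snd p" T qs]
    by (simp add: H.cinner_simps X.bounded_ops_closed)
qed (use assms in simp)

lemma wsum_growth:
  assumes "ps \<in> pairs"
  obtains M where "\<And>S C. S \<in> bounded_ops X \<Longrightarrow> op_bound X S C \<Longrightarrow> hnorm H (wsum S ps) \<le> M * C" 
proof -
  have "\<exists>M. \<forall>S C. S \<in> bounded_ops X \<longrightarrow> op_bound X S C \<longrightarrow> hnorm H (wsum S ps) \<le> M * C"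
    using assms
  proof (induction ps)
    case (Cons p ps)
    then obtain M where M: "\<And>S C. S \<in> bounded_ops X \<Longrightarrow> op_bound X S C \<Longrightarrow> hnorm H (wsum S ps) \<le> M * C"
      by auto
    have p: "fst p \<in> carrier X" "snd p \<in> carrier K" "ps \<in> pairs" using Cons by auto
    have "hnorm H (wsum S (p # ps)) \<le> (hnorm X (fst p) * hnorm K (snd p) + M) * C"
      if S: "S \<in> bounded_ops X" "op_bound X S C" for S C
    proof -
      have "hnorm H (wsum S (p # ps)) \<le> hnorm X (S (fst p)) * hnorm K (snd p) + hnorm H (wsum S ps)"
        using H.hnorm_triangle[of "m (S (fst p)) (snd p)" "wsum S ps"] S p
        by (simp add: m_norm X.bounded_ops_closed)
      also have "\<dots> \<le> (C * hnorm X (fst p)) * hnorm K (snd p) + M * C"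
        using M[OF S] X.op_boundD[OF S(2) p(1)] p by (intro add_mono mult_right_mono) auto
      finally show ?thesis by (simp add: algebra_simps)
    qed
    then show ?case by blast
  qed (auto intro: exI[of _ 0])
  then show ?thesis using that by blast
qed

text \<open>The operator \<open>T \<otimes> 1\<close> is bounded by the norm of \<open>T\<close> on the span of the elementary tensors.
  The numbers \<open>a k = \<parallel>(T\<^sub>k \<otimes> 1) w\<parallel>\<close> with \<open>T\<^sub>0 = T\<close> and \<open>T\<^sub>k\<^sub>+\<^sub>1 = T\<^sub>k\<^sup>* T\<^sub>k\<close> satisfy
  \<open>a k\<^sup>2 \<le> a (k + 1) \<parallel>w\<parallel>\<close>, and they grow at most like \<open>\<parallel>T\<parallel>\<close> to the power \<open>2\<^sup>k\<close>.\<close>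

lemma wsum_bound:
  assumes T: "T \<in> bounded_ops X" and C: "op_bound X T C" and ps: "ps \<in> pairs"
  shows "hnorm H (wsum T ps) \<le> C * hnorm H (wsum idX ps)"
proof -
  define S where "S = rec_nat T (\<lambda>_ S. compose (carrier X) (adjoint_op X S) S)"
  have S0: "S 0 = T" and SS: "S (Suc k) = compose (carrier X) (adjoint_op X (S k)) (S k)" for k
    by (simp_all add: S_def)
  have Sb: "S k \<in> bounded_ops X" for k by (induction k) (use T in \<open>auto simp: S0 SS\<close>)
  have SC: "op_bound X (S k) (C ^ (2 ^ k))" for k
  proof (induction k)
    case (Suc k)
    have "op_bound X (S (Suc k)) (C ^ (2 ^ k) * C ^ (2 ^ k))"
      unfolding SS using Suc Sb by (intro X.op_bound_compose X.adjoint_bound) auto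
    then show ?case by (simp add: power_add[symmetric] mult_2)
  qed (simp add: S0 C)
  obtain M where M: "\<And>S C. S \<in> bounded_ops X \<Longrightarrow> op_bound X S C \<Longrightarrow> hnorm H (wsum S ps) \<le> M * C"
    using wsum_growth[OF ps] by blast
  have "hnorm H (wsum (S 0) ps) \<le> C * hnorm H (wsum idX ps)"
  proof (rule squaring_bound[where M = M])
    fix k
    show "(hnorm H (wsum (S k) ps))\<^sup>2 \<le> hnorm H (wsum (S (Suc k)) ps) * hnorm H (wsum idX ps)"
    proof -
      have "(hnorm H (wsum (S k) ps))\<^sup>2 = Re (cinner H (wsum (S (Suc k)) ps) (wsum idX ps))"
        using Sb[of k] ps wsum_inner[of "S k" "S k" ps ps] by (simp add: H.hnorm_sq SS)
      also have "\<dots> \<le> cmod (cinner H (wsum (S (Suc k)) ps) (wsum idX ps))" by (rule complex_Re_le_cmod)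
      also have "\<dots> \<le> hnorm H (wsum (S (Suc k)) ps) * hnorm H (wsum idX ps)"
        using Sb ps by (intro H.cauchy_schwarz) auto
      finally show ?thesis .
    qed
    show "hnorm H (wsum (S k) ps) \<le> M * C ^ 2 ^ k" using M[OF Sb SC] .
  qed (use Sb ps C in \<open>auto simp: op_bound_def\<close>)
  then show ?thesis by (simp add: S0)
qed

text \<open>The orthogonal complement of the elementary tensors.\<close>

definition perp :: "'c set" where
  "perp = {h \<in> carrier H. \<forall>x\<in>carrier X. \<forall>k\<in>carrier K. cinner H (m x k) h = 0}"

lemma perp_wsum: "h \<in> perp \<Longrightarrow> ps \<in> pairs \<Longrightarrow> cinner H (wsum idX ps) h = 0"
  by (induction ps) (auto simp: perp_def H.cinner_simps)

text \<open>A vector orthogonal to the elementary tensors and to their complement is itself in this complement,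
  hence orthogonal to itself. So operators can be compared on elementary tensors and on \<open>perp\<close>,
  without any density argument.\<close>

lemma perp_zero: 
  assumes "d \<in> carrier H" "\<And>x k. x \<in> carrier X \<Longrightarrow> k \<in> carrier K \<Longrightarrow> cinner H (m x k) d = 0"
    and "\<And>h. h \<in> perp \<Longrightarrow> cinner H h d = 0"
  shows "d = \<zero>\<^bsub>H\<^esub>"
  using assms by (intro H.cinner_eq_0) (auto simp: perp_def)

lemma ops_eqI:
  assumes S: "S \<in> bounded_ops H" "S' \<in> bounded_ops H"
    and gen: "\<And>x k. x \<in> carrier X \<Longrightarrow> k \<in> carrier K \<Longrightarrow> S (m x k) = S' (m x k)"
    and perp: "\<And>h. h \<in> perp \<Longrightarrow> S h = S' h"
  shows "S = S'"
proof (rule H.bounded_ops_eqI[OF S])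
  fix g y assume gy: "g \<in> carrier H" "y \<in> carrier H"
  have d: "cinner H h (adjoint_op H S y \<ominus>\<^bsub>H\<^esub> adjoint_op H S' y) = 0"
    if "h \<in> carrier H" "S h = S' h" for h
    using that gy S H.adjoint[OF S(1), of h y] H.adjoint[OF S(2), of h y]
    by (simp add: H.cinner_simps H.bounded_ops_closed)
  have "adjoint_op H S y \<ominus>\<^bsub>H\<^esub> adjoint_op H S' y = \<zero>\<^bsub>H\<^esub>"
  proof (rule perp_zero)
    show "adjoint_op H S y \<ominus>\<^bsub>H\<^esub> adjoint_op H S' y \<in> carrier H"
      using S gy by (simp add: H.bounded_ops_closed)
  qed (use d gen perp in \<open>auto simp: perp_def\<close>)
  then have "adjoint_op H S y = adjoint_op H S' y"
    using S gy by (subst (asm) H.minus_eq_zero_iff) (auto simp: H.bounded_ops_closed)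
  then show "cinner H (S g) y = cinner H (S' g) y"
    using H.adjoint[OF S(1) gy] H.adjoint[OF S(2) gy] by simp
qed

text \<open>The unique operator that acts as \<open>T \<otimes> 1\<close> on the closed span of the elementary tensors and
  vanishes on its orthogonal complement.\<close>

definition amp :: "('a \<Rightarrow> 'a) \<Rightarrow> 'c \<Rightarrow> 'c" where
  "amp T = (THE S. S \<in> bounded_ops H \<and>
     (\<forall>x\<in>carrier X. \<forall>k\<in>carrier K. S (m x k) = m (T x) k) \<and> (\<forall>h\<in>perp. S h = \<zero>\<^bsub>H\<^esub>))"

text \<open>The functional \<open>w \<mapsto> \<langle>(T \<otimes> 1) w, g\<rangle>\<close> on the span of the elementary tensors is represented by
  a vector in the closure of that span.\<close>

lemma span_functional:
  assumes T: "T \<in> bounded_ops X" and C: "op_bound X T C" and g: "g \<in> carrier H"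
  obtains u where "u \<in> carrier H"
    "\<And>ps. ps \<in> pairs \<Longrightarrow> cinner H (wsum T ps) g = cinner H (wsum idX ps) u"
    "\<And>\<epsilon>. \<epsilon> > 0 \<Longrightarrow> \<exists>ps\<in>pairs. hnorm H (u \<ominus>\<^bsub>H\<^esub> wsum idX ps) < \<epsilon>" "hnorm H u \<le> C * hnorm H g"
proof -
  have C0: "0 \<le> C" using C by (simp add: op_bound_def)
  define R where "R = (\<lambda>ps. (wsum idX ps, cinner H (wsum T ps) g)) ` pairs"
  have R_E: "\<exists>ps\<in>pairs. w = wsum idX ps \<and> c = cinner H (wsum T ps) g" if "(w, c) \<in> R" for w c
    using that unfolding R_def by blast
  obtain u where u: "u \<in> carrier H" "\<And>w c. (w, c) \<in> R \<Longrightarrow> c = cinner H w u"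
      "\<And>\<epsilon>. \<epsilon> > 0 \<Longrightarrow> \<exists>w c. (w, c) \<in> R \<and> hnorm H (u \<ominus>\<^bsub>H\<^esub> w) < \<epsilon>" "hnorm H u \<le> \<bar>C * hnorm H g\<bar>"
  proof (rule H.riesz_relation[of R "C * hnorm H g"])
    show "R \<subseteq> carrier H \<times> UNIV" by (auto simp: R_def)
    show "(\<zero>\<^bsub>H\<^esub>, 0) \<in> R" using g by (auto simp: R_def image_iff intro!: bexI[of _ "[]"])
    show "(w \<oplus>\<^bsub>H\<^esub> w', c + c') \<in> R" if wc: "(w, c) \<in> R" "(w', c') \<in> R" for w c w' c'
    proof -
      obtain ps qs where "ps \<in> pairs" "qs \<in> pairs" "w = wsum idX ps" "c = cinner H (wsum T ps) g"
        "w' = wsum idX qs" "c' = cinner H (wsum T qs) g" using R_E wc by meson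
      then show ?thesis using g T unfolding R_def
        by (intro image_eqI[of _ _ "ps @ qs"]) (auto simp: wsum_append H.cinner_simps)
    qed
    show "(a \<odot>\<^bsub>H\<^esub> w, a * c) \<in> R" if wc: "(w, c) \<in> R" for w c a
    proof -
      obtain ps where "ps \<in> pairs" "w = wsum idX ps" "c = cinner H (wsum T ps) g"
        using R_E[OF wc] by blast
      then show ?thesis using g T pairs_scale[of ps a] unfolding R_def
        by (intro image_eqI[of _ _ "map (\<lambda>(x, k). (a \<odot>\<^bsub>X\<^esub> x, k)) ps"])
          (simp_all add: wsum_scale H.cinner_simps)
    qed
    show "cmod c \<le> C * hnorm H g * hnorm H w" if wc: "(w, c) \<in> R" for w c
    proof -
      obtain ps where ps: "ps \<in> pairs" "w = wsum idX ps" "c = cinner H (wsum T ps) g"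
        using R_E[OF wc] by blast
      have "cmod c \<le> hnorm H (wsum T ps) * hnorm H g"
        using ps T g by (simp add: H.cauchy_schwarz)
      also have "\<dots> \<le> (C * hnorm H (wsum idX ps)) * hnorm H g"
        using wsum_bound[OF T C ps(1)] g by (intro mult_right_mono) auto
      finally show ?thesis using ps by (simp add: mult.commute mult.left_commute)
    qed
  qed blast
  moreover have "cinner H (wsum T ps) g = cinner H (wsum idX ps) u" if "ps \<in> pairs" for ps
    using u(2)[of "wsum idX ps"] that unfolding R_def by blast
  moreover have "\<exists>ps\<in>pairs. hnorm H (u \<ominus>\<^bsub>H\<^esub> wsum idX ps) < \<epsilon>" if e: "\<epsilon> > 0" for \<epsilon>
  proof -
    obtain w c where w: "(w, c) \<in> R" "hnorm H (u \<ominus>\<^bsub>H\<^esub> w) < \<epsilon>" using u(3)[OF e] by blast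
    then show ?thesis using R_E[OF w(1)] by blast
  qed
  moreover have "hnorm H u \<le> C * hnorm H g" using u(4) C0 g by simp
  ultimately show ?thesis using that by blast
qed

lemma amp_exists:
  assumes T: "T \<in> bounded_ops X" and C: "op_bound X T C"
  shows "\<exists>S. S \<in> bounded_ops H \<and> op_bound H S C \<and>
     (\<forall>x\<in>carrier X. \<forall>k\<in>carrier K. S (m x k) = m (T x) k) \<and> (\<forall>h\<in>perp. S h = \<zero>\<^bsub>H\<^esub>)"
proof -
  have C0: "0 \<le> C" using C by (simp add: op_bound_def)
  have "\<exists>u\<in>carrier H. (\<forall>ps\<in>pairs. cinner H (wsum T ps) g = cinner H (wsum idX ps) u) \<and>
       (\<forall>h\<in>perp. cinner H h u = 0) \<and> hnorm H u \<le> C * hnorm H g"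
    if g: "g \<in> carrier H" for g
  proof -
    obtain u where u: "u \<in> carrier H"
      "\<And>ps. ps \<in> pairs \<Longrightarrow> cinner H (wsum T ps) g = cinner H (wsum idX ps) u"
      "\<And>\<epsilon>. \<epsilon> > 0 \<Longrightarrow> \<exists>ps\<in>pairs. hnorm H (u \<ominus>\<^bsub>H\<^esub> wsum idX ps) < \<epsilon>" "hnorm H u \<le> C * hnorm H g"
      using span_functional[OF T C g] by blast
    have "cinner H h u = 0" if h: "h \<in> perp" for h
    proof (rule ccontr)
      assume nz: "cinner H h u \<noteq> 0"
      have hc: "h \<in> carrier H" using h by (simp add: perp_def)
      define \<epsilon> where "\<epsilon> = cmod (cinner H h u) / (hnorm H h + 1)"
      have e: "\<epsilon> > 0" using nz hc by (auto simp: \<epsilon>_def intro!: divide_pos_pos add_nonneg_pos)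
      obtain ps where ps: "ps \<in> pairs" "hnorm H (u \<ominus>\<^bsub>H\<^esub> wsum idX ps) < \<epsilon>"
        using u(3)[OF e] by blast
      have "cinner H h (wsum idX ps) = 0"
        using perp_wsum[OF h ps(1)] H.cinner_commute[of "wsum idX ps" h] hc ps by simp
      then have "cmod (cinner H h u) = cmod (cinner H h (u \<ominus>\<^bsub>H\<^esub> wsum idX ps))"
        using u hc ps by (simp add: H.cinner_simps)
      also have "\<dots> \<le> hnorm H h * hnorm H (u \<ominus>\<^bsub>H\<^esub> wsum idX ps)"
        using u hc ps by (intro H.cauchy_schwarz) auto
      also have "\<dots> \<le> hnorm H h * \<epsilon>" using ps hc by (intro mult_left_mono) auto
      also have "\<dots> < (hnorm H h + 1) * \<epsilon>" using e by simp
      also have "\<dots> = cmod (cinner H h u)"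
        using H.hnorm_nonneg[OF hc] unfolding \<epsilon>_def by simp
      finally show False by simp
    qed
    then show ?thesis using u by blast
  qed
  then obtain U where U: "\<And>g. g \<in> carrier H \<Longrightarrow> U g \<in> carrier H"
    and U1: "\<And>g ps. g \<in> carrier H \<Longrightarrow> ps \<in> pairs \<Longrightarrow> cinner H (wsum T ps) g = cinner H (wsum idX ps) (U g)"
    and U2: "\<And>g h. g \<in> carrier H \<Longrightarrow> h \<in> perp \<Longrightarrow> cinner H h (U g) = 0"
    and U3: "\<And>g. g \<in> carrier H \<Longrightarrow> hnorm H (U g) \<le> C * hnorm H g" by metis
  have U1': "cinner H (m x k) (U g) = cinner H (m (T x) k) g"
    if "x \<in> carrier X" "k \<in> carrier K" "g \<in> carrier H" for x k g
    using U1[of g "[(x, k)]"] that T by (simp add: X.bounded_ops_closed)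
  have uniq: "u = v" if uv: "u \<in> carrier H" "v \<in> carrier H"
    "\<And>x k. x \<in> carrier X \<Longrightarrow> k \<in> carrier K \<Longrightarrow> cinner H (m x k) u = cinner H (m x k) v"
    "\<And>h. h \<in> perp \<Longrightarrow> cinner H h u = cinner H h v" for u v
  proof -
    have "u \<ominus>\<^bsub>H\<^esub> v = \<zero>\<^bsub>H\<^esub>"
      using uv by (intro perp_zero) (auto simp: H.cinner_simps perp_def)
    then show ?thesis using uv by (subst (asm) H.minus_eq_zero_iff) auto
  qed
  have pc: "h \<in> perp \<Longrightarrow> h \<in> carrier H" for h by (simp add: perp_def)
  have Uadd: "U (g \<oplus>\<^bsub>H\<^esub> g') = U g \<oplus>\<^bsub>H\<^esub> U g'" if "g \<in> carrier H" "g' \<in> carrier H" for g g'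
    by (rule uniq) (use that T in \<open>auto simp: U U1' U2 H.cinner_simps X.bounded_ops_closed pc\<close>)
  have Usm: "U (c \<odot>\<^bsub>H\<^esub> g) = c \<odot>\<^bsub>H\<^esub> U g" if "g \<in> carrier H" for c g
    by (rule uniq) (use that T in \<open>auto simp: U U1' U2 H.cinner_simps X.bounded_ops_closed pc\<close>)
  \<comment> \<open>\<open>U\<close> is the adjoint of the operator in question.\<close>
  define U0 where "U0 = restrict U (carrier H)"
  have U0b: "op_bound H U0 C" using U3 C0 by (auto simp: op_bound_def U0_def)
  have U0: "U0 \<in> bounded_ops H"
    by (rule H.bounded_opsI[OF _ _ _ _ U0b]) (auto simp: U0_def U Uadd Usm H.cinner_simps)
  have "adjoint_op H U0 (m x k) = m (T x) k" if "x \<in> carrier X" "k \<in> carrier K" for x k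
  proof (rule H.cinner_ext)
    fix g assume g: "g \<in> carrier H"
    show "cinner H (adjoint_op H U0 (m x k)) g = cinner H (m (T x) k) g"
      using H.adjoint'[OF U0, of "m x k" g] g that U1' by (simp add: U0_def)
  qed (use that U0 T in \<open>auto simp: H.bounded_ops_closed X.bounded_ops_closed\<close>)
  moreover have "adjoint_op H U0 h = \<zero>\<^bsub>H\<^esub>" if h: "h \<in> perp" for h
  proof (rule H.cinner_ext)
    fix g assume g: "g \<in> carrier H"
    show "cinner H (adjoint_op H U0 h) g = cinner H \<zero>\<^bsub>H\<^esub> g"
      using H.adjoint'[OF U0, of h g] g pc[OF h] U2[OF g h] by (simp add: U0_def)
  qed (use pc[OF h] U0 in \<open>auto simp: H.bounded_ops_closed\<close>)
  ultimately show ?thesis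
    using H.adjoint_closed[OF U0] H.adjoint_bound[OF U0 U0b] by blast
qed

lemma amp_eqI:
  assumes "T \<in> bounded_ops X" "S \<in> bounded_ops H"
    "\<And>x k. x \<in> carrier X \<Longrightarrow> k \<in> carrier K \<Longrightarrow> S (m x k) = m (T x) k" "\<And>h. h \<in> perp \<Longrightarrow> S h = \<zero>\<^bsub>H\<^esub>"
  shows "amp T = S"
  unfolding amp_def
proof (rule the_equality)
  fix S' assume "S' \<in> bounded_ops H \<and>
     (\<forall>x\<in>carrier X. \<forall>k\<in>carrier K. S' (m x k) = m (T x) k) \<and> (\<forall>h\<in>perp. S' h = \<zero>\<^bsub>H\<^esub>)"
  then show "S' = S" using assms by (intro ops_eqI) auto
qed (use assms in auto)

lemma amp:
  assumes T: "T \<in> bounded_ops X"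
  shows amp_closed [simp]: "amp T \<in> bounded_ops H"
    and amp_m [simp]: "\<And>x k. x \<in> carrier X \<Longrightarrow> k \<in> carrier K \<Longrightarrow> amp T (m x k) = m (T x) k"
    and amp_perp [simp]: "\<And>h. h \<in> perp \<Longrightarrow> amp T h = \<zero>\<^bsub>H\<^esub>"
    and amp_bound: "\<And>C. op_bound X T C \<Longrightarrow> op_bound H (amp T) C"
proof -
  have *: "\<exists>S. S \<in> bounded_ops H \<and> op_bound H S C \<and>
     (\<forall>x\<in>carrier X. \<forall>k\<in>carrier K. S (m x k) = m (T x) k) \<and> (\<forall>h\<in>perp. S h = \<zero>\<^bsub>H\<^esub>) \<and> amp T = S"
    if "op_bound X T C" for C
    using amp_exists[OF T that] amp_eqI[OF T] by blast
  obtain C where "op_bound X T C" using X.bounded_ops_bound[OF T] .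
  from *[OF this] show "amp T \<in> bounded_ops H"
    "\<And>x k. x \<in> carrier X \<Longrightarrow> k \<in> carrier K \<Longrightarrow> amp T (m x k) = m (T x) k"
    "\<And>h. h \<in> perp \<Longrightarrow> amp T h = \<zero>\<^bsub>H\<^esub>" by auto
  show "\<And>C. op_bound X T C \<Longrightarrow> op_bound H (amp T) C" using * by auto
qed

lemma perp_closed: "h \<in> perp \<Longrightarrow> h \<in> carrier H"
  by (simp add: perp_def)

lemma amp_adjoint:
  assumes T: "T \<in> bounded_ops X"
  shows "amp (adjoint_op X T) = adjoint_op H (amp T)"
proof (rule amp_eqI)
  have A: "amp T \<in> bounded_ops H" using T by simp
  have gen: "cinner H (m x k) (adjoint_op H (amp T) g) = cinner H (m (T x) k) g"
    if "x \<in> carrier X" "k \<in> carrier K" "g \<in> carrier H" for x k g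
    using H.adjoint[OF A, of "m x k" g] that T by simp
  have per: "cinner H h (adjoint_op H (amp T) g) = 0" if "h \<in> perp" "g \<in> carrier H" for h g
    using H.adjoint[OF A, of h g] that T perp_closed[OF that(1)] by simp
  fix x k assume xk: "x \<in> carrier X" "k \<in> carrier K"
  have "adjoint_op H (amp T) (m x k) \<ominus>\<^bsub>H\<^esub> m (adjoint_op X T x) k = \<zero>\<^bsub>H\<^esub>"
  proof (rule perp_zero)
    show "cinner H (m y l) (adjoint_op H (amp T) (m x k) \<ominus>\<^bsub>H\<^esub> m (adjoint_op X T x) k) = 0"
      if "y \<in> carrier X" "l \<in> carrier K" for y l
      using that xk T A X.adjoint[OF T, of y x]
      by (simp add: H.cinner_simps gen m_inner X.bounded_ops_closed H.bounded_ops_closed)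
    show "cinner H h (adjoint_op H (amp T) (m x k) \<ominus>\<^bsub>H\<^esub> m (adjoint_op X T x) k) = 0" if h: "h \<in> perp" for h
    proof -
      have "cinner H h (m (adjoint_op X T x) k) = cnj (cinner H (m (adjoint_op X T x) k) h)"
        using xk T h by (intro H.cinner_commute) (auto simp: perp_closed X.bounded_ops_closed)
      also have "\<dots> = 0" using h xk T by (simp add: perp_def X.bounded_ops_closed)
      finally show ?thesis
        using h xk T A by (simp add: per H.cinner_simps perp_closed X.bounded_ops_closed H.bounded_ops_closed)
    qed
  qed (use xk T A in \<open>simp add: X.bounded_ops_closed H.bounded_ops_closed\<close>)
  then show "adjoint_op H (amp T) (m x k) = m (adjoint_op X T x) k"
    using xk T A by (subst (asm) H.minus_eq_zero_iff) (simp_all add: X.bounded_ops_closed H.bounded_ops_closed)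
next
  have A: "amp T \<in> bounded_ops H" using T by simp
  fix h assume h: "h \<in> perp"
  show "adjoint_op H (amp T) h = \<zero>\<^bsub>H\<^esub>"
  proof (rule perp_zero)
    show "cinner H (m y l) (adjoint_op H (amp T) h) = 0" if "y \<in> carrier X" "l \<in> carrier K" for y l
      using H.adjoint[OF A, of "m y l" h] h that T by (simp add: perp_def X.bounded_ops_closed)
    show "cinner H g (adjoint_op H (amp T) h) = 0" if "g \<in> perp" for g
      using H.adjoint[OF A, of g h] h that T by (simp add: perp_closed)
  qed (use h A in \<open>simp add: H.bounded_ops_closed perp_closed\<close>)
qed (use T in auto)

lemma amp_compose:
  assumes S: "S \<in> bounded_ops X" and T: "T \<in> bounded_ops X"
  shows "amp (compose (carrier X) S T) = compose (carrier H) (amp S) (amp T)"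
  by (rule amp_eqI)
    (use S T in \<open>simp_all, simp_all add: compose_def X.bounded_ops_closed perp_closed H.bounded_ops_zero\<close>)

lemma amp_add:
  assumes S: "S \<in> bounded_ops X" and T: "T \<in> bounded_ops X"
  shows "amp (\<lambda>x\<in>carrier X. S x \<oplus>\<^bsub>X\<^esub> T x) = (\<lambda>h\<in>carrier H. amp S h \<oplus>\<^bsub>H\<^esub> amp T h)"
  by (rule amp_eqI) (use S T in \<open>simp_all add: m_add X.bounded_ops_closed perp_closed\<close>)

lemma amp_smult:
  assumes T: "T \<in> bounded_ops X"
  shows "amp (\<lambda>x\<in>carrier X. c \<odot>\<^bsub>X\<^esub> T x) = (\<lambda>h\<in>carrier H. c \<odot>\<^bsub>H\<^esub> amp T h)"
  by (rule amp_eqI)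
    (use T H.smult_r_null[of c] in \<open>simp_all add: m_smult X.bounded_ops_closed perp_closed\<close>)

text \<open>The adjoint of \<open>x \<mapsto> m x k\<close>, evaluated at a vector.\<close>

lemma slice_adjoint:
  assumes "k \<in> carrier K" "g \<in> carrier H"
  obtains u where "u \<in> carrier X" "\<And>x. x \<in> carrier X \<Longrightarrow> cinner H (m x k) g = cinner X x u"
proof (rule X.riesz_relation[of "(\<lambda>x. (x, cinner H (m x k) g)) ` carrier X" "hnorm K k * hnorm H g"])
  have m0: "m \<zero>\<^bsub>X\<^esub> k = \<zero>\<^bsub>H\<^esub>" using m_smult[of "\<zero>\<^bsub>X\<^esub>" k 0] assms by simp
  show "(\<zero>\<^bsub>X\<^esub>, 0) \<in> (\<lambda>x. (x, cinner H (m x k) g)) ` carrier X"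
    using assms m0 by (auto simp: image_iff intro!: bexI[of _ "\<zero>\<^bsub>X\<^esub>"])
  show "cmod c \<le> hnorm K k * hnorm H g * hnorm X w" if "(w, c) \<in> (\<lambda>x. (x, cinner H (m x k) g)) ` carrier X" for w c
    using that assms H.cauchy_schwarz[of "m w k" g] by (auto simp: m_norm mult_ac)
qed (use assms that in \<open>auto simp: m_add m_smult H.cinner_simps image_iff\<close>)

end


section \<open>Positivity and normality of the amplification\<close>

lemma sa_order_simps [simp]:
  "T \<in> carrier (sa_order H) \<longleftrightarrow> T \<in> bounded_ops H \<and> adjoint_op H T = T"
  "S \<sqsubseteq>\<^bsub>sa_order H\<^esub> T \<longleftrightarrow> (\<forall>x\<in>carrier H. Re (cinner H (S x) x) \<le> Re (cinner H (T x) x))"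
  by (auto simp: sa_order_def)

context hilbert_space begin

text \<open>The polarization of a quadratic form \<open>q\<close>.\<close>

definition pol :: "('a \<Rightarrow> complex) \<Rightarrow> 'a \<Rightarrow> 'a \<Rightarrow> complex" where
  "pol q x y = (q (x \<oplus> y) - q (x \<ominus> y) + \<i> * q (x \<oplus> \<i> \<odot> y) - \<i> * q (x \<ominus> \<i> \<odot> y)) / 4"

lemma polarization:
  "T \<in> bounded_ops H \<Longrightarrow> x \<in> carrier H \<Longrightarrow> y \<in> carrier H \<Longrightarrow>
    cinner H (T x) y = pol (\<lambda>z. cinner H (T z) z) x y"
  by (simp add: pol_def bounded_opsD bounded_ops_minus cinner_simps algebra_simps)

lemma selfadjoint_form:
  assumes "T \<in> bounded_ops H" "adjoint_op H T = T" "x \<in> carrier H"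
  shows "cinner H (T x) x = of_real (Re (cinner H (T x) x))"
proof -
  have "cinner H (T x) x = cnj (cinner H (T x) x)"
    using adjoint[OF assms(1,3,3)] assms cinner_commute[of "T x" x] by (simp add: bounded_opsD)
  then show ?thesis by (auto simp: complex_eq_iff)
qed

lemma selfadjoint_eqI:
  assumes "S \<in> bounded_ops H" "adjoint_op H S = S" "T \<in> bounded_ops H" "adjoint_op H T = T"
    and "\<And>x. x \<in> carrier H \<Longrightarrow> Re (cinner H (S x) x) = Re (cinner H (T x) x)"
  shows "S = T"
proof (rule bounded_ops_eqI[OF assms(1,3)])
  have e: "cinner H (S z) z = cinner H (T z) z" if "z \<in> carrier H" for z
    using selfadjoint_form assms that by metis
  fix x y assume "x \<in> carrier H" "y \<in> carrier H"
  then show "cinner H (S x) y = cinner H (T x) y"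
    by (subst polarization[OF assms(1)], simp_all, subst polarization[OF assms(3)])
      (simp_all add: pol_def e)
qed

text \<open>The difference of two operators, written with the sum and the scalar multiples of \<open>Bop H\<close>, so that
  homomorphisms respect it by their definition.\<close>

definition op_minus :: "('a \<Rightarrow> 'a) \<Rightarrow> ('a \<Rightarrow> 'a) \<Rightarrow> 'a \<Rightarrow> 'a" where
  "op_minus S T = (\<lambda>x\<in>carrier H. S x \<oplus> (\<lambda>x\<in>carrier H. (-1) \<odot> T x) x)"

lemma op_minus_closed [simp]: "S \<in> bounded_ops H \<Longrightarrow> T \<in> bounded_ops H \<Longrightarrow> op_minus S T \<in> bounded_ops H"
  unfolding op_minus_def by (intro op_add op_smult)

lemma op_minus_apply: "S \<in> bounded_ops H \<Longrightarrow> T \<in> bounded_ops H \<Longrightarrow> x \<in> carrier H \<Longrightarrow>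
    op_minus S T x = S x \<ominus> T x"
  unfolding op_minus_def by (rule cinner_ext) (auto simp: cinner_simps bounded_opsD)

lemma op_minus_adjoint: "S \<in> bounded_ops H \<Longrightarrow> T \<in> bounded_ops H \<Longrightarrow>
    adjoint_op H (op_minus S T) = op_minus (adjoint_op H S) (adjoint_op H T)"
  by (rule adjoint_eqI) (auto simp: op_minus_apply cinner_simps bounded_opsD adjoint)

text \<open>The filter of the sections of a directed set of self-adjoint operators.\<close>

definition section_filter :: "('a \<Rightarrow> 'a) set \<Rightarrow> ('a \<Rightarrow> 'a) filter" where
  "section_filter D = (INF T\<in>D. principal {T' \<in> D. T \<sqsubseteq>\<^bsub>sa_order H\<^esub> T'})"

lemma eventually_section_filter:
  assumes "D \<noteq> {}" and dir: "\<forall>S1\<in>D. \<forall>S2\<in>D. \<exists>S3\<in>D. S1 \<sqsubseteq>\<^bsub>sa_order H\<^esub> S3 \<and> S2 \<sqsubseteq>\<^bsub>sa_order H\<^esub> S3"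
  shows "eventually P (section_filter D) \<longleftrightarrow> (\<exists>T\<in>D. \<forall>T'\<in>D. T \<sqsubseteq>\<^bsub>sa_order H\<^esub> T' \<longrightarrow> P T')"
  unfolding section_filter_def
proof (subst eventually_INF_base[OF assms(1)])
  fix S1 S2 assume "S1 \<in> D" "S2 \<in> D"
  then obtain S3 where S3: "S3 \<in> D" "S1 \<sqsubseteq>\<^bsub>sa_order H\<^esub> S3" "S2 \<sqsubseteq>\<^bsub>sa_order H\<^esub> S3" using dir by blast
  have "{T' \<in> D. S3 \<sqsubseteq>\<^bsub>sa_order H\<^esub> T'} \<subseteq> {T' \<in> D. S1 \<sqsubseteq>\<^bsub>sa_order H\<^esub> T'} \<inter> {T' \<in> D. S2 \<sqsubseteq>\<^bsub>sa_order H\<^esub> T'}"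
    using S3 by (auto intro: order_trans)
  then show "\<exists>x\<in>D. principal {T' \<in> D. x \<sqsubseteq>\<^bsub>sa_order H\<^esub> T'}
      \<le> inf (principal {T' \<in> D. S1 \<sqsubseteq>\<^bsub>sa_order H\<^esub> T'}) (principal {T' \<in> D. S2 \<sqsubseteq>\<^bsub>sa_order H\<^esub> T'})"
    using S3(1) by (intro bexI[of _ S3]) auto
qed (auto simp: eventually_principal)

text \<open>The least upper bound of an upward directed set of self-adjoint operators is its weak limit: the
  weak limit exists as an operator since it is given by a bounded form, and it is an upper bound whose
  quadratic form is the pointwise supremum.\<close>

lemma lub_weak_limit:
  assumes D: "D \<subseteq> carrier (sa_order H)" "D \<noteq> {}"
    and dir: "\<forall>S1\<in>D. \<forall>S2\<in>D. \<exists>S3\<in>D. S1 \<sqsubseteq>\<^bsub>sa_order H\<^esub> S3 \<and> S2 \<sqsubseteq>\<^bsub>sa_order H\<^esub> S3"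
    and lub: "least (sa_order H) S (Upper (sa_order H) D)"
    and x: "x \<in> carrier H" and y: "y \<in> carrier H"
  shows "((\<lambda>T. cinner H (T x) y) \<longlongrightarrow> cinner H (S x) y) (section_filter D)"
proof -
  note ev = eventually_section_filter[OF D(2) dir]
  have Db: "T \<in> bounded_ops H" "adjoint_op H T = T" if "T \<in> D" for T using D that by auto
  have S: "S \<in> bounded_ops H" "adjoint_op H S = S" using least_closed[OF lub] by auto
  have upS: "Re (cinner H (T z) z) \<le> Re (cinner H (S z) z)" if "T \<in> D" "z \<in> carrier H" for T z
    using least_Upper_above[OF lub that(1) D(1)] that(2) by simp
  have leastS: "Re (cinner H (S z) z) \<le> Re (cinner H (V z) z)"
    if "V \<in> bounded_ops H" "adjoint_op H V = V" "z \<in> carrier H"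
      "\<And>T z. T \<in> D \<Longrightarrow> z \<in> carrier H \<Longrightarrow> Re (cinner H (T z) z) \<le> Re (cinner H (V z) z)" for V z
    using lub that by (auto simp: least_def Upper_def)
  define F where "F = section_filter D"
  have Fbot: "F \<noteq> bot"
    using D(2) unfolding trivial_limit_def F_def ev by auto
  have evD: "eventually (\<lambda>T. T \<in> D) F" unfolding F_def ev using D(2) by auto
  define s where "s z = (SUP T\<in>D. Re (cinner H (T z) z))" for z
  have bdd: "bdd_above ((\<lambda>T. Re (cinner H (T z) z)) ` D)" if "z \<in> carrier H" for z
    using upS that by (intro bdd_aboveI2) blast
  have T_le_s: "Re (cinner H (T z) z) \<le> s z" if "T \<in> D" "z \<in> carrier H" for T z
    unfolding s_def using bdd that by (intro cSUP_upper) auto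
  have s_le_S: "s z \<le> Re (cinner H (S z) z)" if "z \<in> carrier H" for z
    unfolding s_def using upS D(2) that by (intro cSUP_least) auto
  have lim_s: "((\<lambda>T. Re (cinner H (T z) z)) \<longlongrightarrow> s z) F" if z: "z \<in> carrier H" for z
  proof (rule order_tendstoI)
    fix a assume "a < s z"
    then obtain T where "T \<in> D" "a < Re (cinner H (T z) z)"
      unfolding s_def using less_cSUP_iff[OF D(2) bdd[OF z]] by blast
    then show "\<forall>\<^sub>F T in F. a < Re (cinner H (T z) z)"
      unfolding F_def ev using z by (force intro: less_le_trans)
  next
    fix a assume "s z < a"
    then show "\<forall>\<^sub>F T in F. Re (cinner H (T z) z) < a"
      using T_le_s z by (intro eventually_mono[OF evD]) (force intro: le_less_trans)
  qed
  \<comment> \<open>\<open>l\<close> is the form of the weak limit.\<close>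
  define l where "l x y = pol (\<lambda>z. of_real (s z)) x y" for x y
  have lim_l: "((\<lambda>T. cinner H (T x) y) \<longlongrightarrow> l x y) F" if xy: "x \<in> carrier H" "y \<in> carrier H" for x y
  proof -
    have "((\<lambda>T. pol (\<lambda>z. of_real (Re (cinner H (T z) z))) x y) \<longlongrightarrow> l x y) F"
      unfolding l_def pol_def using xy by (intro tendsto_intros lim_s) auto
    moreover have "\<forall>\<^sub>F T in F. pol (\<lambda>z. of_real (Re (cinner H (T z) z))) x y = cinner H (T x) y"
      using evD
    proof eventually_elim
      case (elim T)
      have "cinner H (T z) z = of_real (Re (cinner H (T z) z))" if "z \<in> carrier H" for z
        using selfadjoint_form Db[OF elim] that by blast
      then show ?case
        using polarization[OF Db(1)[OF elim] xy] xy by (simp add: pol_def)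
    qed
    ultimately show ?thesis by (rule Lim_transform_eventually)
  qed
  have l_eqI: "l x y = b" if "x \<in> carrier H" "y \<in> carrier H" "((\<lambda>T. cinner H (T x) y) \<longlongrightarrow> b) F" for x y b
    using tendsto_unique[OF Fbot lim_l[OF that(1,2)] that(3)] .
  have trans: "((\<lambda>T. g T) \<longlongrightarrow> c) F"
    if "((\<lambda>T. f T) \<longlongrightarrow> c) F" "\<And>T. T \<in> D \<Longrightarrow> f T = g T" for f g :: "('a \<Rightarrow> 'a) \<Rightarrow> complex" and c
    using that(1) by (rule Lim_transform_eventually) (use evD that(2) in \<open>auto elim: eventually_mono\<close>)
  obtain T0 where T0: "T0 \<in> D" using D(2) by blast
  obtain C0 where C0: "op_bound H T0 C0" using bounded_ops_bound[OF Db(1)[OF T0]] .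
  obtain C1 where C1: "op_bound H (op_minus S T0) C1"
    using bounded_ops_bound[OF op_minus_closed[OF S(1) Db(1)[OF T0]]] .
  have C01: "0 \<le> C0" "0 \<le> C1" using C0 C1 by (auto simp: op_bound_def)
  \<comment> \<open>The operators above \<open>T0\<close> are uniformly bounded, since \<open>0 \<le> T - T0 \<le> S - T0\<close>.\<close>
  have Tbound: "hnorm H (T z) \<le> (C1 + C0) * hnorm H z"
    if T: "T \<in> D" "T0 \<sqsubseteq>\<^bsub>sa_order H\<^esub> T" and z: "z \<in> carrier H" for T z
  proof -
    note b = Db(1)[OF T(1)] Db(1)[OF T0]
    have "op_bound H (op_minus T T0) C1"
    proof (rule positive_op_bound)
      fix z assume z: "z \<in> carrier H"
      show "0 \<le> Re (cinner H (op_minus T T0 z) z)"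
        using T z b by (simp add: op_minus_apply cinner_simps bounded_opsD)
      have "Re (cinner H (op_minus T T0 z) z) \<le> Re (cinner H (op_minus S T0 z) z)"
        using upS[OF T(1) z] z b S by (simp add: op_minus_apply cinner_simps bounded_opsD)
      also have "\<dots> \<le> cmod (cinner H (op_minus S T0 z) z)" by (rule complex_Re_le_cmod)
      also have "\<dots> \<le> hnorm H (op_minus S T0 z) * hnorm H z"
        using z b S by (intro cauchy_schwarz) (auto simp: op_minus_apply bounded_opsD)
      also have "\<dots> \<le> (C1 * hnorm H z) * hnorm H z"
        using op_boundD[OF C1 z] z by (intro mult_right_mono) auto
      finally show "Re (cinner H (op_minus T T0 z) z) \<le> C1 * (hnorm H z)\<^sup>2"
        by (simp add: power2_eq_square mult.assoc)
    qed (use b Db T T0 C01 in \<open>auto simp: op_minus_adjoint\<close>)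
    then have "hnorm H (T z \<ominus> T0 z) \<le> C1 * hnorm H z"
      using op_boundD[of "op_minus T T0" C1 z] z b by (simp add: op_minus_apply)
    moreover have "hnorm H (T z) \<le> hnorm H (T z \<ominus> T0 z) + hnorm H (T0 z)"
      using z b by (intro hnorm_le_minus) (auto simp: bounded_opsD)
    ultimately show ?thesis using op_boundD[OF C0 z] by (simp add: algebra_simps)
  qed
  have lbound: "cmod (l x y) \<le> (C1 + C0) * hnorm H x * hnorm H y" if xy: "x \<in> carrier H" "y \<in> carrier H" for x y
  proof (rule tendsto_upperbound[OF tendsto_norm[OF lim_l[OF xy]] _ Fbot])
    have "cmod (cinner H (T x) y) \<le> (C1 + C0) * hnorm H x * hnorm H y"
      if T: "T \<in> D" "T0 \<sqsubseteq>\<^bsub>sa_order H\<^esub> T" for T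
    proof -
      have "cmod (cinner H (T x) y) \<le> hnorm H (T x) * hnorm H y"
        using xy Db(1)[OF T(1)] by (intro cauchy_schwarz) (auto simp: bounded_opsD)
      also have "\<dots> \<le> (C1 + C0) * hnorm H x * hnorm H y"
        using Tbound[OF T xy(1)] xy by (intro mult_right_mono) auto
      finally show ?thesis .
    qed
    then show "\<forall>\<^sub>F T in F. cmod (cinner H (T x) y) \<le> (C1 + C0) * hnorm H x * hnorm H y"
      unfolding F_def ev using T0 by blast
  qed
  obtain V where V: "V \<in> bounded_ops H" "\<And>x y. x \<in> carrier H \<Longrightarrow> y \<in> carrier H \<Longrightarrow> l x y = cinner H x (V y)"
  proof (rule adjoint_exists_form[of l "C1 + C0"])
    fix x x' y assume xy: "x \<in> carrier H" "x' \<in> carrier H" "y \<in> carrier H"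
    show "l (x \<oplus> x') y = l x y + l x' y"
    proof (rule l_eqI)
      show "((\<lambda>T. cinner H (T (x \<oplus> x')) y) \<longlongrightarrow> l x y + l x' y) F"
        by (rule trans[OF tendsto_add[OF lim_l lim_l]]) (use xy Db in \<open>auto simp: bounded_opsD cinner_simps\<close>)
    qed (use xy in auto)
    show "l y (x \<oplus> x') = l y x + l y x'"
    proof (rule l_eqI)
      show "((\<lambda>T. cinner H (T y) (x \<oplus> x')) \<longlongrightarrow> l y x + l y x') F"
        by (rule trans[OF tendsto_add[OF lim_l lim_l]]) (use xy Db in \<open>auto simp: bounded_opsD cinner_simps\<close>)
    qed (use xy in auto)
  next
    fix c x y assume xy: "x \<in> carrier H" "y \<in> carrier H"
    show "l (c \<odot> x) y = c * l x y"
    proof (rule l_eqI)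
      show "((\<lambda>T. cinner H (T (c \<odot> x)) y) \<longlongrightarrow> c * l x y) F"
        by (rule trans[OF tendsto_mult_left[OF lim_l]]) (use xy Db in \<open>auto simp: bounded_opsD cinner_simps\<close>)
    qed (use xy in auto)
    show "l x (c \<odot> y) = cnj c * l x y"
    proof (rule l_eqI)
      show "((\<lambda>T. cinner H (T x) (c \<odot> y)) \<longlongrightarrow> cnj c * l x y) F"
        by (rule trans[OF tendsto_mult_left[OF lim_l]]) (use xy Db in \<open>auto simp: bounded_opsD cinner_simps\<close>)
    qed (use xy in auto)
  qed (use lbound C01 that in auto)
  have Vl: "cinner H (V x) y = l x y" if xy: "x \<in> carrier H" "y \<in> carrier H" for x y
  proof -
    have "l x y = cnj (l y x)"
    proof (rule l_eqI[OF xy])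
      have "cnj (cinner H (T y) x) = cinner H (T x) y" if "T \<in> D" for T
        using adjoint[OF Db(1)[OF that], of x y] Db(2)[OF that] Db(1)[OF that] xy
          cinner_commute[of "T y" x] by (simp add: bounded_opsD)
      then show "((\<lambda>T. cinner H (T x) y) \<longlongrightarrow> cnj (l y x)) F"
        by (intro trans[OF tendsto_cnj[OF lim_l]]) (use xy in auto)
    qed
    also have "\<dots> = cinner H (V x) y"
      using V xy cinner_commute[of y "V x"] by (simp add: bounded_opsD)
    finally show ?thesis by simp
  qed
  have Vsa: "adjoint_op H V = V" by (rule adjoint_eqI[OF V(1) V(1)]) (use V(2) Vl in metis)
  have Vs: "Re (cinner H (V z) z) = s z" if z: "z \<in> carrier H" for z
  proof -
    have "((\<lambda>T. Re (cinner H (T z) z)) \<longlongrightarrow> Re (l z z)) F" by (intro tendsto_Re lim_l z)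
    then show ?thesis using tendsto_unique[OF Fbot lim_s[OF z]] Vl z by auto
  qed
  have "S = V"
  proof (rule selfadjoint_eqI[OF S V(1) Vsa])
    fix z assume z: "z \<in> carrier H"
    have "Re (cinner H (S z) z) \<le> Re (cinner H (V z) z)"
      by (rule leastS) (use V Vsa z Vs T_le_s in auto)
    then show "Re (cinner H (S z) z) = Re (cinner H (V z) z)" using s_le_S[OF z] Vs[OF z] by simp
  qed
  then show ?thesis using lim_l[OF x y] Vl[OF x y] by (simp add: F_def)
qed

end

context tensor_map begin

text \<open>The amplification as an extensional function on the bounded operators, as \<open>rho_normal\<close> is.\<close>

definition rho_amp :: "('a \<Rightarrow> 'a) \<Rightarrow> 'c \<Rightarrow> 'c" where
  "rho_amp = (\<lambda>T\<in>bounded_ops X. amp T)"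

lemma star_hom_amp: "star_hom (Bop X) (Bop H) rho_amp"
  by (auto simp: star_hom_def rho_amp_def amp_add amp_smult amp_compose amp_adjoint)

lemma amp_idX_left: "T \<in> bounded_ops X \<Longrightarrow> h \<in> carrier H \<Longrightarrow> amp idX (amp T h) = amp T h"
proof -
  assume T: "T \<in> bounded_ops X" and h: "h \<in> carrier H"
  have "compose (carrier X) idX T = T"
    using T by (intro X.bounded_ops_eqI) (auto, simp add: compose_def X.bounded_ops_closed)
  then show ?thesis using amp_compose[OF idX_op T] h by (metis compose_eq)
qed

lemma amp_idX_right: "T \<in> bounded_ops X \<Longrightarrow> h \<in> carrier H \<Longrightarrow> amp T (amp idX h) = amp T h"
proof -
  assume T: "T \<in> bounded_ops X" and h: "h \<in> carrier H"
  have "compose (carrier X) T idX = T"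
    using T by (intro X.bounded_ops_eqI) (auto, simp add: compose_def X.bounded_ops_closed)
  then show ?thesis using amp_compose[OF T idX_op] h by (metis compose_eq)
qed

lemma amp_sa: "T \<in> bounded_ops X \<Longrightarrow> adjoint_op X T = T \<Longrightarrow> adjoint_op H (amp T) = amp T"
  using amp_adjoint[of T] by simp

lemma idX_sa [simp]: "adjoint_op X idX = idX" by (simp add: idX_def)

text \<open>A positive operator is \<open>c (1 - Y)\<close> with \<open>\<parallel>Y\<parallel> \<le> 1\<close>, so that positivity is preserved by
  contractivity alone.\<close>

lemma amp_positive:
  assumes T: "T \<in> bounded_ops X" "adjoint_op X T = T"
    and pos: "\<And>x. x \<in> carrier X \<Longrightarrow> 0 \<le> Re (cinner X (T x) x)" and h: "h \<in> carrier H"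
  shows "0 \<le> Re (cinner H (amp T h) h)"
proof -
  obtain C where C: "op_bound X T C" using X.bounded_ops_bound[OF T(1)] .
  define c where "c = C + 1"
  have C0: "0 \<le> C" using C by (simp add: op_bound_def)
  have c: "c > 0" using C0 by (simp add: c_def)
  have cT: "Re (cinner X (T x) x) \<le> c * (hnorm X x)\<^sup>2" if x: "x \<in> carrier X" for x
  proof -
    have "Re (cinner X (T x) x) \<le> cmod (cinner X (T x) x)" by (rule complex_Re_le_cmod)
    also have "\<dots> \<le> hnorm X (T x) * hnorm X x" using x T by (intro X.cauchy_schwarz) (auto simp: X.bounded_opsD)
    also have "\<dots> \<le> (C * hnorm X x) * hnorm X x" using X.op_boundD[OF C x] x by (intro mult_right_mono) auto
    also have "\<dots> \<le> c * (hnorm X x)\<^sup>2" by (simp add: c_def power2_eq_square algebra_simps)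
    finally show ?thesis .
  qed
  define T' where "T' = (\<lambda>x\<in>carrier X. of_real (- (1 / c)) \<odot>\<^bsub>X\<^esub> T x)"
  have T': "T' \<in> bounded_ops X" unfolding T'_def by (rule X.op_smult[OF T(1)])
  have T'sa: "adjoint_op X T' = T'"
    unfolding T'_def X.adjoint_smult[OF T(1)] T(2) complex_cnj_complex_of_real ..
  define Y where "Y = (\<lambda>x\<in>carrier X. idX x \<oplus>\<^bsub>X\<^esub> T' x)"
  have Y: "Y \<in> bounded_ops X" "adjoint_op X Y = Y"
    unfolding Y_def using T' by (simp_all only: X.op_add idX_op X.adjoint_add T'sa idX_sa)
  have YT: "Re (cinner X (Y x) x) = (hnorm X x)\<^sup>2 - Re (cinner X (T x) x) / c" if "x \<in> carrier X" for x
  proof -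
    have "cinner X (T' x) x = of_real (- (1 / c)) * cinner X (T x) x"
      unfolding T'_def using that T by (simp add: X.cinner_simps X.bounded_ops_closed)
    then show ?thesis using that T' 
      by (simp add: Y_def X.cinner_simps X.hnorm_sq X.bounded_ops_closed)
  qed
  have "op_bound X Y 1"
  proof (rule X.positive_op_bound[OF Y])
    fix x assume x: "x \<in> carrier X"
    have "Re (cinner X (T x) x) / c \<le> (hnorm X x)\<^sup>2" "0 \<le> Re (cinner X (T x) x) / c"
      using pos[OF x] cT[OF x] c by (simp_all add: divide_le_eq mult.commute)
    then show "0 \<le> Re (cinner X (Y x) x)" "Re (cinner X (Y x) x) \<le> 1 * (hnorm X x)\<^sup>2"
      using YT[OF x] by simp_all
  qed simp
  then have AY: "op_bound H (amp Y) 1" using amp_bound[OF Y(1)] by simp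
  define q where "q = amp idX h"
  have q: "q \<in> carrier H" unfolding q_def using h by (simp add: H.bounded_ops_closed)
  have Q: "Re (cinner H (amp S h) h) = Re (cinner H (amp S q) q)" if "S \<in> bounded_ops X" for S
  proof -
    have "cinner H (amp S q) q = cinner H (amp S h) q" using that h by (simp add: q_def amp_idX_right)
    also have "\<dots> = cinner H (amp idX (amp S h)) h"
      unfolding q_def using H.adjoint'[OF amp_closed[OF idX_op], of "amp S h" h] that h
      by (simp add: amp_sa H.bounded_ops_closed)
    finally show ?thesis using that h by (simp add: amp_idX_left)
  qed
  have "amp Y = (\<lambda>h\<in>carrier H. amp idX h \<oplus>\<^bsub>H\<^esub> amp T' h)"
    unfolding Y_def by (rule amp_add[OF idX_op T'])
  moreover have "amp T' = (\<lambda>h\<in>carrier H. of_real (- (1/c)) \<odot>\<^bsub>H\<^esub> amp T h)"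
    unfolding T'_def by (rule amp_smult[OF T(1)])
  ultimately have "Re (cinner H (amp Y q) q) = Re (cinner H (amp idX q) q) - Re (cinner H (amp T q) q) / c"
    using q T by (simp add: H.cinner_simps H.bounded_ops_closed)
  moreover have "amp idX q = q" using h by (simp add: q_def amp_idX_left)
  moreover have "Re (cinner H (amp Y q) q) \<le> (hnorm H q)\<^sup>2"
  proof -
    have "Re (cinner H (amp Y q) q) \<le> cmod (cinner H (amp Y q) q)" by (rule complex_Re_le_cmod)
    also have "\<dots> \<le> hnorm H (amp Y q) * hnorm H q" using q Y by (intro H.cauchy_schwarz) (auto simp: H.bounded_opsD)
    also have "\<dots> \<le> hnorm H q * hnorm H q" using H.op_boundD[OF AY q] q by (intro mult_right_mono) auto
    finally show ?thesis by (simp add: power2_eq_square)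
  qed
  ultimately have "0 \<le> Re (cinner H (amp T q) q) / c" using q by (simp add: H.hnorm_sq)
  then show ?thesis using c Q[OF T(1)] by (simp add: zero_le_divide_iff)
qed

lemma amp_mono:
  assumes S: "S \<in> bounded_ops X" "adjoint_op X S = S" and T: "T \<in> bounded_ops X" "adjoint_op X T = T"
    and le: "\<And>x. x \<in> carrier X \<Longrightarrow> Re (cinner X (S x) x) \<le> Re (cinner X (T x) x)"
    and h: "h \<in> carrier H"
  shows "Re (cinner H (amp S h) h) \<le> Re (cinner H (amp T h) h)"
proof -
  have "0 \<le> Re (cinner H (amp (X.op_minus T S) h) h)"
    by (rule amp_positive) (use S T le h in \<open>auto simp: X.op_minus_adjoint X.op_minus_apply X.cinner_simps X.bounded_opsD\<close>)
  moreover have "amp (X.op_minus T S) = (\<lambda>h\<in>carrier H. amp T h \<oplus>\<^bsub>H\<^esub> (\<lambda>h\<in>carrier H. (-1) \<odot>\<^bsub>H\<^esub> amp S h) h)"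
    unfolding X.op_minus_def using S T by (simp only: amp_add[OF T(1) X.op_smult[OF S(1)]] amp_smult[OF S(1)])
  ultimately show ?thesis using h S T by (simp add: H.cinner_simps H.bounded_ops_closed)
qed

lemma amp_wsum: "T \<in> bounded_ops X \<Longrightarrow> ps \<in> pairs \<Longrightarrow> amp T (wsum idX ps) = wsum T ps"
  by (induction ps) (auto simp: H.bounded_opsD H.bounded_ops_zero)

text \<open>Every vector \<open>h\<close> may be replaced by its projection \<open>u\<close> to the closed span of the elementary tensors,
  which is approximated by elements of the span.\<close>

lemma span_projection:
  assumes h: "h \<in> carrier H"
  obtains u where "u \<in> carrier H" "\<And>T. T \<in> bounded_ops X \<Longrightarrow> amp T h = amp T u"
    "\<And>\<epsilon>. \<epsilon> > 0 \<Longrightarrow> \<exists>ps\<in>pairs. hnorm H (u \<ominus>\<^bsub>H\<^esub> wsum idX ps) < \<epsilon>"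
proof -
  have id1: "op_bound X idX 1" by (simp add: op_bound_def)
  obtain u where u: "u \<in> carrier H"
    "\<And>ps. ps \<in> pairs \<Longrightarrow> cinner H (wsum idX ps) h = cinner H (wsum idX ps) u"
    "\<And>\<epsilon>. \<epsilon> > 0 \<Longrightarrow> \<exists>ps\<in>pairs. hnorm H (u \<ominus>\<^bsub>H\<^esub> wsum idX ps) < \<epsilon>" "hnorm H u \<le> 1 * hnorm H h"
    using span_functional[OF idX_op id1 h] by blast
  have gen: "cinner H (m x k) h = cinner H (m x k) u" if "x \<in> carrier X" "k \<in> carrier K" for x k
    using u(2)[of "[(x, k)]"] that by simp
  then have "h \<ominus>\<^bsub>H\<^esub> u \<in> perp" using h u(1) by (auto simp: perp_def H.cinner_simps)
  then have "amp T h = amp T u" if "T \<in> bounded_ops X" for T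
    using amp_perp[OF that, of "h \<ominus>\<^bsub>H\<^esub> u"] h u(1) amp_closed[OF that]
    by (simp add: H.bounded_ops_minus H.minus_eq_zero_iff H.bounded_ops_closed)
  then show ?thesis using that u(1,3) by blast
qed

lemma amp_form:
  assumes "T \<in> bounded_ops X" "adjoint_op X T = T" "h \<in> carrier H" "u \<in> carrier H"
    and "\<And>T. T \<in> bounded_ops X \<Longrightarrow> amp T h = amp T u"
  shows "cinner H (amp T h) h = cinner H (amp T u) u"
proof -
  have "cinner H (amp T u) u = cinner H u (amp T u)"
    using H.adjoint[of "amp T" u u] assms by (simp add: amp_sa)
  also have "\<dots> = cinner H u (amp T h)" using assms by simp
  also have "\<dots> = cinner H (amp T u) h" using H.adjoint[of "amp T" u h] assms by (simp add: amp_sa)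
  finally show ?thesis using assms by simp
qed

text \<open>For \<open>T\<close> above \<open>T\<^sub>0\<close> in the directed set, the quadratic form \<open>q T\<close> of \<open>amp S - amp T\<close> is positive and at
  most that of \<open>amp S - amp T\<^sub>0\<close>. Hence it is uniformly small on the error \<open>v\<close> of an approximation of the
  vector by an element \<open>w\<close> of the span, and on \<open>w\<close> itself it tends to 0.\<close>

lemma normal_amp: "normal_map X H rho_amp"
  unfolding normal_map_def
proof (intro allI impI)
  fix D S
  assume D: "D \<subseteq> carrier (sa_order X)" "D \<noteq> {}"
    and dir: "\<forall>S1\<in>D. \<forall>S2\<in>D. \<exists>S3\<in>D. S1 \<sqsubseteq>\<^bsub>sa_order X\<^esub> S3 \<and> S2 \<sqsubseteq>\<^bsub>sa_order X\<^esub> S3"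
    and lub: "least (sa_order X) S (Upper (sa_order X) D)"
  note ev = X.eventually_section_filter[OF D(2) dir]
  have Db: "T \<in> bounded_ops X" "adjoint_op X T = T" if "T \<in> D" for T using D that by auto
  have S: "S \<in> bounded_ops X" "adjoint_op X S = S" using least_closed[OF lub] by auto
  have upS: "Re (cinner X (T z) z) \<le> Re (cinner X (S z) z)" if "T \<in> D" "z \<in> carrier X" for T z
    using least_Upper_above[OF lub that(1) D(1)] that(2) by simp
  have img: "rho_amp ` D = amp ` D" using Db by (auto simp: rho_amp_def)
  have rS: "rho_amp S = amp S" using S by (simp add: rho_amp_def)
  define F where "F = X.section_filter D"
  have evD: "eventually (\<lambda>T. T \<in> D) F" unfolding F_def ev using D(2) by auto
  have lim: "((\<lambda>T. cinner H (wsum T ps) z) \<longlongrightarrow> cinner H (wsum S ps) z) F"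
    if ps: "ps \<in> pairs" and z: "z \<in> carrier H" for ps z
    using ps
  proof (induction ps)
    case (Cons p ps)
    have p: "fst p \<in> carrier X" "snd p \<in> carrier K" "ps \<in> pairs" using Cons.prems by auto
    obtain u where u: "u \<in> carrier X" "\<And>x. x \<in> carrier X \<Longrightarrow> cinner H (m x (snd p)) z = cinner X x u"
      using slice_adjoint[OF p(2) z] by blast
    have e: "cinner X (T (fst p)) u + cinner H (wsum T ps) z = cinner H (wsum T (p # ps)) z"
      if "T \<in> bounded_ops X" for T
      using that p z u by (simp add: H.cinner_simps X.bounded_ops_closed)
    have "((\<lambda>T. cinner X (T (fst p)) u + cinner H (wsum T ps) z)
        \<longlongrightarrow> cinner X (S (fst p)) u + cinner H (wsum S ps) z) F"
      using X.lub_weak_limit[OF D dir lub p(1) u(1)] Cons.IH[OF p(3)] unfolding F_def by (rule tendsto_add)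
    then have "((\<lambda>T. cinner H (wsum T (p # ps)) z) \<longlongrightarrow> cinner X (S (fst p)) u + cinner H (wsum S ps) z) F"
      by (rule Lim_transform_eventually) (use evD e Db in \<open>auto elim!: eventually_mono\<close>)
    then show ?case using e[OF S(1)] by simp
  qed simp
  show "least (sa_order H) (rho_amp S) (Upper (sa_order H) (rho_amp ` D))"
    unfolding img rS
  proof (rule least_UpperI)
    show "x \<sqsubseteq>\<^bsub>sa_order H\<^esub> amp S" if x: "x \<in> amp ` D" for x
    proof -
      obtain T where T: "T \<in> D" "x = amp T" using x by blast
      show ?thesis using T upS Db S by (auto intro!: amp_mono)
    qed
    show "amp ` D \<subseteq> carrier (sa_order H)" using Db by (auto simp: amp_sa)
    show "amp S \<in> carrier (sa_order H)" using S by (simp add: amp_sa)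
    fix R assume "R \<in> Upper (sa_order H) (amp ` D)"
    then have R: "R \<in> bounded_ops H" "adjoint_op H R = R"
      and upR: "Re (cinner H (amp T h) h) \<le> Re (cinner H (R h) h)" if "T \<in> D" "h \<in> carrier H" for T h
      using that Db by (auto simp: Upper_def amp_sa)
    have "Re (cinner H (amp S h) h) \<le> Re (cinner H (R h) h)" if h: "h \<in> carrier H" for h
    proof (rule field_le_epsilon)
      fix \<epsilon> :: real assume e: "\<epsilon> > 0"
      obtain u where u: "u \<in> carrier H" "\<And>T. T \<in> bounded_ops X \<Longrightarrow> amp T h = amp T u"
        "\<And>\<epsilon>. \<epsilon> > 0 \<Longrightarrow> \<exists>ps\<in>pairs. hnorm H (u \<ominus>\<^bsub>H\<^esub> wsum idX ps) < \<epsilon>" 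
        using span_projection[OF h] by blast
      obtain T0 where T0: "T0 \<in> D" using D(2) by blast
      define q where "q T v = Re (cinner H (amp S v) v) - Re (cinner H (amp T v) v)" for T v
      obtain C where C: "op_bound H (H.op_minus (amp S) (amp T0)) C"
        using H.bounded_ops_bound[OF H.op_minus_closed[OF amp_closed[OF S(1)] amp_closed[OF Db(1)[OF T0]]]] .
      have C0: "0 \<le> C" using C by (simp add: op_bound_def)
      have q0: "q T0 v \<le> C * (hnorm H v)\<^sup>2" if v: "v \<in> carrier H" for v
      proof -
        let ?B = "H.op_minus (amp S) (amp T0)"
        have "q T0 v = Re (cinner H (?B v) v)"
          using v S Db[OF T0] by (simp add: q_def H.op_minus_apply H.cinner_simps H.bounded_ops_closed)
        also have "\<dots> \<le> cmod (cinner H (?B v) v)" by (rule complex_Re_le_cmod)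
        also have "\<dots> \<le> hnorm H (?B v) * hnorm H v"
          using v S Db[OF T0] by (intro H.cauchy_schwarz) (auto simp: H.op_minus_apply H.bounded_ops_closed)
        also have "\<dots> \<le> (C * hnorm H v) * hnorm H v"
          using H.op_boundD[OF C v] v by (intro mult_right_mono) auto
        finally show ?thesis by (simp add: power2_eq_square mult.assoc)
      qed
      \<comment> \<open>The error contributes at most \<open>2 C \<delta>\<^sup>2 \<le> \<epsilon> / 2\<close>.\<close>
      define \<delta> where "\<delta> = sqrt (\<epsilon> / (4 * (C + 1)))"
      have d: "\<delta> > 0" "2 * C * \<delta>\<^sup>2 \<le> \<epsilon> / 2"
        using e C0 by (auto simp: \<delta>_def field_simps)
      obtain ps where ps: "ps \<in> pairs" "hnorm H (u \<ominus>\<^bsub>H\<^esub> wsum idX ps) < \<delta>" using u(3)[OF d(1)] by blast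
      define w where "w = wsum idX ps"
      define v where "v = u \<ominus>\<^bsub>H\<^esub> w"
      have wc: "w \<in> carrier H" and vc: "v \<in> carrier H" using ps u by (auto simp: w_def v_def)
      have uwv: "u = w \<oplus>\<^bsub>H\<^esub> v"
        unfolding v_def using wc u(1) by (intro H.cinner_ext) (auto simp: H.cinner_simps)
      have "((\<lambda>T. Re (cinner H (wsum T ps) w)) \<longlongrightarrow> Re (cinner H (wsum S ps) w)) F"
        by (intro tendsto_Re lim ps wc)
      then have "\<forall>\<^sub>F T in F. Re (cinner H (wsum S ps) w) - \<epsilon> / 4 < Re (cinner H (wsum T ps) w)"
        using e by (intro order_tendstoD(1)[where y = "Re (cinner H (wsum S ps) w)"]) auto
      moreover have "\<forall>\<^sub>F T in F. T \<in> D \<and> T0 \<sqsubseteq>\<^bsub>sa_order X\<^esub> T"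
        unfolding F_def ev using T0 by blast
      ultimately have "\<forall>\<^sub>F T in F. T \<in> D \<and> T0 \<sqsubseteq>\<^bsub>sa_order X\<^esub> T \<and>
          Re (cinner H (wsum S ps) w) - \<epsilon> / 4 < Re (cinner H (wsum T ps) w)"
        by eventually_elim blast
      then obtain T where T: "T \<in> D" "T0 \<sqsubseteq>\<^bsub>sa_order X\<^esub> T"
        "Re (cinner H (wsum S ps) w) - \<epsilon> / 4 < Re (cinner H (wsum T ps) w)"
        unfolding F_def ev using X.bounded_ops_closed by (meson order_refl sa_order_simps(2))
      have qw: "q T w < \<epsilon> / 4"
        using T(3) ps S Db[OF T(1)] by (simp add: q_def w_def amp_wsum)
      have qpos: "0 \<le> q T z" if "z \<in> carrier H" for z
        unfolding q_def using amp_mono[OF Db[OF T(1)] S] upS[OF T(1)] that by auto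
      have "q T v \<le> q T0 v"
        unfolding q_def using amp_mono[OF Db[OF T0] Db[OF T(1)]] T(2) vc by auto
      also have "\<dots> \<le> C * (hnorm H v)\<^sup>2" by (rule q0[OF vc])
      also have "\<dots> \<le> C * \<delta>\<^sup>2"
        using ps(2) vc C0 unfolding v_def w_def by (intro mult_left_mono power_mono) auto
      finally have qv: "2 * q T v \<le> \<epsilon> / 2" using d(2) by simp
      have "q T (w \<oplus>\<^bsub>H\<^esub> v) + q T (w \<ominus>\<^bsub>H\<^esub> v) = 2 * q T w + 2 * q T v"
        using wc vc S Db[OF T(1)]
        by (simp add: q_def H.bounded_opsD H.bounded_ops_minus H.cinner_simps)
      then have "q T u \<le> 2 * q T w + 2 * q T v" using qpos[of "w \<ominus>\<^bsub>H\<^esub> v"] wc vc uwv by simp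
      then have "q T u \<le> \<epsilon>" using qw qv by simp
      moreover have "q T u = Re (cinner H (amp S h) h) - Re (cinner H (amp T h) h)"
        unfolding q_def using amp_form[OF S h u(1,2)] amp_form[OF Db[OF T(1)] h u(1,2)] by simp
      ultimately show "Re (cinner H (amp S h) h) \<le> Re (cinner H (R h) h) + \<epsilon>"
        using upR[OF T(1) h] by simp
    qed
    then show "amp S \<sqsubseteq>\<^bsub>sa_order H\<^esub> R" by simp
  qed
qed

end


section \<open>Compact operators and projections of finite rank\<close>

context hilbert_space begin

lemma unit_ball_closed: "x \<in> unit_ball H \<Longrightarrow> x \<in> carrier H"
  by (simp add: unit_ball_def)

text \<open>Compactness of the closure of the image of the unit ball is total boundedness of this image, by
  completeness.\<close>

lemma compact_ops_iff_net:
  "T \<in> compact_ops H \<longleftrightarrow> T \<in> bounded_ops H \<and>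
    (\<forall>\<epsilon>>0. \<exists>F. finite F \<and> F \<subseteq> unit_ball H \<and> (\<forall>x\<in>unit_ball H. \<exists>y\<in>F. hnorm H (T x \<ominus> T y) < \<epsilon>))"
proof (cases "T \<in> bounded_ops H")
  case T: True
  interpret M: Metric_space "carrier H" "norm_dist H (hnorm H)" by (rule metric)
  have sub: "T ` unit_ball H \<subseteq> carrier H" using T by (auto simp: bounded_ops_closed unit_ball_closed)
  have "T \<in> compact_ops H \<longleftrightarrow> M.mtotally_bounded (T ` unit_ball H)"
    using M.mtotally_bounded_eq_compact_closure_of[OF complete, of "T ` unit_ball H"] T sub
    by (simp add: compact_ops_def htop_def)
  also have "\<dots> \<longleftrightarrow> (\<forall>\<epsilon>>0. \<exists>F. finite F \<and> F \<subseteq> unit_ball H \<and> (\<forall>x\<in>unit_ball H. \<exists>y\<in>F. hnorm H (T x \<ominus> T y) < \<epsilon>))"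
  proof -
    have ball: "T x \<in> M.mball (T y) \<epsilon> \<longleftrightarrow> hnorm H (T x \<ominus> T y) < \<epsilon>"
      if "x \<in> unit_ball H" "y \<in> unit_ball H" for x y \<epsilon>
      using that T by (simp add: M.in_mball norm_dist_def bounded_ops_closed unit_ball_closed hnorm_minus_commute)
    have "(\<exists>K. finite K \<and> K \<subseteq> T ` unit_ball H \<and> T ` unit_ball H \<subseteq> (\<Union>x\<in>K. M.mball x \<epsilon>)) \<longleftrightarrow>
       (\<exists>F. finite F \<and> F \<subseteq> unit_ball H \<and> (\<forall>x\<in>unit_ball H. \<exists>y\<in>F. hnorm H (T x \<ominus> T y) < \<epsilon>))" for \<epsilon>
    proof
      assume "\<exists>K. finite K \<and> K \<subseteq> T ` unit_ball H \<and> T ` unit_ball H \<subseteq> (\<Union>x\<in>K. M.mball x \<epsilon>)"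
      then obtain K where K: "finite K" "K \<subseteq> T ` unit_ball H" "T ` unit_ball H \<subseteq> (\<Union>x\<in>K. M.mball x \<epsilon>)" by blast
      obtain F where F: "F \<subseteq> unit_ball H" "finite F" "K = T ` F" using finite_subset_image[OF K(1,2)] by blast
      have "\<exists>y\<in>F. hnorm H (T x \<ominus> T y) < \<epsilon>" if x: "x \<in> unit_ball H" for x
      proof -
        obtain y where "y \<in> F" "T x \<in> M.mball (T y) \<epsilon>" using K(3) F(3) x by blast
        then show ?thesis using ball[OF x, of y] F(1) by blast
      qed
      then show "\<exists>F. finite F \<and> F \<subseteq> unit_ball H \<and> (\<forall>x\<in>unit_ball H. \<exists>y\<in>F. hnorm H (T x \<ominus> T y) < \<epsilon>)"
        using F by blast
    next
      assume "\<exists>F. finite F \<and> F \<subseteq> unit_ball H \<and> (\<forall>x\<in>unit_ball H. \<exists>y\<in>F. hnorm H (T x \<ominus> T y) < \<epsilon>)"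
      then obtain F where F: "finite F" "F \<subseteq> unit_ball H" "\<forall>x\<in>unit_ball H. \<exists>y\<in>F. hnorm H (T x \<ominus> T y) < \<epsilon>" by blast
      have "T x \<in> (\<Union>x\<in>T ` F. M.mball x \<epsilon>)" if x: "x \<in> unit_ball H" for x
      proof -
        obtain y where "y \<in> F" "hnorm H (T x \<ominus> T y) < \<epsilon>" using F(3) x by blast
        then show ?thesis using ball[OF x, of y] F(2) by blast
      qed
      then show "\<exists>K. finite K \<and> K \<subseteq> T ` unit_ball H \<and> T ` unit_ball H \<subseteq> (\<Union>x\<in>K. M.mball x \<epsilon>)"
        using F by (intro exI[of _ "T ` F"]) auto
    qed
    then show ?thesis by (simp add: M.mtotally_bounded_def)
  qed
  finally show ?thesis using T by simp
qed (simp add: compact_ops_def)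

text \<open>A finite cover of the unit ball by sets on which the operator varies by less than \<open>\<epsilon>\<close>. Unlike nets
  of points, covers have common refinements and preimages.\<close>

definition fine_cover :: "('a \<Rightarrow> 'a) \<Rightarrow> real \<Rightarrow> 'a set set \<Rightarrow> bool" where
  "fine_cover T \<epsilon> \<U> \<longleftrightarrow> finite \<U> \<and> unit_ball H \<subseteq> \<Union>\<U> \<and>
      (\<forall>U\<in>\<U>. \<forall>x\<in>U \<inter> unit_ball H. \<forall>y\<in>U \<inter> unit_ball H. hnorm H (T x \<ominus> T y) < \<epsilon>)"

lemma fine_coverI:
  assumes "finite \<U>" "unit_ball H \<subseteq> \<Union>\<U>"
    "\<And>U x y. \<lbrakk>U \<in> \<U>; x \<in> U; x \<in> unit_ball H; y \<in> U; y \<in> unit_ball H\<rbrakk> \<Longrightarrow> hnorm H (T x \<ominus> T y) < \<epsilon>"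
  shows "fine_cover T \<epsilon> \<U>"
  using assms(1,2) unfolding fine_cover_def by (auto intro!: assms(3))

lemma fine_coverD:
  assumes "fine_cover T \<epsilon> \<U>"
  shows "finite \<U>" "unit_ball H \<subseteq> \<Union>\<U>"
    "\<And>U x y. \<lbrakk>U \<in> \<U>; x \<in> U; x \<in> unit_ball H; y \<in> U; y \<in> unit_ball H\<rbrakk> \<Longrightarrow> hnorm H (T x \<ominus> T y) < \<epsilon>"
  using assms unfolding fine_cover_def by auto

lemma compact_ops_iff:
  "T \<in> compact_ops H \<longleftrightarrow> T \<in> bounded_ops H \<and> (\<forall>\<epsilon>>0. \<exists>\<U>. fine_cover T \<epsilon> \<U>)"
proof (cases "T \<in> bounded_ops H")
  case T: True
  show ?thesis
  proof (intro iffI conjI allI impI T)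
    fix \<epsilon> :: real assume "T \<in> compact_ops H" "\<epsilon> > 0"
    then obtain F where F: "finite F" "F \<subseteq> unit_ball H" "\<forall>x\<in>unit_ball H. \<exists>y\<in>F. hnorm H (T x \<ominus> T y) < \<epsilon> / 2"
      unfolding compact_ops_iff_net by (meson half_gt_zero)
    define \<U> where "\<U> = (\<lambda>y. {x \<in> unit_ball H. hnorm H (T x \<ominus> T y) < \<epsilon> / 2}) ` F"
    have "hnorm H (T x \<ominus> T y) < \<epsilon>"
      if z: "z \<in> F" "x \<in> unit_ball H" "y \<in> unit_ball H" "hnorm H (T x \<ominus> T z) < \<epsilon> / 2" "hnorm H (T y \<ominus> T z) < \<epsilon> / 2" for x y z
    proof -
      have c: "T x \<in> carrier H" "T y \<in> carrier H" "T z \<in> carrier H"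
        using z F T by (auto simp: bounded_ops_closed unit_ball_closed)
      have "hnorm H (T x \<ominus> T y) \<le> hnorm H (T x \<ominus> T z) + hnorm H (T z \<ominus> T y)" using c hnorm_triangle3 by blast
      then show ?thesis using z c hnorm_minus_commute[of "T y" "T z"] by simp
    qed
    then have "fine_cover T \<epsilon> \<U>"
      using F(1,3) by (intro fine_coverI) (auto simp: \<U>_def)
    then show "\<exists>\<U>. fine_cover T \<epsilon> \<U>" by blast
  next
    assume "T \<in> bounded_ops H \<and> (\<forall>\<epsilon>>0. \<exists>\<U>. fine_cover T \<epsilon> \<U>)"
    then have cov: "\<exists>\<U>. fine_cover T \<epsilon> \<U>" if "\<epsilon> > 0" for \<epsilon> using that by blast
    show "T \<in> compact_ops H" unfolding compact_ops_iff_net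
    proof (intro conjI T allI impI)
      fix \<epsilon> :: real assume "\<epsilon> > 0"
      from cov[OF this] obtain \<U> where "fine_cover T \<epsilon> \<U>" by blast
      note U = fine_coverD[OF this]
      define F where "F = (\<lambda>U. SOME y. y \<in> U \<inter> unit_ball H) ` {U \<in> \<U>. U \<inter> unit_ball H \<noteq> {}}"
      have some: "(SOME y. y \<in> U \<inter> unit_ball H) \<in> U \<inter> unit_ball H" if "U \<inter> unit_ball H \<noteq> {}" for U
        using that someI_ex[of "\<lambda>y. y \<in> U \<inter> unit_ball H"] by auto
      have "\<exists>y\<in>F. hnorm H (T x \<ominus> T y) < \<epsilon>" if x: "x \<in> unit_ball H" for x
      proof -
        obtain V where V: "V \<in> \<U>" "x \<in> V" using U(2) x by blast
        then have "V \<inter> unit_ball H \<noteq> {}" using x by blast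
        note s = some[OF this]
        have "(SOME y. y \<in> V \<inter> unit_ball H) \<in> F" unfolding F_def using V x by blast
        then show ?thesis using U(3)[OF V x, of "SOME y. y \<in> V \<inter> unit_ball H"] s by auto
      qed
      moreover have "finite F" unfolding F_def using U(1) by simp
      moreover have "F \<subseteq> unit_ball H" unfolding F_def using some by blast
      ultimately show "\<exists>F. finite F \<and> F \<subseteq> unit_ball H \<and> (\<forall>x\<in>unit_ball H. \<exists>y\<in>F. hnorm H (T x \<ominus> T y) < \<epsilon>)" by blast
    qed
  qed
qed (simp add: compact_ops_def)

lemma compact_bounded [simp]: "T \<in> compact_ops H \<Longrightarrow> T \<in> bounded_ops H"
  by (simp add: compact_ops_def)

lemma compactI:
  assumes "T \<in> bounded_ops H" "\<And>\<epsilon>. \<epsilon> > 0 \<Longrightarrow> \<exists>\<U>. fine_cover T \<epsilon> \<U>"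
  shows "T \<in> compact_ops H"
  using assms by (simp add: compact_ops_iff)

lemma compactE:
  assumes "T \<in> compact_ops H" "\<epsilon> > 0"
  obtains \<U> where "finite \<U>" "unit_ball H \<subseteq> \<Union>\<U>"
      "\<And>U x y. \<lbrakk>U \<in> \<U>; x \<in> U; x \<in> unit_ball H; y \<in> U; y \<in> unit_ball H\<rbrakk> \<Longrightarrow> hnorm H (T x \<ominus> T y) < \<epsilon>"
proof -
  obtain \<U> where "fine_cover T \<epsilon> \<U>" using assms by (auto simp: compact_ops_iff)
  from fine_coverD[OF this] show ?thesis by (rule that)
qed

text \<open>The sum and the zero of \<open>Bop H\<close>, as named operators.\<close>

definition op_plus :: "('a \<Rightarrow> 'a) \<Rightarrow> ('a \<Rightarrow> 'a) \<Rightarrow> 'a \<Rightarrow> 'a" where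
  "op_plus S T = (\<lambda>x\<in>carrier H. S x \<oplus> T x)"

definition op_null :: "'a \<Rightarrow> 'a" where "op_null = (\<lambda>x\<in>carrier H. \<zero>)"

lemma op_plus_apply [simp]: "x \<in> carrier H \<Longrightarrow> op_plus S T x = S x \<oplus> T x"
  by (simp add: op_plus_def)

lemma op_null_apply [simp]: "x \<in> carrier H \<Longrightarrow> op_null x = \<zero>"
  by (simp add: op_null_def)

lemma op_plus_closed [simp]: "S \<in> bounded_ops H \<Longrightarrow> T \<in> bounded_ops H \<Longrightarrow> op_plus S T \<in> bounded_ops H"
  by (simp add: op_plus_def)

lemma op_null_closed [simp]: "op_null \<in> bounded_ops H"
  by (simp add: op_null_def)

lemma op_plus_adjoint: "S \<in> bounded_ops H \<Longrightarrow> T \<in> bounded_ops H \<Longrightarrow>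
    adjoint_op H (op_plus S T) = op_plus (adjoint_op H S) (adjoint_op H T)"
  by (simp add: op_plus_def adjoint_add)

lemma op_null_adjoint: "adjoint_op H op_null = op_null"
  by (simp add: op_null_def)

lemma hnorm_pos: "x \<in> carrier H \<Longrightarrow> x \<noteq> \<zero> \<Longrightarrow> 0 < hnorm H x"
  using hnorm_nonneg[of x] hnorm_eq_0[of x] by linarith

lemma compact_add:
  assumes S: "S \<in> compact_ops H" and T: "T \<in> compact_ops H"
  shows "op_plus S T \<in> compact_ops H"
proof (rule compactI)
  show "op_plus S T \<in> bounded_ops H" using S T by simp
  fix \<epsilon> :: real assume "\<epsilon> > 0"
  then have e: "\<epsilon> / 2 > 0" by simp
  obtain \<U> where U: "finite \<U>" "unit_ball H \<subseteq> \<Union>\<U>"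
      "\<And>U x y. \<lbrakk>U \<in> \<U>; x \<in> U; x \<in> unit_ball H; y \<in> U; y \<in> unit_ball H\<rbrakk> \<Longrightarrow> hnorm H (S x \<ominus> S y) < \<epsilon> / 2"
    using compactE[OF S e] by blast
  obtain \<V> where V: "finite \<V>" "unit_ball H \<subseteq> \<Union>\<V>"
      "\<And>U x y. \<lbrakk>U \<in> \<V>; x \<in> U; x \<in> unit_ball H; y \<in> U; y \<in> unit_ball H\<rbrakk> \<Longrightarrow> hnorm H (T x \<ominus> T y) < \<epsilon> / 2"
    using compactE[OF T e] by blast
  define \<W> where "\<W> = (\<lambda>(U, V). U \<inter> V) ` (\<U> \<times> \<V>)"
  have main: "hnorm H ((S x \<oplus> T x) \<ominus> (S y \<oplus> T y)) < \<epsilon>"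
    if "U \<in> \<U>" "V \<in> \<V>" "x \<in> U" "x \<in> V" "y \<in> U" "y \<in> V" "x \<in> unit_ball H" "y \<in> unit_ball H" for U V x y
  proof -
    have c: "S x \<in> carrier H" "T x \<in> carrier H" "S y \<in> carrier H" "T y \<in> carrier H"
      using S T that by (auto simp: bounded_ops_closed unit_ball_closed)
    have "(S x \<oplus> T x) \<ominus> (S y \<oplus> T y) = (S x \<ominus> S y) \<oplus> (T x \<ominus> T y)"
      using c by (intro cinner_ext) (auto simp: cinner_simps)
    then have "hnorm H ((S x \<oplus> T x) \<ominus> (S y \<oplus> T y)) \<le> hnorm H (S x \<ominus> S y) + hnorm H (T x \<ominus> T y)"
      using hnorm_triangle[of "S x \<ominus> S y" "T x \<ominus> T y"] c by simp
    then show ?thesis using U(3)[of U x y] V(3)[of V x y] that by simp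
  qed
  have "fine_cover (op_plus S T) \<epsilon> \<W>"
  proof (rule fine_coverI)
    show "finite \<W>" unfolding \<W>_def using U(1) V(1) by simp
    show "unit_ball H \<subseteq> \<Union>\<W>"
    proof
      fix x assume "x \<in> unit_ball H"
      then obtain A B where "A \<in> \<U>" "x \<in> A" "B \<in> \<V>" "x \<in> B" using U(2) V(2) by (meson UnionE subsetD)
      then show "x \<in> \<Union>\<W>" unfolding \<W>_def by (intro UnionI[of "A \<inter> B"]) auto
    qed
    fix U x y assume "U \<in> \<W>" "x \<in> U" "x \<in> unit_ball H" "y \<in> U" "y \<in> unit_ball H"
    then show "hnorm H (op_plus S T x \<ominus> op_plus S T y) < \<epsilon>"
      using main by (auto simp: \<W>_def unit_ball_closed)
  qed
  then show "\<exists>\<W>. fine_cover (op_plus S T) \<epsilon> \<W>" by blast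
qed

lemma compact_compose_left:
  assumes S: "S \<in> bounded_ops H" and T: "T \<in> compact_ops H"
  shows "compose (carrier H) S T \<in> compact_ops H"
proof (rule compactI)
  show "compose (carrier H) S T \<in> bounded_ops H" using S T by simp
  fix \<epsilon> :: real assume e: "\<epsilon> > 0"
  obtain C where C: "op_bound H S C" using bounded_ops_bound[OF S] .
  then have C0: "0 \<le> C" by (simp add: op_bound_def)
  obtain \<U> where U: "finite \<U>" "unit_ball H \<subseteq> \<Union>\<U>"
      "\<And>U x y. \<lbrakk>U \<in> \<U>; x \<in> U; x \<in> unit_ball H; y \<in> U; y \<in> unit_ball H\<rbrakk> \<Longrightarrow> hnorm H (T x \<ominus> T y) < \<epsilon> / (C + 1)"
    using compactE[OF T, of "\<epsilon> / (C + 1)"] e C0 by (auto simp: divide_pos_pos)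
  have "hnorm H (compose (carrier H) S T x \<ominus> compose (carrier H) S T y) < \<epsilon>"
    if "U \<in> \<U>" "x \<in> U" "x \<in> unit_ball H" "y \<in> U" "y \<in> unit_ball H" for U x y
  proof -
    have c: "x \<in> carrier H" "y \<in> carrier H" "T x \<in> carrier H" "T y \<in> carrier H"
      using T that by (auto simp: bounded_ops_closed unit_ball_closed)
    have "hnorm H (S (T x \<ominus> T y)) \<le> C * hnorm H (T x \<ominus> T y)" using c by (intro op_boundD[OF C]) auto
    also have "\<dots> \<le> (C + 1) * hnorm H (T x \<ominus> T y)" using c by (intro mult_right_mono) auto
    also have "\<dots> < (C + 1) * (\<epsilon> / (C + 1))" using U(3)[OF that] C0 by (intro mult_strict_left_mono) auto
    also have "\<dots> = \<epsilon>" using C0 by simp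
    finally show ?thesis using c S by (simp add: compose_eq bounded_ops_minus)
  qed
  then have "fine_cover (compose (carrier H) S T) \<epsilon> \<U>" using U(1,2) by (intro fine_coverI)
  then show "\<exists>\<U>. fine_cover (compose (carrier H) S T) \<epsilon> \<U>" by blast
qed

lemma compact_compose_right:
  assumes S: "S \<in> compact_ops H" and T: "T \<in> bounded_ops H"
  shows "compose (carrier H) S T \<in> compact_ops H"
proof (rule compactI)
  show "compose (carrier H) S T \<in> bounded_ops H" using S T by simp
  fix \<epsilon> :: real assume e: "\<epsilon> > 0"
  obtain C' where C': "op_bound H T C'" using bounded_ops_bound[OF T] .
  define C where "C = C' + 1"
  have C: "op_bound H T C" "C > 0"
    using op_bound_mono[OF C', of C] C' by (auto simp: C_def op_bound_def)
  obtain \<U> where U: "finite \<U>" "unit_ball H \<subseteq> \<Union>\<U>"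
      "\<And>U x y. \<lbrakk>U \<in> \<U>; x \<in> U; x \<in> unit_ball H; y \<in> U; y \<in> unit_ball H\<rbrakk> \<Longrightarrow> hnorm H (S x \<ominus> S y) < \<epsilon> / C"
    using compactE[OF S, of "\<epsilon> / C"] e C by (auto simp: divide_pos_pos)
  define g where "g x = of_real (1 / C) \<odot> T x" for x
  have g: "g x \<in> unit_ball H" if "x \<in> unit_ball H" for x
  proof -
    have x: "x \<in> carrier H" "hnorm H x \<le> 1" using that by (auto simp: unit_ball_def)
    have "hnorm H (T x) \<le> C * hnorm H x" using op_boundD[OF C(1) x(1)] .
    also have "\<dots> \<le> C" using x C by simp
    finally show ?thesis using x T C by (simp add: g_def unit_ball_def bounded_ops_closed hnorm_smult norm_divide)
  qed
  have main: "hnorm H (compose (carrier H) S T x \<ominus> compose (carrier H) S T y) < \<epsilon>"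
    if "U \<in> \<U>" "g x \<in> U" "g y \<in> U" "x \<in> unit_ball H" "y \<in> unit_ball H" for U x y
  proof -
    have c: "x \<in> carrier H" "y \<in> carrier H" using that by (auto simp: unit_ball_closed)
    have "S (g x) \<ominus> S (g y) = of_real (1 / C) \<odot> (S (T x) \<ominus> S (T y))"
      using c S T by (intro cinner_ext) (auto simp: g_def bounded_opsD cinner_simps algebra_simps)
    then have "hnorm H (S (g x) \<ominus> S (g y)) = hnorm H (S (T x) \<ominus> S (T y)) / C"
      using c S T C by (simp add: hnorm_smult bounded_ops_closed norm_divide)
    then show ?thesis using U(3)[OF that(1,2) g[OF that(4)] that(3) g[OF that(5)]] c C
      by (simp add: compose_eq divide_less_cancel)
  qed
  define \<V> where "\<V> = (\<lambda>U. g -` U) ` \<U>"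
  have "fine_cover (compose (carrier H) S T) \<epsilon> \<V>"
  proof (rule fine_coverI)
    show "finite \<V>" using U(1) by (simp add: \<V>_def)
    show "unit_ball H \<subseteq> \<Union>\<V>"
    proof
      fix x assume "x \<in> unit_ball H"
      then obtain A where "A \<in> \<U>" "g x \<in> A" using U(2) g by (meson UnionE subsetD)
      then show "x \<in> \<Union>\<V>" unfolding \<V>_def by (intro UnionI[of "g -` A"]) auto
    qed
  qed (use main in \<open>auto simp: \<V>_def\<close>)
  then show "\<exists>\<U>. fine_cover (compose (carrier H) S T) \<epsilon> \<U>" by blast
qed

lemma compact_smult:
  assumes "T \<in> compact_ops H"
  shows "(\<lambda>x\<in>carrier H. c \<odot> T x) \<in> compact_ops H"
proof -
  have "compose (carrier H) (\<lambda>x\<in>carrier H. c \<odot> (\<lambda>x\<in>carrier H. x) x) T \<in> compact_ops H"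
    using assms by (intro compact_compose_left op_smult op_id)
  moreover have "compose (carrier H) (\<lambda>x\<in>carrier H. c \<odot> (\<lambda>x\<in>carrier H. x) x) T = (\<lambda>x\<in>carrier H. c \<odot> T x)"
    using assms by (auto simp: compose_def bounded_ops_closed)
  ultimately show ?thesis by simp
qed

text \<open>The adjoint of a compact operator is compact, because
  \<open>\<parallel>T\<^sup>* (x - y)\<parallel>\<^sup>2 \<le> \<parallel>T T\<^sup>* (x - y)\<parallel> \<parallel>x - y\<parallel>\<close> and \<open>T T\<^sup>*\<close> is compact.\<close>

lemma compact_adjoint:
  assumes T: "T \<in> compact_ops H"
  shows "adjoint_op H T \<in> compact_ops H"
proof (rule compactI)
  have Tb: "T \<in> bounded_ops H" "adjoint_op H T \<in> bounded_ops H" using T by auto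
  then show "adjoint_op H T \<in> bounded_ops H" by simp
  fix \<epsilon> :: real assume e: "\<epsilon> > 0"
  have K: "compose (carrier H) T (adjoint_op H T) \<in> compact_ops H"
    using T by (intro compact_compose_right) auto
  obtain \<U> where U: "finite \<U>" "unit_ball H \<subseteq> \<Union>\<U>"
      "\<And>U x y. \<lbrakk>U \<in> \<U>; x \<in> U; x \<in> unit_ball H; y \<in> U; y \<in> unit_ball H\<rbrakk> \<Longrightarrow>
        hnorm H (compose (carrier H) T (adjoint_op H T) x \<ominus> compose (carrier H) T (adjoint_op H T) y) < \<epsilon>\<^sup>2 / 2"
    using compactE[OF K, of "\<epsilon>\<^sup>2 / 2"] e by auto
  have "hnorm H (adjoint_op H T x \<ominus> adjoint_op H T y) < \<epsilon>"
    if "U \<in> \<U>" "x \<in> U" "x \<in> unit_ball H" "y \<in> U" "y \<in> unit_ball H" for U x y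
  proof (rule power2_less_imp_less)
    have c: "x \<in> carrier H" "y \<in> carrier H" "hnorm H x \<le> 1" "hnorm H y \<le> 1" using that by (auto simp: unit_ball_def)
    let ?z = "x \<ominus> y"
    have z: "?z \<in> carrier H" "hnorm H ?z \<le> 2" using c hnorm_minus_le[of x y] by auto
    have "(hnorm H (adjoint_op H T ?z))\<^sup>2 = Re (cinner H (T (adjoint_op H T ?z)) ?z)"
      using z Tb adjoint[OF Tb(1), of "adjoint_op H T ?z" ?z] by (simp add: hnorm_sq bounded_ops_closed)
    also have "\<dots> \<le> cmod (cinner H (T (adjoint_op H T ?z)) ?z)" by (rule complex_Re_le_cmod)
    also have "\<dots> \<le> hnorm H (T (adjoint_op H T ?z)) * hnorm H ?z"
      using z Tb by (intro cauchy_schwarz) (auto simp: bounded_ops_closed)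
    also have "\<dots> \<le> hnorm H (T (adjoint_op H T ?z)) * 2"
      using z Tb by (intro mult_left_mono) (auto simp: bounded_ops_closed)
    also have "\<dots> < \<epsilon>\<^sup>2"
      using U(3)[OF that] c Tb by (simp add: compose_eq bounded_ops_minus bounded_ops_closed)
    finally show "(hnorm H (adjoint_op H T x \<ominus> adjoint_op H T y))\<^sup>2 < \<epsilon>\<^sup>2"
      using c Tb by (simp add: bounded_ops_minus)
  qed (use e in simp)
  then have "fine_cover (adjoint_op H T) \<epsilon> \<U>" using U(1,2) by (intro fine_coverI)
  then show "\<exists>\<U>. fine_cover (adjoint_op H T) \<epsilon> \<U>" by blast
qed

lemma compact_null: "op_null \<in> compact_ops H"
proof (rule compactI)
  fix \<epsilon> :: real assume "\<epsilon> > 0"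
  then have "fine_cover op_null \<epsilon> {unit_ball H}"
    by (intro fine_coverI) (auto simp: unit_ball_closed minus_eq_zero_iff[THEN iffD2])
  then show "\<exists>\<U>. fine_cover op_null \<epsilon> \<U>" by blast
qed simp

lemma compact_rank_one:
  assumes x: "x \<in> carrier H" and y: "y \<in> carrier H"
  shows "rank_one H x y \<in> compact_ops H"
proof (rule compactI)
  show "rank_one H x y \<in> bounded_ops H" using x y by simp
  fix \<epsilon> :: real assume e: "\<epsilon> > 0"
  define \<delta> where "\<delta> = \<epsilon> / (2 * (hnorm H x + 1))"
  have d: "\<delta> > 0" using e x by (auto simp: \<delta>_def intro!: divide_pos_pos mult_pos_pos add_nonneg_pos)
  have "compact (cball (0::complex) (hnorm H y))" by simp
  then obtain K where K: "finite K" "cball (0::complex) (hnorm H y) \<subseteq> (\<Union>k\<in>K. ball k \<delta>)"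
    using d unfolding compact_eq_totally_bounded by blast
  define \<U> where "\<U> = (\<lambda>k. {z \<in> carrier H. cinner H z y \<in> ball k \<delta>}) ` K"
  have "unit_ball H \<subseteq> \<Union>\<U>"
  proof
    fix z assume "z \<in> unit_ball H"
    then have z: "z \<in> carrier H" "hnorm H z \<le> 1" by (auto simp: unit_ball_def)
    have "cmod (cinner H z y) \<le> 1 * hnorm H y"
      using z y by (intro order_trans[OF cauchy_schwarz[OF z(1) y]] mult_right_mono) auto
    then have "cinner H z y \<in> cball 0 (hnorm H y)" by simp
    then show "z \<in> \<Union>\<U>" using K(2) z(1) unfolding \<U>_def by blast
  qed
  moreover have "hnorm H (rank_one H x y z \<ominus> rank_one H x y w) < \<epsilon>"
    if "k \<in> K" "cinner H z y \<in> ball k \<delta>" "cinner H w y \<in> ball k \<delta>" "z \<in> carrier H" "w \<in> carrier H" for k z w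
  proof -
    have "dist (cinner H z y) (cinner H w y) < 2 * \<delta>"
      using that(2,3) dist_triangle_half_r[of k "cinner H z y" "2 * \<delta>" "cinner H w y"] by simp
    then have lt: "cmod (cinner H z y - cinner H w y) < 2 * \<delta>" by (simp add: dist_norm)
    have "rank_one H x y z \<ominus> rank_one H x y w = (cinner H z y - cinner H w y) \<odot> x"
      using that x y by (intro cinner_ext) (auto simp: rank_one_def cinner_simps algebra_simps)
    then have "hnorm H (rank_one H x y z \<ominus> rank_one H x y w) = cmod (cinner H z y - cinner H w y) * hnorm H x"
      using x by (simp add: hnorm_smult)
    also have "\<dots> \<le> cmod (cinner H z y - cinner H w y) * (hnorm H x + 1)" by (intro mult_left_mono) auto
    also have "\<dots> < 2 * \<delta> * (hnorm H x + 1)"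
      using lt hnorm_nonneg[OF x] by (intro mult_strict_right_mono) auto
    also have "\<dots> = \<epsilon>" using hnorm_nonneg[OF x] by (simp add: \<delta>_def field_simps)
    finally show ?thesis .
  qed
  moreover have "finite \<U>" using K(1) by (simp add: \<U>_def)
  ultimately have "fine_cover (rank_one H x y) \<epsilon> \<U>"
    by (intro fine_coverI) (auto simp: \<U>_def)
  then show "\<exists>\<U>. fine_cover (rank_one H x y) \<epsilon> \<U>" by blast
qed

text \<open>The operator of finite rank that is the sum of \<open>rank_one x y\<close> over a list of pairs \<open>(x, y)\<close>.\<close>

primrec fin_rank :: "('a \<times> 'a) list \<Rightarrow> 'a \<Rightarrow> 'a" where
  "fin_rank [] = op_null"
| "fin_rank (p # ps) = op_plus (rank_one H (fst p) (snd p)) (fin_rank ps)"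

text \<open>The lists of pairs of vectors of \<open>H\<close>.\<close>

definition vpairs :: "('a \<times> 'a) list set" where "vpairs = lists (carrier H \<times> carrier H)"

lemma vpairs_Nil [simp]: "[] \<in> vpairs" by (simp add: vpairs_def)

lemma vpairs_Cons [simp]: "p # ps \<in> vpairs \<longleftrightarrow> fst p \<in> carrier H \<and> snd p \<in> carrier H \<and> ps \<in> vpairs"
  by (cases p) (auto simp: vpairs_def)

lemma fin_rank_compact: "ps \<in> vpairs \<Longrightarrow> fin_rank ps \<in> compact_ops H"
proof (induction ps)
  case Nil
  then show ?case using compact_null by simp
next
  case (Cons p ps)
  then show ?case using compact_add[OF compact_rank_one[of "fst p" "snd p"], of "fin_rank ps"] by simp
qed

lemma fin_rank_bounded [simp]: "ps \<in> vpairs \<Longrightarrow> fin_rank ps \<in> bounded_ops H"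
  using fin_rank_compact by simp

text \<open>Orthogonal projections of finite rank, built one orthonormal vector at a time.\<close>

inductive_set fin_proj :: "('a \<Rightarrow> 'a) set" where
  zero: "op_null \<in> fin_proj"
| step: "\<lbrakk>Q \<in> fin_proj; u \<in> carrier H; cinner H u u = 1; Q u = \<zero>\<rbrakk> \<Longrightarrow>
    op_plus (rank_one H u u) Q \<in> fin_proj"

lemma fin_proj:
  assumes "Q \<in> fin_proj"
  shows fin_proj_fin_rank: "\<exists>ps\<in>vpairs. Q = fin_rank ps"
    and fin_proj_sa: "adjoint_op H Q = Q"
    and fin_proj_idem: "z \<in> carrier H \<Longrightarrow> Q (Q z) = Q z"
proof -
  have "(\<exists>ps\<in>vpairs. Q = fin_rank ps) \<and> adjoint_op H Q = Q \<and> (\<forall>z\<in>carrier H. Q (Q z) = Q z)"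
    using assms
  proof (induction rule: fin_proj.induct)
    case zero
    show ?case by (intro conjI bexI[of _ "[]"]) (auto simp: op_null_adjoint)
  next
    case (step Q u)
    obtain ps where ps: "ps \<in> vpairs" "Q = fin_rank ps" using step.IH by blast
    have Q: "Q \<in> bounded_ops H" "adjoint_op H Q = Q" using ps step.IH by auto
    let ?P = "op_plus (rank_one H u u) Q"
    have P: "?P \<in> bounded_ops H" using Q step.hyps by simp
    have Qu: "cinner H (Q z) u = 0" if "z \<in> carrier H" for z
      using adjoint[OF Q(1) that step.hyps(2)] that Q step.hyps by simp
    have "?P (?P z) = ?P z" if z: "z \<in> carrier H" for z
    proof -
      have c: "Q z \<in> carrier H" "rank_one H u u z = cinner H z u \<odot> u" using z Q by (auto simp: bounded_ops_closed rank_one_def)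
      have "Q (cinner H z u \<odot> u \<oplus> Q z) = Q z"
        using z c step.hyps step.IH Q smult_r_null[of "cinner H z u"] by (simp add: bounded_opsD)
      moreover have "rank_one H u u (cinner H z u \<odot> u \<oplus> Q z) = cinner H z u \<odot> u"
        using z c step.hyps Qu by (simp add: rank_one_def cinner_simps)
      ultimately show ?thesis using z c step.hyps by simp
    qed
    moreover have "?P = fin_rank ((u, u) # ps)" using ps by simp
    moreover have "(u, u) # ps \<in> vpairs" using ps step.hyps by simp
    moreover have "adjoint_op H ?P = ?P"
      using Q step.hyps by (simp add: op_plus_adjoint adjoint_rank_one)
    ultimately show ?case by blast
  qed
  then show "\<exists>ps\<in>vpairs. Q = fin_rank ps" "adjoint_op H Q = Q"
    "z \<in> carrier H \<Longrightarrow> Q (Q z) = Q z" by blast+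
qed

lemma fin_proj_compact: "Q \<in> fin_proj \<Longrightarrow> Q \<in> compact_ops H"
  using fin_proj_fin_rank fin_rank_compact by blast

lemma fin_proj_bounded: "Q \<in> fin_proj \<Longrightarrow> Q \<in> bounded_ops H"
  using fin_proj_compact by simp

lemma fin_proj_form:
  assumes "Q \<in> fin_proj" "z \<in> carrier H"
  shows "Re (cinner H (Q z) z) = (hnorm H (Q z))\<^sup>2"
  using assms adjoint[OF fin_proj_bounded[OF assms(1)], of "Q z" z]
    fin_proj_sa[OF assms(1)] fin_proj_idem[OF assms] fin_proj_bounded[OF assms(1)]
  by (simp add: hnorm_sq bounded_ops_closed)

lemma fin_proj_orth:
  assumes "Q \<in> fin_proj" "z \<in> carrier H"
  shows "hnorm H (z \<ominus> Q z) \<le> hnorm H z"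
proof (rule power2_le_imp_le)
  have c: "Q z \<in> carrier H" using assms by (simp add: fin_proj_bounded bounded_ops_closed)
  have "Re (cinner H z (Q z)) = Re (cinner H (Q z) z)" using cinner_commute[OF c assms(2)] by simp
  then show "(hnorm H (z \<ominus> Q z))\<^sup>2 \<le> (hnorm H z)\<^sup>2"
    using fin_proj_form[OF assms] c assms by (simp add: hnorm_minus_sq)
qed (use assms in simp)

lemma fin_proj_norm:
  assumes "Q \<in> fin_proj" "z \<in> carrier H"
  shows "hnorm H (Q z) \<le> hnorm H z"
proof (rule power2_le_imp_le)
  have c: "Q z \<in> carrier H" using assms by (simp add: fin_proj_bounded bounded_ops_closed)
  have "Re (cinner H z (Q z)) = Re (cinner H (Q z) z)" using cinner_commute[OF c assms(2)] by simp
  then have "(hnorm H (z \<ominus> Q z))\<^sup>2 = (hnorm H z)\<^sup>2 - (hnorm H (Q z))\<^sup>2"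
    using fin_proj_form[OF assms] c assms by (simp add: hnorm_minus_sq)
  then show "(hnorm H (Q z))\<^sup>2 \<le> (hnorm H z)\<^sup>2" using zero_le_power2[of "hnorm H (z \<ominus> Q z)"] by linarith
qed (use assms in simp)

text \<open>One step of the Gram-Schmidt process: the new vector \<open>u\<close> is \<open>x - Q x\<close>, normalized.\<close>

lemma fin_proj_extend:
  assumes Q: "Q \<in> fin_proj" and x: "x \<in> carrier H"
  shows "\<exists>Q'\<in>fin_proj. Q' x = x \<and> (\<forall>z\<in>carrier H. Q z = z \<longrightarrow> Q' z = z)"
proof (cases "Q x = x")
  case False
  have Qb: "Q \<in> bounded_ops H" using Q by (rule fin_proj_bounded)
  define v where "v = x \<ominus> Q x"
  have v: "v \<in> carrier H" using x Qb by (simp add: v_def bounded_ops_closed)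
  have "v \<noteq> \<zero>" using False x Qb minus_eq_zero_iff[of x "Q x"] by (auto simp: v_def bounded_ops_closed)
  then have nv: "hnorm H v > 0" using v by (simp add: hnorm_pos)
  have Qv: "Q v = \<zero>"
    using x Qb fin_proj_idem[OF Q x] by (simp add: v_def bounded_ops_minus minus_eq_zero_iff bounded_ops_closed)
  define u where "u = of_real (1 / hnorm H v) \<odot> v"
  have u: "u \<in> carrier H" using v by (simp add: u_def)
  have uu: "cinner H u u = 1"
    using v nv cinner_self[OF v] by (simp add: u_def cinner_simps power2_eq_square)
  have Qu: "Q u = \<zero>" using v Qb Qv smult_r_null[of "of_real (1 / hnorm H v)"] by (simp add: u_def bounded_opsD)
  let ?P = "op_plus (rank_one H u u) Q"
  have P: "?P \<in> fin_proj" using fin_proj.step[OF Q u uu Qu] .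
  have fixu: "cinner H (Q z) u = 0" if "z \<in> carrier H" for z
    using adjoint[OF Qb that u] fin_proj_sa[OF Q] Qu that by simp
  have "?P x = x"
  proof -
    have "cinner H x v = cinner H v v"
    proof -
      have "cinner H (Q x) v = 0" using adjoint[OF Qb x v] fin_proj_sa[OF Q] Qv x by simp
      then show ?thesis using x v Qb by (simp add: v_def cinner_simps bounded_ops_closed)
    qed
    then have "rank_one H u u x = v"
      using x v nv cinner_self[OF v] u
      by (intro cinner_ext) (auto simp: rank_one_def u_def cinner_simps power2_eq_square)
    moreover have "v \<oplus> Q x = x"
      using x Qb by (intro cinner_ext) (auto simp: v_def bounded_ops_closed cinner_simps)
    ultimately show ?thesis using x by simp
  qed
  moreover have "?P z = z" if z: "z \<in> carrier H" "Q z = z" for z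
    using fixu[OF z(1)] z u by (simp add: rank_one_def)
  ultimately show ?thesis using P by blast
qed (use Q in blast)

lemma fin_proj_fixes:
  assumes "set xs \<subseteq> carrier H"
  shows "\<exists>Q\<in>fin_proj. \<forall>x\<in>set xs. Q x = x"
  using assms
proof (induction xs)
  case Nil
  then show ?case using fin_proj.zero by auto
next
  case (Cons x xs)
  then obtain Q where Q: "Q \<in> fin_proj" "\<forall>x\<in>set xs. Q x = x" by auto
  obtain Q' where "Q' \<in> fin_proj" "Q' x = x" "\<forall>z\<in>carrier H. Q z = z \<longrightarrow> Q' z = z"
    using fin_proj_extend[OF Q(1), of x] Cons.prems by auto
  then show ?case using Q Cons.prems by (intro bexI[of _ Q']) auto
qed

lemma fin_proj_join:
  assumes "Q1 \<in> fin_proj" "Q2 \<in> fin_proj"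
  shows "\<exists>Q\<in>fin_proj. \<forall>z\<in>carrier H. Q1 z = z \<or> Q2 z = z \<longrightarrow> Q z = z"
  using assms(2)
proof (induction rule: fin_proj.induct)
  case zero
  show ?case using assms(1) bounded_ops_zero[OF fin_proj_bounded[OF assms(1)]]
    by (intro bexI[of _ Q1]) auto
next
  case (step R u)
  then obtain Q where Q: "Q \<in> fin_proj" "\<forall>z\<in>carrier H. Q1 z = z \<or> R z = z \<longrightarrow> Q z = z" by blast
  obtain Q' where Q': "Q' \<in> fin_proj" "Q' u = u" "\<forall>z\<in>carrier H. Q z = z \<longrightarrow> Q' z = z"
    using fin_proj_extend[OF Q(1) step.hyps(2)] by blast
  have "Q' z = z" if z: "z \<in> carrier H" "op_plus (rank_one H u u) R z = z" for z
  proof -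
    have R: "R z \<in> carrier H" "R (R z) = R z"
      using z step.hyps fin_proj_idem[OF step.hyps(1) z(1)] by (auto simp: fin_proj_bounded bounded_ops_closed)
    then have "Q' (R z) = R z" using Q Q' by blast
    have e: "z = cinner H z u \<odot> u \<oplus> R z" using z step.hyps by (simp add: rank_one_def)
    have "Q' (cinner H z u \<odot> u \<oplus> R z) = cinner H z u \<odot> Q' u \<oplus> Q' (R z)"
      using fin_proj_bounded[OF Q'(1)] R step.hyps by (simp add: bounded_opsD)
    then show ?thesis using Q'(2) \<open>Q' (R z) = R z\<close> e by simp
  qed
  then show ?case using Q Q' by (intro bexI[of _ Q']) blast+
qed

lemma fin_proj_le:
  assumes "Q \<in> fin_proj" "Q' \<in> fin_proj" "\<And>z. z \<in> carrier H \<Longrightarrow> Q z = z \<Longrightarrow> Q' z = z"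
  shows "Q \<sqsubseteq>\<^bsub>sa_order H\<^esub> Q'"
proof -
  have "Re (cinner H (Q z) z) \<le> Re (cinner H (Q' z) z)" if z: "z \<in> carrier H" for z
  proof -
    have c: "Q z \<in> carrier H" "Q' z \<in> carrier H" using assms z by (auto simp: fin_proj_bounded bounded_ops_closed)
    have "Q' (Q z) = Q z" using assms c fin_proj_idem[OF assms(1) z] by blast
    then have "cinner H (Q z) z = cinner H (Q z) (Q' z)"
      using adjoint[OF fin_proj_bounded[OF assms(2)], of "Q z" z] c z fin_proj_sa[OF assms(2)] by simp
    then have "(hnorm H (Q z))\<^sup>2 \<le> hnorm H (Q z) * hnorm H (Q' z)"
      using fin_proj_form[OF assms(1) z] cauchy_schwarz[OF c] complex_Re_le_cmod[of "cinner H (Q z) (Q' z)"] by simp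
    then have "hnorm H (Q z) \<le> hnorm H (Q' z)"
      using c mult_left_le_imp_le[of "hnorm H (Q z)" "hnorm H (Q z)" "hnorm H (Q' z)"] hnorm_nonneg[OF c(1)] hnorm_nonneg[OF c(2)]
      by (cases "hnorm H (Q z) = 0") (auto simp: power2_eq_square)
    then show ?thesis using fin_proj_form[OF assms(1) z] fin_proj_form[OF assms(2) z] c by (simp add: power_mono)
  qed
  then show ?thesis by simp
qed

lemma fin_proj_directed:
  "\<forall>Q1\<in>fin_proj. \<forall>Q2\<in>fin_proj. \<exists>Q\<in>fin_proj. Q1 \<sqsubseteq>\<^bsub>sa_order H\<^esub> Q \<and> Q2 \<sqsubseteq>\<^bsub>sa_order H\<^esub> Q"
  using fin_proj_join fin_proj_le by meson

lemma fin_proj_lub: "least (sa_order H) (\<lambda>x\<in>carrier H. x) (Upper (sa_order H) fin_proj)"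
proof (rule least_UpperI)
  show "Q \<sqsubseteq>\<^bsub>sa_order H\<^esub> (\<lambda>x\<in>carrier H. x)" if "Q \<in> fin_proj" for Q
    using fin_proj_form[OF that] fin_proj_norm[OF that] that
    by (auto simp: hnorm_sq[symmetric] fin_proj_bounded bounded_ops_closed power_mono)
  show "fin_proj \<subseteq> carrier (sa_order H)" by (auto simp: fin_proj_bounded fin_proj_sa)
  show "(\<lambda>x\<in>carrier H. x) \<in> carrier (sa_order H)" by simp
  fix R assume R: "R \<in> Upper (sa_order H) fin_proj"
  have "Re (cinner H z z) \<le> Re (cinner H (R z) z)" if z: "z \<in> carrier H" for z
  proof -
    obtain Q where Q: "Q \<in> fin_proj" "Q z = z" using fin_proj_fixes[of "[z]"] z by auto
    then have "Q \<sqsubseteq>\<^bsub>sa_order H\<^esub> R" using R by (auto simp: Upper_def fin_proj_bounded fin_proj_sa)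
    then show ?thesis using Q(2) z by (metis sa_order_simps(2))
  qed
  then show "(\<lambda>x\<in>carrier H. x) \<sqsubseteq>\<^bsub>sa_order H\<^esub> R" by simp
qed

lemma fin_rank_compose:
  assumes T: "T \<in> bounded_ops H" and ps: "ps \<in> vpairs"
  shows "\<exists>qs\<in>vpairs. compose (carrier H) (fin_rank ps) T = fin_rank qs"
proof -
  define qs where "qs = map (\<lambda>(x, y). (x, adjoint_op H T y)) ps"
  have "qs \<in> vpairs \<and> (\<forall>z\<in>carrier H. fin_rank ps (T z) = fin_rank qs z)"
    unfolding qs_def using ps
  proof (induction ps)
    case Nil
    then show ?case using T by (simp add: bounded_ops_closed)
  next
    case (Cons p ps)
    then show ?case using T adjoint[OF T, of _ "snd p"]
      by (cases p) (auto simp: bounded_ops_closed rank_one_def)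
  qed
  then show ?thesis using T ps
    by (intro bexI[of _ qs] bounded_ops_eqI) (auto simp: compose_eq)
qed

text \<open>If \<open>Q\<close> fixes an \<open>\<epsilon>\<close>-net of the image of the unit ball under \<open>T\<close>, then \<open>\<parallel>T - Q T\<parallel> \<le> \<epsilon>\<close>.\<close>

lemma finite_rank_approx:
  assumes T: "T \<in> compact_ops H" and e: "\<epsilon> > 0"
  shows "\<exists>ps\<in>vpairs. op_bound H (op_minus T (fin_rank ps)) \<epsilon>"
proof -
  have Tb: "T \<in> bounded_ops H" using T by simp
  obtain F where F: "finite F" "F \<subseteq> unit_ball H" "\<forall>x\<in>unit_ball H. \<exists>y\<in>F. hnorm H (T x \<ominus> T y) < \<epsilon>"
    using T e unfolding compact_ops_iff_net by blast
  obtain ys where ys: "set ys = F" using finite_list[OF F(1)] by blast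
  have "set (map T ys) \<subseteq> carrier H" using F ys Tb by (auto simp: unit_ball_closed bounded_ops_closed)
  from fin_proj_fixes[OF this] obtain Q where Q: "Q \<in> fin_proj" "\<forall>y\<in>F. Q (T y) = T y" using ys by auto
  have Qb: "Q \<in> bounded_ops H" using Q by (simp add: fin_proj_bounded)
  obtain ps where "ps \<in> vpairs" "Q = fin_rank ps" using fin_proj_fin_rank[OF Q(1)] by blast
  then obtain qs where qs: "qs \<in> vpairs" "compose (carrier H) Q T = fin_rank qs" using fin_rank_compose[OF Tb] by blast
  have qsT: "op_minus T (fin_rank qs) x = T x \<ominus> Q (T x)" if "x \<in> carrier H" for x
    using that qs(1) Tb op_minus_apply[of T "fin_rank qs" x] compose_eq[of x "carrier H" Q T] unfolding qs(2) by simp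
  have ball: "hnorm H (T x \<ominus> Q (T x)) \<le> \<epsilon>" if x: "x \<in> unit_ball H" for x
  proof -
    obtain y where y: "y \<in> F" "hnorm H (T x \<ominus> T y) < \<epsilon>" using F(3) x by blast
    have c: "T x \<in> carrier H" "T y \<in> carrier H" using x y F Tb by (auto simp: unit_ball_closed bounded_ops_closed)
    have "(T x \<ominus> T y) \<ominus> Q (T x \<ominus> T y) = T x \<ominus> Q (T x)"
      using c Qb Q(2) y(1) by (intro cinner_ext) (auto simp: bounded_ops_minus bounded_ops_closed cinner_simps)
    then show ?thesis using fin_proj_orth[OF Q(1), of "T x \<ominus> T y"] c y(2) by simp
  qed
  have "op_bound H (op_minus T (fin_rank qs)) \<epsilon>"
    unfolding op_bound_def
  proof (intro conjI ballI)
    fix x assume x: "x \<in> carrier H"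
    show "hnorm H (op_minus T (fin_rank qs) x) \<le> \<epsilon> * hnorm H x"
    proof (cases "hnorm H x = 0")
      case True
      then have "x = \<zero>" using x by (simp add: hnorm_eq_0)
      then show ?thesis using qs Tb by (simp add: bounded_ops_zero)
    next
      case False
      then have n: "hnorm H x > 0" using hnorm_nonneg[OF x] by simp
      define c where "c = complex_of_real (1 / hnorm H x)"
      have "c \<odot> x \<in> unit_ball H" using x n by (simp add: unit_ball_def hnorm_smult c_def norm_divide)
      from ball[OF this] have "hnorm H (op_minus T (fin_rank qs) (c \<odot> x)) \<le> \<epsilon>" using x qsT by simp
      moreover have "hnorm H (op_minus T (fin_rank qs) (c \<odot> x)) = hnorm H (op_minus T (fin_rank qs) x) / hnorm H x"
        using x qs Tb n bounded_ops_smult[of "op_minus T (fin_rank qs)" x c] bounded_ops_closed[of "op_minus T (fin_rank qs)" x]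
        by (simp add: hnorm_smult c_def norm_divide)
      ultimately show ?thesis using n by (simp add: divide_le_eq)
    qed
  qed (use e in simp)
  then show ?thesis using qs(1) by blast
qed

section \<open>Norm bounds from quasi-inverses\<close>

text \<open>If all \<open>1 - a\<^sup>*a/t\<close> with \<open>t > C\<^sup>2\<close> are right invertible, then \<open>\<parallel>a\<parallel> \<le> C\<close>, since \<open>\<parallel>a\<parallel>\<^sup>2\<close> is an
  approximate eigenvalue of \<open>a\<^sup>*a\<close>. The operator \<open>Y\<close> stands for the inverse minus 1.\<close>

lemma norm_bound_from_inverses:
  assumes a: "a \<in> bounded_ops H" and C: "0 \<le> C"
    and inv: "\<And>t. t > C\<^sup>2 \<Longrightarrow> \<exists>Y\<in>bounded_ops H. \<forall>h\<in>carrier H.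
        Y h = of_real (1 / t) \<odot> adjoint_op H a (a (h \<oplus> Y h))"
  shows "op_bound H a C"
proof (rule ccontr)
  assume "\<not> op_bound H a C"
  then obtain x where x: "x \<in> carrier H" "hnorm H (a x) > C * hnorm H x" using C by (auto simp: op_bound_def)
  have ac: "a h \<in> carrier H" if "h \<in> carrier H" for h using a that by (simp add: bounded_ops_closed)
  have nx: "hnorm H x > 0"
    using x a by (intro hnorm_pos) (auto simp: bounded_ops_zero)
  define V where "V = {(hnorm H (a h))\<^sup>2 |h. h \<in> carrier H \<and> hnorm H h = 1}"
  define M where "M = Sup V"
  obtain B where B: "op_bound H a B" using bounded_ops_bound[OF a] .
  have bdd: "bdd_above V"
    unfolding V_def using op_boundD[OF B] ac by (intro bdd_aboveI[of _ "B\<^sup>2"]) (force intro!: power_mono)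
  define x1 where "x1 = of_real (1 / hnorm H x) \<odot> x"
  have x1: "x1 \<in> carrier H" "hnorm H x1 = 1" using x nx by (auto simp: x1_def hnorm_smult norm_divide)
  have "hnorm H (a x1) = hnorm H (a x) / hnorm H x"
    using x nx a ac by (simp add: x1_def bounded_ops_smult hnorm_smult norm_divide)
  then have "hnorm H (a x1) > C" using x nx by (simp add: less_divide_eq)
  then have "(hnorm H (a x1))\<^sup>2 > C\<^sup>2" using C by (intro power_strict_mono) auto
  moreover have x1V: "(hnorm H (a x1))\<^sup>2 \<in> V" unfolding V_def using x1 by blast
  ultimately have MC: "M > C\<^sup>2" unfolding M_def using bdd by (meson cSup_upper less_le_trans)
  then have M0: "M > 0" using zero_le_power2[of C] by linarith
  have aM1: "(hnorm H (a h))\<^sup>2 \<le> M" if "h \<in> carrier H" "hnorm H h = 1" for h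
    unfolding M_def using bdd that by (intro cSup_upper) (auto simp: V_def)
  have aM: "op_bound H a (sqrt M)"
    unfolding op_bound_def
  proof (intro conjI ballI)
    fix h assume h: "h \<in> carrier H"
    show "hnorm H (a h) \<le> sqrt M * hnorm H h"
    proof (cases "hnorm H h = 0")
      case True
      then show ?thesis using h a by (simp add: hnorm_eq_0 bounded_ops_zero)
    next
      case False
      then have n: "hnorm H h > 0" using hnorm_nonneg[OF h] by simp
      have "hnorm H (of_real (1 / hnorm H h) \<odot> h) = 1" using h n by (simp add: hnorm_smult norm_divide)
      then have "(hnorm H (a (of_real (1 / hnorm H h) \<odot> h)))\<^sup>2 \<le> M" using h by (intro aM1) auto
      then have "hnorm H (a (of_real (1 / hnorm H h) \<odot> h)) \<le> sqrt M" by (rule real_le_rsqrt)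
      then show ?thesis using h a n ac by (simp add: bounded_ops_smult hnorm_smult norm_divide divide_le_eq)
    qed
  qed (use M0 in simp)
  obtain Y where Y: "Y \<in> bounded_ops H"
    "\<And>h. h \<in> carrier H \<Longrightarrow> Y h = of_real (1 / M) \<odot> adjoint_op H a (a (h \<oplus> Y h))" using inv[OF MC] by blast
  obtain D where D: "op_bound H Y D" using bounded_ops_bound[OF Y(1)] .
  have D0: "0 \<le> D" using D by (simp add: op_bound_def)
  \<comment> \<open>A unit vector that almost attains \<open>M = \<parallel>a\<parallel>\<^sup>2\<close> is almost fixed by \<open>b = a\<^sup>*a/M\<close>, which contradicts
    that \<open>1 - b\<close> is bounded below by \<open>1 / (1 + D)\<close>.\<close>
  define \<delta> where "\<delta> = 1 / (4 * (1 + D)\<^sup>2)"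
  have d: "\<delta> > 0" using D0 by (auto simp: \<delta>_def intro!: divide_pos_pos mult_pos_pos)
  have "M * (1 - \<delta>) < M" using M0 d by simp
  then obtain h where h: "h \<in> carrier H" "hnorm H h = 1" "M * (1 - \<delta>) < (hnorm H (a h))\<^sup>2"
    unfolding M_def using less_cSupD[of V] x1V unfolding V_def by blast
  define b where "b h = of_real (1 / M) \<odot> adjoint_op H a (a h)" for h
  have bc: "b k \<in> carrier H" if "k \<in> carrier H" for k using that a by (simp add: b_def bounded_ops_closed)
  have badj: "cinner H (b k) l = cinner H k (b l)" if "k \<in> carrier H" "l \<in> carrier H" for k l
    using that a adjoint[OF a, of k "a l"] adjoint'[OF a, of "a k" l] by (simp add: b_def cinner_simps bounded_ops_closed)
  define g where "g = h \<ominus> b h"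
  have gc: "g \<in> carrier H" using h bc by (simp add: g_def)
  have hY: "h \<oplus> Y h \<in> carrier H" using h Y by (simp add: bounded_ops_closed)
  have "cinner H h h = cinner H g (h \<oplus> Y h)"
  proof -
    have "cinner H g (h \<oplus> Y h) = cinner H h (h \<oplus> Y h) - cinner H h (b (h \<oplus> Y h))"
      using h bc hY badj[OF h(1) hY] by (simp add: g_def cinner_minus)
    also have "b (h \<oplus> Y h) = Y h" using Y(2)[OF h(1)] by (simp add: b_def)
    finally show ?thesis using h Y by (simp add: cinner_simps bounded_ops_closed)
  qed
  then have "1 = cmod (cinner H g (h \<oplus> Y h))" using cinner_self[OF h(1)] h(2) by simp
  also have "\<dots> \<le> hnorm H g * hnorm H (h \<oplus> Y h)" by (rule cauchy_schwarz[OF gc hY])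
  also have "\<dots> \<le> hnorm H g * (1 + D)"
    using hnorm_triangle[of h "Y h"] op_boundD[OF D h(1)] h Y gc
    by (intro mult_left_mono) (auto simp: bounded_ops_closed)
  finally have one: "1 \<le> hnorm H g * (1 + D)" .
  have "(hnorm H g)\<^sup>2 \<le> 2 * \<delta>"
  proof -
    have "hnorm H (b h) \<le> 1"
    proof -
      have "hnorm H (adjoint_op H a (a h)) \<le> sqrt M * hnorm H (a h)"
        using op_boundD[OF adjoint_bound[OF a aM] ac[OF h(1)]] .
      also have "\<dots> \<le> sqrt M * (sqrt M * 1)"
        using op_boundD[OF aM h(1)] h(2) M0 by (intro mult_left_mono) auto
      finally have "hnorm H (adjoint_op H a (a h)) \<le> M" using M0 by simp
      then show ?thesis using h a M0 ac by (simp add: b_def hnorm_smult norm_divide bounded_ops_closed)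
    qed
    then have b1: "(hnorm H (b h))\<^sup>2 \<le> 1" using bc[OF h(1)] by (simp add: power_le_one)
    have "cinner H h (b h) = of_real (1 / M) * of_real ((hnorm H (a h))\<^sup>2)"
      using h a adjoint[OF a, of h "a h"] cinner_self[OF ac[OF h(1)]] by (simp add: b_def cinner_simps bounded_ops_closed)
    then have "Re (cinner H h (b h)) = (hnorm H (a h))\<^sup>2 / M" by simp
    moreover have "1 - \<delta> < (hnorm H (a h))\<^sup>2 / M" using h(3) M0 by (simp add: less_divide_eq mult.commute)
    ultimately have "Re (cinner H h (b h)) > 1 - \<delta>" by simp
    then show ?thesis using hnorm_minus_sq[OF h(1) bc[OF h(1)]] h(2) b1 by (simp add: g_def)
  qed
  moreover have "1 \<le> (hnorm H g)\<^sup>2 * (1 + D)\<^sup>2"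
    using one power_mono[of 1 "hnorm H g * (1 + D)" 2] by (simp add: power_mult_distrib)
  ultimately have "1 \<le> (2 * \<delta>) * (1 + D)\<^sup>2" by (meson mult_right_mono order_trans zero_le_power2)
  also have "\<dots> = 1 / 2" using D0 by (simp add: \<delta>_def)
  finally show False by simp
qed

end


section \<open>Uniqueness of homomorphisms of operator algebras\<close>

lemma star_homD:
  assumes "star_hom A B f"
  shows star_hom_closed: "x \<in> carrier A \<Longrightarrow> f x \<in> carrier B"
    and star_hom_add: "x \<in> carrier A \<Longrightarrow> y \<in> carrier A \<Longrightarrow> f (x \<oplus>\<^bsub>A\<^esub> y) = f x \<oplus>\<^bsub>B\<^esub> f y"
    and star_hom_smult: "x \<in> carrier A \<Longrightarrow> f (c \<odot>\<^bsub>A\<^esub> x) = c \<odot>\<^bsub>B\<^esub> f x"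
    and star_hom_mult: "x \<in> carrier A \<Longrightarrow> y \<in> carrier A \<Longrightarrow> f (x \<otimes>\<^bsub>A\<^esub> y) = f x \<otimes>\<^bsub>B\<^esub> f y"
    and star_hom_star: "x \<in> carrier A \<Longrightarrow> f (star A x) = star B (f x)"
  using assms by (auto simp: star_hom_def)

context hilbert_space begin

lemma compact_minus:
  "S \<in> compact_ops H \<Longrightarrow> T \<in> compact_ops H \<Longrightarrow> op_minus S T \<in> compact_ops H"
  unfolding op_minus_def using compact_add[of S "\<lambda>x\<in>carrier H. (-1) \<odot> T x"] compact_smult[of T "-1"]
  by (simp add: op_plus_def)

end

text \<open>A homomorphism from the compact operators to \<open>B(H)\<close> is contractive: the algebra of compact
  operators contains the quasi-inverses of its elements of norm below 1.\<close>

lemma compact_hom_bound: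
  assumes X: "hilbert_space X" and H: "hilbert_space H"
    and f: "star_hom (Kop X) (Bop H) f" and T: "T \<in> compact_ops X" and C: "op_bound X T C"
  shows "op_bound H (f T) C"
proof -
  interpret X: hilbert_space X by (rule X)
  interpret H: hilbert_space H by (rule H)
  note fD = star_homD[OF f, simplified]
  have Tb: "T \<in> bounded_ops X" using T by simp
  have C0: "0 \<le> C" using C by (simp add: op_bound_def)
  have fT: "f T \<in> bounded_ops H" using fD(1) T by simp
  show ?thesis
  proof (rule H.norm_bound_from_inverses[OF fT C0])
    fix t assume t: "t > C\<^sup>2"
    then have t0: "t > 0" using zero_le_power2[of C] by linarith
    define TT where "TT = compose (carrier X) (adjoint_op X T) T"
    have TT: "TT \<in> compact_ops X" unfolding TT_def using T Tb by (intro X.compact_compose_left) auto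
    have TTb: "TT \<in> bounded_ops X" "adjoint_op X TT = TT"
      using TT Tb by (auto simp: TT_def X.adjoint_compose)
    have TTC: "op_bound X TT (C * C)"
      unfolding TT_def using C Tb by (intro X.op_bound_compose X.adjoint_bound) auto
    define B where "B = (\<lambda>x\<in>carrier X. of_real (1 / t) \<odot>\<^bsub>X\<^esub> TT x)"
    have B: "B \<in> compact_ops X" unfolding B_def by (rule X.compact_smult[OF TT])
    have Bb: "B \<in> bounded_ops X" "adjoint_op X B = B"
      using B TTb(2) X.adjoint_smult[OF TTb(1), of "of_real (1 / t)"]
      by (auto simp: B_def simp del: of_real_divide)
    have "op_bound X B (C * C / t)"
      unfolding B_def using X.op_bound_smult[OF TTC TTb(1), of "of_real (1 / t)"] t0 by (simp add: norm_divide)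
    moreover have "C * C / t < 1" using t t0 by (simp add: power2_eq_square)
    ultimately obtain Z where Z: "Z \<in> bounded_ops X" "\<And>y. y \<in> carrier X \<Longrightarrow> Z y = y \<oplus>\<^bsub>X\<^esub> B (Z y)"
      using X.neumann_selfadjoint[OF Bb] by blast
    \<comment> \<open>The quasi-inverse \<open>y = B (1 - B)\<^sup>-\<^sup>1\<close> is compact, and \<open>y = B + B y\<close>.\<close>
    define y where "y = compose (carrier X) B Z"
    have y: "y \<in> compact_ops X" unfolding y_def by (rule X.compact_compose_right[OF B Z(1)])
    have By: "compose (carrier X) B y \<in> compact_ops X" using B y by (intro X.compact_compose_left) auto
    have yeq: "y = (\<lambda>x\<in>carrier X. B x \<oplus>\<^bsub>X\<^esub> compose (carrier X) B y x)"
    proof (rule X.bounded_ops_eqI)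
      fix x w assume x: "x \<in> carrier X" "w \<in> carrier X"
      have c: "Z x \<in> carrier X" "B (Z x) \<in> carrier X" using x Z(1) Bb by (auto simp: X.bounded_ops_closed)
      have "B (Z x) = B (x \<oplus>\<^bsub>X\<^esub> B (Z x))" using Z(2)[OF x(1)] by simp
      also have "\<dots> = B x \<oplus>\<^bsub>X\<^esub> B (B (Z x))" using x c Bb by (simp add: X.bounded_ops_add)
      finally show "cinner X (y x) w = cinner X ((\<lambda>x\<in>carrier X. B x \<oplus>\<^bsub>X\<^esub> compose (carrier X) B y x) x) w"
        using x c by (simp add: y_def compose_eq)
    qed (use y B By in \<open>auto intro!: X.op_add\<close>)
    have fB: "f B = (\<lambda>h\<in>carrier H. of_real (1 / t) \<odot>\<^bsub>H\<^esub> adjoint_op H (f T) (f T h))"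
    proof -
      have "f TT = compose (carrier H) (adjoint_op H (f T)) (f T)"
        unfolding TT_def using fD(4)[of "adjoint_op X T" T] fD(5)[OF T] T X.compact_adjoint by simp
      moreover have "f B = (\<lambda>h\<in>carrier H. of_real (1 / t) \<odot>\<^bsub>H\<^esub> f TT h)"
        unfolding B_def by (rule fD(3)[OF TT])
      ultimately show ?thesis by (auto simp: compose_def)
    qed
    have "f y = (\<lambda>h\<in>carrier H. f B h \<oplus>\<^bsub>H\<^esub> f (compose (carrier X) B y) h)"
      by (subst yeq) (rule fD(2)[OF B By])
    then have fy: "f y = (\<lambda>h\<in>carrier H. f B h \<oplus>\<^bsub>H\<^esub> compose (carrier H) (f B) (f y) h)"
      using fD(4)[OF B y] by simp
    have fyb: "f y \<in> bounded_ops H" and fBb: "f B \<in> bounded_ops H" using fD(1) y B by auto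
    have "f y h = of_real (1 / t) \<odot>\<^bsub>H\<^esub> adjoint_op H (f T) (f T (h \<oplus>\<^bsub>H\<^esub> f y h))" if h: "h \<in> carrier H" for h
    proof -
      have c: "f y h \<in> carrier H" using h fyb by (simp add: H.bounded_ops_closed)
      have "f y h = f B h \<oplus>\<^bsub>H\<^esub> f B (f y h)" using fun_cong[OF fy, of h] h by (simp add: compose_eq)
      also have "\<dots> = f B (h \<oplus>\<^bsub>H\<^esub> f y h)" using h c fBb by (simp add: H.bounded_ops_add)
      also have "\<dots> = of_real (1 / t) \<odot>\<^bsub>H\<^esub> adjoint_op H (f T) (f T (h \<oplus>\<^bsub>H\<^esub> f y h))" using h c by (simp add: fB)
      finally show ?thesis .
    qed
    then show "\<exists>Y\<in>bounded_ops H. \<forall>h\<in>carrier H.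
        Y h = of_real (1 / t) \<odot>\<^bsub>H\<^esub> adjoint_op H (f T) (f T (h \<oplus>\<^bsub>H\<^esub> Y h))" using fyb by blast
  qed
qed

context tensor_map begin

lemma amp_plus: "S \<in> bounded_ops X \<Longrightarrow> T \<in> bounded_ops X \<Longrightarrow> amp (X.op_plus S T) = H.op_plus (amp S) (amp T)"
  by (simp add: X.op_plus_def H.op_plus_def amp_add)

lemma amp_null: "amp X.op_null = H.op_null"
proof (rule amp_eqI)
  fix x k assume "x \<in> carrier X" "k \<in> carrier K"
  then show "H.op_null (m x k) = m (X.op_null x) k" using m_smult[of "\<zero>\<^bsub>X\<^esub>" k 0] by simp
qed (auto simp: perp_closed)

lemma amp_minus: "S \<in> bounded_ops X \<Longrightarrow> T \<in> bounded_ops X \<Longrightarrow> amp (X.op_minus S T) = H.op_minus (amp S) (amp T)"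
  unfolding X.op_minus_def H.op_minus_def by (simp only: amp_add X.op_smult amp_smult)

text \<open>By contractivity and approximation by operators of finite rank, a homomorphism on the compact
  operators is determined by its values on the operators of rank one.\<close>

lemma compact_hom_unique:
  assumes f: "star_hom (Kop X) (Bop H) f"
    and rank: "\<And>x y. x \<in> carrier X \<Longrightarrow> y \<in> carrier X \<Longrightarrow> f (rank_one X x y) = amp (rank_one X x y)"
    and T: "T \<in> compact_ops X"
  shows "f T = amp T"
proof -
  note fD = star_homD[OF f, simplified]
  have fplus: "f (X.op_plus S S') = H.op_plus (f S) (f S')" if "S \<in> compact_ops X" "S' \<in> compact_ops X" for S S'
    using fD(2)[OF that] by (simp add: X.op_plus_def H.op_plus_def)
  have fnull: "f X.op_null = H.op_null"
  proof -
    have "X.op_null = (\<lambda>x\<in>carrier X. 0 \<odot>\<^bsub>X\<^esub> X.op_null x)" by (auto simp: X.op_null_def)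
    then have e: "f X.op_null = (\<lambda>h\<in>carrier H. 0 \<odot>\<^bsub>H\<^esub> f X.op_null h)"
      using fD(3)[OF X.compact_null, of 0] by simp
    have "f X.op_null h = \<zero>\<^bsub>H\<^esub>" if "h \<in> carrier H" for h
      using fun_cong[OF e, of h] that fD(1)[OF X.compact_null] by (simp add: H.bounded_ops_closed)
    then show ?thesis
      using fD(1)[OF X.compact_null] by (intro H.bounded_ops_eqI) auto
  qed
  have ffr: "f (X.fin_rank ps) = amp (X.fin_rank ps)" if "ps \<in> X.vpairs" for ps
    using that
  proof (induction ps)
    case (Cons p ps)
    then show ?case using fplus[OF X.compact_rank_one X.fin_rank_compact, of "fst p" "snd p" ps] rank
      by (simp add: amp_plus)
  qed (simp add: fnull amp_null)
  have fminus: "f (X.op_minus S S') = H.op_minus (f S) (f S')" if "S \<in> compact_ops X" "S' \<in> compact_ops X" for S S'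
  proof -
    have c: "(\<lambda>x\<in>carrier X. (-1) \<odot>\<^bsub>X\<^esub> S' x) \<in> compact_ops X" by (rule X.compact_smult[OF that(2)])
    show ?thesis unfolding X.op_minus_def H.op_minus_def
      using fD(2)[OF that(1) c] fD(3)[OF that(2), of "-1"] by simp
  qed
  have fT: "f T \<in> bounded_ops H" "amp T \<in> bounded_ops H" using fD(1) T by auto
  have "f T h = amp T h" if h: "h \<in> carrier H" for h
  proof -
    have c: "f T h \<in> carrier H" "amp T h \<in> carrier H" using fT h by (auto simp: H.bounded_ops_closed)
    have "hnorm H (f T h \<ominus>\<^bsub>H\<^esub> amp T h) \<le> 0 + e" if e: "e > 0" for e
    proof -
      define N where "N = hnorm H h + 1"
      define \<epsilon> where "\<epsilon> = e / (2 * N)"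
      have n: "N > 0" using h by (simp add: N_def add_nonneg_pos)
      have "\<epsilon> > 0" using e n by (simp add: \<epsilon>_def)
      from X.finite_rank_approx[OF T this] obtain ps where ps: "ps \<in> X.vpairs" "op_bound X (X.op_minus T (X.fin_rank ps)) \<epsilon>" by blast
      define F where "F = X.fin_rank ps"
      have F: "F \<in> compact_ops X" "f F = amp F" using ps X.fin_rank_compact ffr by (auto simp: F_def)
      have Fc: "amp F h \<in> carrier H" using F h by (simp add: H.bounded_ops_closed)
      have "op_bound H (f (X.op_minus T F)) \<epsilon>"
        using compact_hom_bound[OF X.hilbert_space_axioms H.hilbert_space_axioms f X.compact_minus[OF T F(1)]] ps by (simp add: F_def)
      then have 1: "hnorm H (f T h \<ominus>\<^bsub>H\<^esub> amp F h) \<le> \<epsilon> * hnorm H h"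
        using H.op_boundD[of "f (X.op_minus T F)" \<epsilon> h] h fT F fminus[OF T F(1)] by (simp add: H.op_minus_apply)
      have "op_bound H (amp (X.op_minus T F)) \<epsilon>" using amp_bound[of "X.op_minus T F"] T F ps by (simp add: F_def)
      then have 2: "hnorm H (amp T h \<ominus>\<^bsub>H\<^esub> amp F h) \<le> \<epsilon> * hnorm H h"
        using H.op_boundD[of "amp (X.op_minus T F)" \<epsilon> h] h T F by (simp add: H.op_minus_apply amp_minus)
      have "hnorm H (f T h \<ominus>\<^bsub>H\<^esub> amp T h) \<le> hnorm H (f T h \<ominus>\<^bsub>H\<^esub> amp F h) + hnorm H (amp F h \<ominus>\<^bsub>H\<^esub> amp T h)"
        by (rule H.hnorm_triangle3[OF c(1) Fc c(2)])
      also have "\<dots> \<le> 2 * \<epsilon> * hnorm H h" using 1 2 H.hnorm_minus_commute[OF Fc c(2)] by simp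
      also have "\<dots> \<le> 2 * \<epsilon> * N" using \<open>\<epsilon> > 0\<close> by (simp add: N_def)
      also have "\<dots> = e" using n by (simp add: \<epsilon>_def)
      finally show ?thesis by simp
    qed
    then have "hnorm H (f T h \<ominus>\<^bsub>H\<^esub> amp T h) \<le> 0" by (rule field_le_epsilon)
    then have "hnorm H (f T h \<ominus>\<^bsub>H\<^esub> amp T h) = 0" using c by (intro order_antisym) auto
    then show ?thesis using c by (simp add: H.hnorm_eq_0 H.minus_eq_zero_iff)
  qed
  then show ?thesis using fT by (intro H.bounded_ops_eqI) auto
qed

lemma compact_star_hom_amp: "star_hom (Kop X) (Bop H) (\<lambda>T\<in>compact_ops X. amp T)"
  using X.compact_add X.compact_smult X.compact_compose_left X.compact_adjoint
  by (auto simp: star_hom_def amp_add amp_smult amp_compose amp_adjoint X.op_plus_def)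

text \<open>The identity is the supremum of the finite rank projections, so that a normal homomorphism
  is determined by its values on compact operators.\<close>

lemma normal_hom_unique:
  assumes f: "star_hom (Bop X) (Bop H) f" and n: "normal_map X H f"
    and cpt: "\<And>T. T \<in> compact_ops X \<Longrightarrow> f T = amp T"
    and T: "T \<in> bounded_ops X"
  shows "f T = amp T"
proof -
  note fD = star_homD[OF f, simplified]
  have img: "f ` X.fin_proj = rho_amp ` X.fin_proj"
    using cpt by (auto simp: rho_amp_def image_iff X.fin_proj_compact intro!: bexI)
  have sub: "X.fin_proj \<subseteq> carrier (sa_order X)" by (auto simp: X.fin_proj_bounded X.fin_proj_sa)
  have ne: "X.fin_proj \<noteq> {}" using X.fin_proj.zero by blast
  have 1: "least (sa_order H) (f idX) (Upper (sa_order H) (rho_amp ` X.fin_proj))"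
    using n[unfolded normal_map_def, rule_format, OF sub ne _ X.fin_proj_lub] X.fin_proj_directed
    unfolding img idX_def by blast
  have 2: "least (sa_order H) (amp idX) (Upper (sa_order H) (rho_amp ` X.fin_proj))"
    using normal_amp[unfolded normal_map_def, rule_format, OF sub ne _ X.fin_proj_lub] X.fin_proj_directed
    unfolding idX_def[symmetric] by (auto simp: rho_amp_def)
  have fid: "f idX = amp idX"
  proof (rule H.selfadjoint_eqI)
    show "f idX \<in> bounded_ops H" "adjoint_op H (f idX) = f idX" using least_closed[OF 1] by auto
    show "amp idX \<in> bounded_ops H" "adjoint_op H (amp idX) = amp idX" using least_closed[OF 2] by auto
    fix h assume "h \<in> carrier H"
    then show "Re (cinner H (f idX h) h) = Re (cinner H (amp idX h) h)"
      using least_le[OF 1 least_mem[OF 2]] least_le[OF 2 least_mem[OF 1]] by (simp add: order_antisym)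
  qed
  have Tid: "compose (carrier X) T idX = T"
    using T by (intro X.bounded_ops_eqI) (auto, simp add: compose_eq X.bounded_ops_closed)
  show ?thesis
  proof (rule ops_eqI)
    show fT: "f T \<in> bounded_ops H" using fD(1) T by simp
    show "amp T \<in> bounded_ops H" using T by simp
    have fcomp: "f (compose (carrier X) T S) h = f T (f S h)" if "S \<in> bounded_ops X" "h \<in> carrier H" for S h
      using fD(4)[OF T that(1)] that(2) by (simp add: compose_eq)
    show "f T h = amp T h" if h: "h \<in> perp" for h
    proof -
      have "f T h = f T (amp idX h)" using fcomp[OF idX_op perp_closed[OF h]] Tid fid by simp
      also have "\<dots> = \<zero>\<^bsub>H\<^esub>" using h fT by (simp add: H.bounded_ops_zero)
      finally show ?thesis using h T by simp
    qed
    fix x k assume xk: "x \<in> carrier X" "k \<in> carrier K"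
    show "f T (m x k) = amp T (m x k)"
    proof (cases "x = \<zero>\<^bsub>X\<^esub>")
      case True
      then have "m x k = \<zero>\<^bsub>H\<^esub>" using m_smult[of "\<zero>\<^bsub>X\<^esub>" k 0] xk by simp
      then show ?thesis using fT T by (simp add: H.bounded_ops_zero)
    next
      case False
      \<comment> \<open>A multiple of \<open>rank_one x x\<close> fixes \<open>m x k\<close>, and its product with \<open>T\<close> is compact.\<close>
      define c where "c = cinner X x x"
      have c: "c \<noteq> 0" using False X.cinner_eq_0[OF xk(1)] by (auto simp: c_def)
      have R: "rank_one X x x \<in> compact_ops X" using X.compact_rank_one xk by simp
      have TR: "compose (carrier X) T (rank_one X x x) \<in> compact_ops X" using X.compact_compose_left[OF T R] .
      have cm: "amp (rank_one X x x) (m x k) = c \<odot>\<^bsub>H\<^esub> m x k"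
        using xk R by (simp add: c_def rank_one_def[of X x x] m_smult)
      have "c \<odot>\<^bsub>H\<^esub> f T (m x k) = f T (amp (rank_one X x x) (m x k))"
        unfolding cm using fT xk by (simp add: H.bounded_ops_smult)
      also have "\<dots> = f (compose (carrier X) T (rank_one X x x)) (m x k)"
        using fcomp[of "rank_one X x x" "m x k"] xk cpt[OF R] by simp
      also have "\<dots> = amp (compose (carrier X) T (rank_one X x x)) (m x k)" using cpt[OF TR] by simp
      also have "\<dots> = amp T (amp (rank_one X x x) (m x k))"
        using xk T R amp_compose[of T "rank_one X x x"] by (simp add: compose_eq)
      also have "\<dots> = c \<odot>\<^bsub>H\<^esub> amp T (m x k)"
        unfolding cm using T xk H.bounded_ops_smult[OF amp_closed[OF T], of "m x k" c] by simp
      finally have e: "c \<odot>\<^bsub>H\<^esub> f T (m x k) = c \<odot>\<^bsub>H\<^esub> amp T (m x k)" .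
      have cl: "f T (m x k) \<in> carrier H" "amp T (m x k) \<in> carrier H"
        using H.bounded_ops_closed[OF fT] H.bounded_ops_closed[OF amp_closed[OF T]] xk by blast+
      show ?thesis
      proof (rule H.cinner_ext[OF cl])
        fix z assume z: "z \<in> carrier H"
        have "c * cinner H (f T (m x k)) z = c * cinner H (amp T (m x k)) z"
          using arg_cong[OF e, of "\<lambda>v. cinner H v z"]
          by (simp only: H.cinner_smult[OF cl(1) z] H.cinner_smult[OF cl(2) z])
        then show "cinner H (f T (m x k)) z = cinner H (amp T (m x k)) z" using c by simp
      qed
    qed
  qed
qed

end


section \<open>Representations of product systems on Hilbert spaces\<close>

text \<open>A Hilbert space tensor product is an isometric tensor map with dense span, so that no nonzero vector
  is orthogonal to the elementary tensors.\<close>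

lemma hilbert_tensor_map:
  assumes H: "hilbert_space H" and K: "hilbert_space K" and L: "hilbert_space L"
    and t: "hilbert_tensor H K L m"
  shows "tensor_map H K L m" and "tensor_map.perp H K L m = {\<zero>\<^bsub>L\<^esub>}"
proof -
  interpret H: hilbert_space H by (rule H)
  interpret K: hilbert_space K by (rule K)
  interpret L: hilbert_space L by (rule L)
  have mc: "m x y \<in> carrier L" if "x \<in> carrier H" "y \<in> carrier K" for x y
    using t that by (simp add: hilbert_tensor_def)
  show tm: "tensor_map H K L m"
    by unfold_locales (use t in \<open>auto simp: hilbert_tensor_def\<close>)
  interpret tensor_map H K L m by (rule tm)
  let ?G = "{m x y | x y. x \<in> carrier H \<and> y \<in> carrier K}"
  let ?W = "(\<lambda>W. submodule W complex_ring L) hull ?G"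
  have cl: "htop L closure_of ?W = carrier L" using t by (simp add: hilbert_tensor_def)
  interpret M: Metric_space "carrier L" "norm_dist L (hnorm L)" by (rule L.metric)
  have "h = \<zero>\<^bsub>L\<^esub>" if h: "h \<in> perp" for h
  proof -
    have hc: "h \<in> carrier L" using h by (rule perp_closed)
    have "submodule {w \<in> carrier L. cinner L w h = 0} complex_ring L"
      by (rule L.submoduleI) (use hc in \<open>auto simp: L.cinner_simps\<close>)
    moreover have "?G \<subseteq> {w \<in> carrier L. cinner L w h = 0}" using h mc by (auto simp: perp_def)
    ultimately have W: "?W \<subseteq> {w \<in> carrier L. cinner L w h = 0}" by (intro hull_minimal)
    have "(hnorm L h)\<^sup>2 \<le> 0 + e" if e: "e > 0" for e
    proof -
      define \<delta> where "\<delta> = e / (hnorm L h + 1)"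
      have n: "hnorm L h + 1 > 0" using hc by (simp add: add_nonneg_pos)
      have d: "\<delta> > 0" using e n by (simp add: \<delta>_def)
      have "h \<in> M.mtopology closure_of ?W" using cl hc by (simp add: htop_def)
      then obtain w where w: "w \<in> ?W" "w \<in> M.mball h \<delta>" using d by (auto simp: M.metric_closure_of)
      have wc: "w \<in> carrier L" "cinner L w h = 0" using W w by auto
      have wd: "hnorm L (h \<ominus>\<^bsub>L\<^esub> w) < \<delta>" using w(2) by (auto simp: M.in_mball norm_dist_def split: if_splits)
      have "of_real ((hnorm L h)\<^sup>2) = cinner L (h \<ominus>\<^bsub>L\<^esub> w) h" using wc hc L.cinner_self[OF hc] by (simp add: L.cinner_simps)
      then have "(hnorm L h)\<^sup>2 = cmod (cinner L (h \<ominus>\<^bsub>L\<^esub> w) h)" by (metis norm_of_real abs_power2)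
      also have "\<dots> \<le> hnorm L (h \<ominus>\<^bsub>L\<^esub> w) * hnorm L h" using wc hc by (intro L.cauchy_schwarz) auto
      also have "\<dots> \<le> \<delta> * (hnorm L h + 1)" using wd hc d by (intro mult_mono) auto
      also have "\<dots> = e" using n by (simp add: \<delta>_def)
      finally show ?thesis by simp
    qed
    then have "(hnorm L h)\<^sup>2 \<le> 0" by (rule field_le_epsilon)
    then show ?thesis using hc by (simp add: L.hnorm_eq_0)
  qed
  then show "perp = {\<zero>\<^bsub>L\<^esub>}" by (auto simp: perp_def)
qed

text \<open>A product system over the positive cone of a quasi-lattice ordered group.\<close>

locale qlo_product_system = quasi_lattice_ordered G P + PS: product_system "G\<lparr>carrier := P\<rparr>" E
  for G :: "('g, 'm) monoid_scheme" (structure) and P and E :: "('g, 'e) prod_system"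
begin

lemma fiber_hs: "s \<in> P \<Longrightarrow> hilbert_space (fiber E s)"
  using PS.fiber_hilbert by simp

lemma fiber_iff: "s \<in> P \<Longrightarrow> x \<in> carrier (fiber E s) \<longleftrightarrow> x \<in> total E \<and> proj E x = s"
  using PS.fiber_carrier[of s] by simp

lemma P_carrier: "s \<in> P \<Longrightarrow> s \<in> carrier G"
  using P_subset by blast

lemma vee_bounds:
  assumes s: "s \<in> P" and t: "t \<in> P" and b: "bounded_pair G P s t"
  shows "vee G P s t \<in> P" "inv s \<otimes> vee G P s t \<in> P" "inv t \<otimes> vee G P s t \<in> P"
proof -
  let ?L = "left_order G P"
  have Lc: "carrier ?L = carrier G" by (simp add: left_order_def)
  have Lle: "(x \<sqsubseteq>\<^bsub>?L\<^esub> y) = (inv x \<otimes> y \<in> P)" for x y by (simp add: left_order_def)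
  have UP: "Upper ?L {s, t} \<subseteq> P"
  proof
    fix u assume "u \<in> Upper ?L {s, t}"
    then have u: "u \<in> carrier G" "inv s \<otimes> u \<in> P" using s P_carrier[OF s] by (auto simp: Upper_def Lc Lle)
    have "s \<otimes> (inv s \<otimes> u) = u" using u(1) P_carrier[OF s] by (simp add: inv_solve_left m_assoc[symmetric])
    then show "u \<in> P" using P_closed[OF s u(2)] by simp
  qed
  then have eq: "Upper ?L {s, t} \<inter> P = Upper ?L {s, t}" by blast
  have "\<exists>r. least ?L r (Upper ?L {s, t})"
    using lub_exists[of "{s, t}"] b P_carrier[OF s] P_carrier[OF t] unfolding eq bounded_pair_def by simp
  then have "least ?L (vee G P s t) (Upper ?L {s, t})"
    unfolding vee_def join_def sup_def by (rule someI_ex)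
  then have v: "vee G P s t \<in> Upper ?L {s, t}" by (rule least_mem)
  then show "vee G P s t \<in> P" using UP by blast
  show "inv s \<otimes> vee G P s t \<in> P" "inv t \<otimes> vee G P s t \<in> P"
    using v P_carrier[OF s] P_carrier[OF t] by (auto simp: Upper_def Lc Lle)
qed

lemma quotient_mult: "s \<in> P \<Longrightarrow> r \<in> P \<Longrightarrow> s \<otimes> (inv s \<otimes> r) = r"
  using P_carrier[of s] P_carrier[of r] by (simp add: m_assoc[symmetric])

text \<open>The fiber over \<open>r \<ge> s\<close> is the tensor product of the fibers over \<open>s\<close> and over \<open>s\<inverse> r\<close>.\<close>

lemma pmult_tensor_map:
  assumes "s \<in> P" "r \<in> P" "inv s \<otimes> r \<in> P"
  shows "tensor_map (fiber E s) (fiber E (inv s \<otimes> r)) (fiber E r) (pmult E)"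
    and "tensor_map.perp (fiber E s) (fiber E (inv s \<otimes> r)) (fiber E r) (pmult E) = {\<zero>\<^bsub>fiber E r\<^esub>}"
proof -
  have t: "hilbert_tensor (fiber E s) (fiber E (inv s \<otimes> r)) (fiber E r) (pmult E)"
    using PS.pmult_tensor[of s "inv s \<otimes> r"] assms quotient_mult[OF assms(1,2)] by simp
  show "tensor_map (fiber E s) (fiber E (inv s \<otimes> r)) (fiber E r) (pmult E)"
    "tensor_map.perp (fiber E s) (fiber E (inv s \<otimes> r)) (fiber E r) (pmult E) = {\<zero>\<^bsub>fiber E r\<^esub>}"
    by (rule hilbert_tensor_map[OF fiber_hs fiber_hs fiber_hs t]; use assms in simp)+
qed

lemma amplify_eq:
  assumes "s \<in> P" "r \<in> P" "inv s \<otimes> r \<in> P" and S: "S \<in> bounded_ops (fiber E s)"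
  shows "amplify G E s r S = tensor_map.amp (fiber E s) (fiber E (inv s \<otimes> r)) (fiber E r) (pmult E) S"
proof -
  interpret tensor_map "fiber E s" "fiber E (inv s \<otimes> r)" "fiber E r" "pmult E"
    by (rule pmult_tensor_map(1)[OF assms(1-3)])
  note perp = pmult_tensor_map(2)[OF assms(1-3)]
  show ?thesis
    unfolding amplify_def
  proof (rule the_equality)
    show "amp S \<in> bounded_ops (fiber E r) \<and>
      (\<forall>x\<in>carrier (fiber E s). \<forall>y\<in>carrier (fiber E (inv s \<otimes> r)). amp S (pmult E x y) = pmult E (S x) y)"
      using S by simp
    fix T assume T: "T \<in> bounded_ops (fiber E r) \<and>
      (\<forall>x\<in>carrier (fiber E s). \<forall>y\<in>carrier (fiber E (inv s \<otimes> r)). T (pmult E x y) = pmult E (S x) y)"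
    show "T = amp S"
      by (rule ops_eqI) (use T S in \<open>auto simp: perp H.bounded_ops_zero\<close>)
  qed
qed

end

text \<open>For a representation \<open>\<phi>\<close> on \<open>H\<close> the maps \<open>(x, h) \<mapsto> \<phi>(x) h\<close> are isometric tensor maps.\<close>

locale hilbert_rep = qlo_product_system G P E + H: hilbert_space H
  for G :: "('g, 'm) monoid_scheme" (structure) and P and E :: "('g, 'e) prod_system"
    and H :: "('h, 'n) hilbert_scheme" +
  fixes \<phi> :: "'e \<Rightarrow> 'h \<Rightarrow> 'h"
  assumes rep: "representation E (Bop H) \<phi>"
begin

lemma rep_closed: "x \<in> total E \<Longrightarrow> \<phi> x \<in> bounded_ops H"
  using rep by (auto simp: representation_def)

lemma rep_mult: "x \<in> total E \<Longrightarrow> y \<in> total E \<Longrightarrow> h \<in> carrier H \<Longrightarrow> \<phi> (pmult E x y) h = \<phi> x (\<phi> y h)"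
  using rep by (simp add: representation_def compose_eq)

lemma rep_inner:
  assumes "s \<in> P" "x \<in> carrier (fiber E s)" "y \<in> carrier (fiber E s)" "h \<in> carrier H"
  shows "adjoint_op H (\<phi> y) (\<phi> x h) = cinner (fiber E s) x y \<odot>\<^bsub>H\<^esub> h"
proof -
  have xy: "x \<in> total E" "y \<in> total E" "proj E x = s" "proj E y = s"
    using assms fiber_iff by auto
  then have "compose (carrier H) (adjoint_op H (\<phi> y)) (\<phi> x) =
      (\<lambda>h\<in>carrier H. cinner (fiber E s) x y \<odot>\<^bsub>H\<^esub> (\<lambda>h\<in>carrier H. h) h)"
    using rep by (simp add: representation_def)
  from fun_cong[OF this, of h] show ?thesis using assms by (simp add: compose_eq)
qed

lemma rep_tensor_map:
  assumes s: "s \<in> P"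
  shows "tensor_map (fiber E s) H H \<phi>"
proof -
  interpret F: hilbert_space "fiber E s" by (rule fiber_hs[OF s])
  show ?thesis
  proof (unfold_locales)
    fix x k assume "x \<in> carrier (fiber E s)" "k \<in> carrier H"
    then show "\<phi> x k \<in> carrier H" using rep_closed fiber_iff[OF s] by (simp add: H.bounded_ops_closed)
  next
    fix x x' k k' assume a: "x \<in> carrier (fiber E s)" "x' \<in> carrier (fiber E s)" "k \<in> carrier H" "k' \<in> carrier H"
    have b: "\<phi> x \<in> bounded_ops H" "\<phi> x' \<in> bounded_ops H" using a rep_closed fiber_iff[OF s] by auto
    have "cinner H (\<phi> x k) (\<phi> x' k') = cinner H (adjoint_op H (\<phi> x') (\<phi> x k)) k'"
      using H.adjoint'[OF b(2), of "\<phi> x k" k'] a b by (simp add: H.bounded_ops_closed)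
    then show "cinner H (\<phi> x k) (\<phi> x' k') = cinner (fiber E s) x x' * cinner H k k'"
      using a rep_inner[OF s a(1,2,3)] by (simp add: H.cinner_simps)
  qed
qed

text \<open>The operator \<open>\<rho>\<^sub>s(T)\<close>, for an arbitrary bounded operator \<open>T\<close> on the fiber over \<open>s\<close>.\<close>

definition rep_op :: "'g \<Rightarrow> ('e \<Rightarrow> 'e) \<Rightarrow> 'h \<Rightarrow> 'h" where
  "rep_op s = tensor_map.amp (fiber E s) H H \<phi>"

lemma rep_op_rank_one:
  assumes s: "s \<in> P" and x: "x \<in> carrier (fiber E s)" and y: "y \<in> carrier (fiber E s)"
  shows "rep_op s (rank_one (fiber E s) x y) = compose (carrier H) (\<phi> x) (adjoint_op H (\<phi> y))"
proof -
  interpret T: tensor_map "fiber E s" H H \<phi> by (rule rep_tensor_map[OF s])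
  have b: "\<phi> x \<in> bounded_ops H" "\<phi> y \<in> bounded_ops H" using x y rep_closed fiber_iff[OF s] by auto
  show ?thesis
    unfolding rep_op_def
  proof (rule T.amp_eqI)
    show "rank_one (fiber E s) x y \<in> bounded_ops (fiber E s)" using x y by simp
    show "compose (carrier H) (\<phi> x) (adjoint_op H (\<phi> y)) \<in> bounded_ops H" using b by simp
    fix z h assume zh: "z \<in> carrier (fiber E s)" "h \<in> carrier H"
    then show "compose (carrier H) (\<phi> x) (adjoint_op H (\<phi> y)) (\<phi> z h) = \<phi> (rank_one (fiber E s) x y z) h"
      using x y b rep_inner[OF s zh(1) y zh(2)]
      by (simp add: compose_eq rank_one_def T.m_smult H.bounded_ops_smult)
  next
    fix h assume h: "h \<in> T.perp"
    then have hc: "h \<in> carrier H" by (rule T.perp_closed)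
    have "adjoint_op H (\<phi> y) h = \<zero>\<^bsub>H\<^esub>"
    proof (rule H.cinner_ext_right)
      fix k assume k: "k \<in> carrier H"
      then show "cinner H k (adjoint_op H (\<phi> y) h) = cinner H k \<zero>\<^bsub>H\<^esub>"
        using H.adjoint[OF b(2) k hc] h y by (simp add: T.perp_def)
    qed (use b hc in \<open>auto simp: H.bounded_ops_closed\<close>)
    then show "compose (carrier H) (\<phi> x) (adjoint_op H (\<phi> y)) h = \<zero>\<^bsub>H\<^esub>"
      using hc b by (simp add: compose_eq H.bounded_ops_zero)
  qed
qed

lemma rho_hom_unique:
  assumes s: "s \<in> P" and f: "star_hom (Kop (fiber E s)) (Bop H) f"
    and rank: "\<And>x y. x \<in> carrier (fiber E s) \<Longrightarrow> y \<in> carrier (fiber E s) \<Longrightarrow>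
        f (rank_one (fiber E s) x y) = \<phi> x \<otimes>\<^bsub>Bop H\<^esub> star (Bop H) (\<phi> y)"
    and T: "T \<in> compact_ops (fiber E s)"
  shows "f T = rep_op s T"
proof -
  interpret T: tensor_map "fiber E s" H H \<phi> by (rule rep_tensor_map[OF s])
  show ?thesis unfolding rep_op_def
    using rank rep_op_rank_one[OF s] by (intro T.compact_hom_unique[OF f _ T]) (simp add: rep_op_def)
qed

lemma rho_eq:
  assumes s: "s \<in> P" and T: "T \<in> compact_ops (fiber E s)"
  shows "rho E (Bop H) \<phi> s T = rep_op s T"
proof -
  interpret T: tensor_map "fiber E s" H H \<phi> by (rule rep_tensor_map[OF s])
  let ?f = "\<lambda>T\<in>compact_ops (fiber E s). T.amp T"
  have "rho E (Bop H) \<phi> s = ?f"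
    unfolding rho_def
  proof (rule the_equality)
    show "?f \<in> extensional (carrier (Kop (fiber E s))) \<and> star_hom (Kop (fiber E s)) (Bop H) ?f \<and>
      (\<forall>x\<in>carrier (fiber E s). \<forall>y\<in>carrier (fiber E s).
        ?f (rank_one (fiber E s) x y) = \<phi> x \<otimes>\<^bsub>Bop H\<^esub> star (Bop H) (\<phi> y))"
      using T.compact_star_hom_amp rep_op_rank_one[OF s] T.X.compact_rank_one by (simp add: rep_op_def)
    fix f assume f: "f \<in> extensional (carrier (Kop (fiber E s))) \<and> star_hom (Kop (fiber E s)) (Bop H) f \<and>
      (\<forall>x\<in>carrier (fiber E s). \<forall>y\<in>carrier (fiber E s).
        f (rank_one (fiber E s) x y) = \<phi> x \<otimes>\<^bsub>Bop H\<^esub> star (Bop H) (\<phi> y))"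
    show "f = ?f"
    proof (rule extensionalityI[where A = "compact_ops (fiber E s)"])
      fix S assume S: "S \<in> compact_ops (fiber E s)"
      then show "f S = ?f S" using rho_hom_unique[OF s _ _ S, of f] f by (simp add: rep_op_def)
    qed (use f in auto)
  qed
  then show ?thesis using T by (simp add: rep_op_def)
qed

lemma rho_normal_eq:
  assumes s: "s \<in> P" and T: "T \<in> bounded_ops (fiber E s)"
  shows "rho_normal E H \<phi> s T = rep_op s T"
proof -
  interpret T: tensor_map "fiber E s" H H \<phi> by (rule rep_tensor_map[OF s])
  have "rho_normal E H \<phi> s = T.rho_amp"
    unfolding rho_normal_def
  proof (rule the_equality)
    show "T.rho_amp \<in> extensional (carrier (Bop (fiber E s))) \<and> star_hom (Bop (fiber E s)) (Bop H) T.rho_amp \<and>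
      normal_map (fiber E s) H T.rho_amp \<and> (\<forall>T\<in>carrier (Kop (fiber E s)). T.rho_amp T = rho E (Bop H) \<phi> s T)"
      using T.star_hom_amp T.normal_amp rho_eq[OF s] by (simp add: T.rho_amp_def rep_op_def)
    fix f assume f: "f \<in> extensional (carrier (Bop (fiber E s))) \<and> star_hom (Bop (fiber E s)) (Bop H) f \<and>
      normal_map (fiber E s) H f \<and> (\<forall>T\<in>carrier (Kop (fiber E s)). f T = rho E (Bop H) \<phi> s T)"
    show "f = T.rho_amp"
    proof (rule extensionalityI[where A = "bounded_ops (fiber E s)"])
      fix S assume S: "S \<in> bounded_ops (fiber E s)"
      then show "f S = T.rho_amp S"
        using T.normal_hom_unique[of f S] f rho_eq[OF s] by (simp add: T.rho_amp_def rep_op_def)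
    qed (use f in \<open>auto simp: T.rho_amp_def\<close>)
  qed
  then show ?thesis using T by (simp add: T.rho_amp_def rep_op_def)
qed

text \<open>The projection \<open>\<rho>\<^sub>s(1)\<close>.\<close>

abbreviation proj_op :: "'g \<Rightarrow> 'h \<Rightarrow> 'h" where
  "proj_op s \<equiv> rep_op s (\<lambda>x\<in>carrier (fiber E s). x)"

lemma rep_op_closed: "s \<in> P \<Longrightarrow> T \<in> bounded_ops (fiber E s) \<Longrightarrow> rep_op s T \<in> bounded_ops H"
  unfolding rep_op_def using tensor_map.amp_closed[OF rep_tensor_map] .

text \<open>On the range of the projection of \<open>r = s q\<close>, the operators \<open>S\<close> and \<open>S \<otimes> 1\<close> act in the same way:
  both send \<open>\<phi>(x y) h\<close> to \<open>\<phi>((S x) y) h\<close>.\<close>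

lemma rep_op_amplify:
  assumes s: "s \<in> P" and r: "r \<in> P" and q: "inv s \<otimes> r \<in> P" and S: "S \<in> bounded_ops (fiber E s)"
  shows "amplify G E s r S \<in> bounded_ops (fiber E r)"
    and "rep_op r (amplify G E s r S) = compose (carrier H) (rep_op s S) (proj_op r)"
    and "rep_op r (amplify G E s r S) = compose (carrier H) (proj_op r) (rep_op s S)"
proof -
  interpret a: tensor_map "fiber E s" H H \<phi> by (rule rep_tensor_map[OF s])
  interpret b: tensor_map "fiber E r" H H \<phi> by (rule rep_tensor_map[OF r])
  interpret p: tensor_map "fiber E s" "fiber E (inv s \<otimes> r)" "fiber E r" "pmult E"
    by (rule pmult_tensor_map(1)[OF s r q])
  note perp = pmult_tensor_map(2)[OF s r q]
  have amp: "amplify G E s r S = p.amp S" if "S \<in> bounded_ops (fiber E s)" for S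
    by (rule amplify_eq[OF s r q that])
  show "amplify G E s r S \<in> bounded_ops (fiber E r)" using amp S by simp
  have main: "b.amp (p.amp S) = compose (carrier H) (a.amp S) (b.amp b.idX)"
    if S: "S \<in> bounded_ops (fiber E s)" for S
  proof (rule b.amp_eqI)
    show "p.amp S \<in> bounded_ops (fiber E r)" using S by simp
    show "compose (carrier H) (a.amp S) (b.amp b.idX) \<in> bounded_ops H" using S by simp
    have aS: "a.amp S \<in> bounded_ops H" using S by simp
    have pS: "p.amp S \<in> bounded_ops (fiber E r)" using S by simp
    fix z h assume zh: "z \<in> carrier (fiber E r)" "h \<in> carrier H"
    have "a.amp S (\<phi> z h) = \<phi> (p.amp S z) h"
    proof (rule H.cinner_ext)
      fix g assume g: "g \<in> carrier H"
      have g': "adjoint_op H (a.amp S) g \<in> carrier H" using aS g by (simp add: H.bounded_ops_closed)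
      obtain u where u: "u \<in> carrier (fiber E r)"
        "\<And>z. z \<in> carrier (fiber E r) \<Longrightarrow> cinner H (\<phi> z h) (adjoint_op H (a.amp S) g) = cinner (fiber E r) z u"
        using b.slice_adjoint[OF zh(2) g'] by blast
      obtain v where v: "v \<in> carrier (fiber E r)"
        "\<And>z. z \<in> carrier (fiber E r) \<Longrightarrow> cinner H (\<phi> z h) g = cinner (fiber E r) z v"
        using b.slice_adjoint[OF zh(2) g] by blast
      let ?v = "adjoint_op (fiber E r) (p.amp S) v"
      have vc: "?v \<in> carrier (fiber E r)" using v pS by (simp add: b.X.bounded_ops_closed)
      \<comment> \<open>The two sides are linear functionals of \<open>z\<close>, so that it suffices to compare them at \<open>z = x y\<close>.\<close>
      have "cinner (fiber E r) (pmult E x y) u = cinner (fiber E r) (pmult E x y) ?v"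
        if xy: "x \<in> carrier (fiber E s)" "y \<in> carrier (fiber E (inv s \<otimes> r))" for x y
      proof -
        have tot: "x \<in> total E" "y \<in> total E" "S x \<in> total E" "S x \<in> carrier (fiber E s)"
          using xy fiber_iff[OF s] fiber_iff[OF q] a.X.bounded_ops_closed[OF S xy(1)] by auto
        have yh: "\<phi> y h \<in> carrier H" using rep_closed[OF tot(2)] zh by (simp add: H.bounded_ops_closed)
        have c: "pmult E x y \<in> carrier (fiber E r)" "pmult E (S x) y \<in> carrier (fiber E r)" using xy tot by auto
        have ch: "\<phi> (pmult E x y) h \<in> carrier H" using c zh by (intro b.m_closed)
        have "cinner (fiber E r) (pmult E x y) u = cinner H (a.amp S (\<phi> (pmult E x y) h)) g"
          using u(2)[OF c(1)] H.adjoint[OF aS ch g] by simp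
        also have "a.amp S (\<phi> (pmult E x y) h) = \<phi> (pmult E (S x) y) h"
          using rep_mult[OF tot(1,2) zh(2)] rep_mult[OF tot(3,2) zh(2)] a.amp_m[OF S xy(1) yh] by simp
        also have "cinner H (\<phi> (pmult E (S x) y) h) g = cinner (fiber E r) (p.amp S (pmult E x y)) v"
          using v(2)[OF c(2)] xy S by simp
        also have "\<dots> = cinner (fiber E r) (pmult E x y) ?v" by (rule b.X.adjoint[OF pS c(1) v(1)])
        finally show ?thesis .
      qed
      then have "u \<ominus>\<^bsub>fiber E r\<^esub> ?v \<in> p.perp"
        using u(1) vc by (auto simp: p.perp_def b.X.cinner_simps)
      then have "u = ?v" using perp u(1) vc by (simp add: b.X.minus_eq_zero_iff)
      then have "cinner H (\<phi> z h) (adjoint_op H (a.amp S) g) = cinner (fiber E r) z ?v" using u(2)[OF zh(1)] by simp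
      also have "\<dots> = cinner (fiber E r) (p.amp S z) v" using b.X.adjoint[OF pS zh(1) v(1)] by simp
      also have "\<dots> = cinner H (\<phi> (p.amp S z) h) g"
        using v(2)[OF b.X.bounded_ops_closed[OF pS zh(1)]] by simp
      finally show "cinner H (a.amp S (\<phi> z h)) g = cinner H (\<phi> (p.amp S z) h) g"
        using H.adjoint[OF aS b.m_closed[OF zh] g] by simp
    qed (use zh aS pS in \<open>auto intro!: H.bounded_ops_closed[OF aS] b.m_closed b.X.bounded_ops_closed[OF pS]\<close>)
    then show "compose (carrier H) (a.amp S) (b.amp b.idX) (\<phi> z h) = \<phi> (p.amp S z) h"
      using zh by (simp add: compose_eq)
  next
    fix h assume h: "h \<in> b.perp"
    then show "compose (carrier H) (a.amp S) (b.amp b.idX) h = \<zero>\<^bsub>H\<^esub>"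
      using b.perp_closed[OF h] S by (simp add: compose_eq H.bounded_ops_zero)
  qed
  show left: "rep_op r (amplify G E s r S) = compose (carrier H) (rep_op s S) (proj_op r)"
    using main[OF S] amp[OF S] by (simp add: rep_op_def b.idX_def)
  have S': "adjoint_op (fiber E s) S \<in> bounded_ops (fiber E s)" using S by simp
  have "adjoint_op H (b.amp (p.amp (adjoint_op (fiber E s) S)))
      = adjoint_op H (compose (carrier H) (a.amp (adjoint_op (fiber E s) S)) (b.amp b.idX))"
    using main[OF S'] by simp
  then have "b.amp (p.amp S) = compose (carrier H) (b.amp b.idX) (a.amp S)"
    using S by (simp add: p.amp_adjoint b.amp_adjoint a.amp_adjoint H.adjoint_compose b.amp_sa)
  then show "rep_op r (amplify G E s r S) = compose (carrier H) (proj_op r) (rep_op s S)"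
    using amp[OF S] by (simp add: rep_op_def b.idX_def)
qed

lemma rep_op_unit_left: "s \<in> P \<Longrightarrow> T \<in> bounded_ops (fiber E s) \<Longrightarrow> h \<in> carrier H \<Longrightarrow> proj_op s (rep_op s T h) = rep_op s T h"
  using tensor_map.amp_idX_left[OF rep_tensor_map] tensor_map.idX_def[OF rep_tensor_map] by (simp add: rep_op_def)

lemma rep_op_unit_right: "s \<in> P \<Longrightarrow> T \<in> bounded_ops (fiber E s) \<Longrightarrow> h \<in> carrier H \<Longrightarrow> rep_op s T (proj_op s h) = rep_op s T h"
  using tensor_map.amp_idX_right[OF rep_tensor_map] tensor_map.idX_def[OF rep_tensor_map] by (simp add: rep_op_def)

lemma rep_op_compose: "s \<in> P \<Longrightarrow> S \<in> bounded_ops (fiber E s) \<Longrightarrow> T \<in> bounded_ops (fiber E s) \<Longrightarrow>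
    rep_op s (compose (carrier (fiber E s)) S T) = compose (carrier H) (rep_op s S) (rep_op s T)"
  unfolding rep_op_def using tensor_map.amp_compose[OF rep_tensor_map] .

lemma unit_op: "s \<in> P \<Longrightarrow> (\<lambda>x\<in>carrier (fiber E s). x) \<in> bounded_ops (fiber E s)"
  using hilbert_space.op_id[OF fiber_hs] .

lemma amplify_unit:
  assumes s: "s \<in> P" and r: "r \<in> P" and q: "inv s \<otimes> r \<in> P"
  shows "amplify G E s r (\<lambda>x\<in>carrier (fiber E s). x) = (\<lambda>x\<in>carrier (fiber E r). x)"
proof -
  interpret p: tensor_map "fiber E s" "fiber E (inv s \<otimes> r)" "fiber E r" "pmult E"
    by (rule pmult_tensor_map(1)[OF s r q])
  note perp = pmult_tensor_map(2)[OF s r q]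
  show ?thesis
    unfolding amplify_eq[OF s r q unit_op[OF s]]
    by (rule p.amp_eqI) (use perp p.H.op_id in \<open>auto\<close>)
qed

lemma proj_op_absorb:
  assumes s: "s \<in> P" and r: "r \<in> P" and q: "inv s \<otimes> r \<in> P" and h: "h \<in> carrier H"
  shows "proj_op s (proj_op r h) = proj_op r h" "proj_op r (proj_op s h) = proj_op r h"
proof -
  note eqs = rep_op_amplify(2,3)[OF s r q unit_op[OF s], unfolded amplify_unit[OF s r q]]
  show "proj_op s (proj_op r h) = proj_op r h"
    using fun_cong[OF eqs(1), of h] unfolding compose_eq[OF h] by (rule sym)
  show "proj_op r (proj_op s h) = proj_op r h"
    using fun_cong[OF eqs(2), of h] unfolding compose_eq[OF h] by (rule sym)
qed

end

section \<open>The two notions of covariance\<close>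

text \<open>A representation on a Hilbert space of a compactly aligned product system.\<close>

locale aligned_hilbert_rep = hilbert_rep +
  assumes aligned: "compactly_aligned G P E"
begin

lemma product_eq:
  assumes s: "s \<in> P" and t: "t \<in> P" and b: "bounded_pair G P s t"
    and S: "S \<in> compact_ops (fiber E s)" and T: "T \<in> compact_ops (fiber E t)"
    and h: "h \<in> carrier H"
  shows "amplified_product G P E s t S T \<in> compact_ops (fiber E (vee G P s t))"
    and "rep_op (vee G P s t) (amplified_product G P E s t S T) h = rep_op s S (proj_op (vee G P s t) (rep_op t T h))"
proof -
  let ?r = "vee G P s t"
  note v = vee_bounds[OF s t b]
  interpret F: hilbert_space "fiber E s" by (rule fiber_hs[OF s])
  interpret F': hilbert_space "fiber E t" by (rule fiber_hs[OF t])
  have Sb: "S \<in> bounded_ops (fiber E s)" and Tb: "T \<in> bounded_ops (fiber E t)" using S T by auto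
  note aS = rep_op_amplify[OF s v(1) v(2) Sb] and aT = rep_op_amplify[OF t v(1) v(3) Tb]
  show "amplified_product G P E s t S T \<in> compact_ops (fiber E ?r)"
    using aligned s t b S T by (auto simp: compactly_aligned_def)
  have Th: "rep_op t T h \<in> carrier H" using rep_op_closed[OF t Tb] h by (simp add: H.bounded_ops_closed)
  have "rep_op ?r (amplified_product G P E s t S T) =
      compose (carrier H) (rep_op ?r (amplify G E s ?r S)) (rep_op ?r (amplify G E t ?r T))"
    unfolding amplified_product_def using rep_op_compose[OF v(1) aS(1) aT(1)] by simp
  then have "rep_op ?r (amplified_product G P E s t S T) h = rep_op s S (proj_op ?r (proj_op ?r (rep_op t T h)))"
    unfolding aS(2) aT(3) using h Th rep_op_closed[OF v(1) unit_op[OF v(1)]]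
    by (simp add: compose_eq H.bounded_ops_closed)
  then show "rep_op ?r (amplified_product G P E s t S T) h = rep_op s S (proj_op ?r (rep_op t T h))"
    using rep_op_unit_left[OF v(1) unit_op[OF v(1)] Th] by simp
qed

text \<open>Both notions of covariance are evaluated at vectors; the product
  \<open>(S \<otimes> 1)(T \<otimes> 1)\<close> disappears by \<open>product_eq\<close>.\<close>

lemma covariant_on_iff:
  "covariant_on G P E H \<phi> \<longleftrightarrow> (\<forall>s\<in>P. \<forall>t\<in>P. \<forall>h\<in>carrier H.
     proj_op s (proj_op t h) = (if bounded_pair G P s t then proj_op (vee G P s t) h else \<zero>\<^bsub>H\<^esub>))"
proof -
  have "(compose (carrier H) (proj_op s) (proj_op t) = (if bounded_pair G P s t then proj_op (vee G P s t) else \<zero>\<^bsub>Bop H\<^esub>))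
      \<longleftrightarrow> (\<forall>h\<in>carrier H. proj_op s (proj_op t h) = (if bounded_pair G P s t then proj_op (vee G P s t) h else \<zero>\<^bsub>H\<^esub>))"
    if st: "s \<in> P" "t \<in> P" for s t
  proof
    assume e: "compose (carrier H) (proj_op s) (proj_op t) = (if bounded_pair G P s t then proj_op (vee G P s t) else \<zero>\<^bsub>Bop H\<^esub>)"
    show "\<forall>h\<in>carrier H. proj_op s (proj_op t h) = (if bounded_pair G P s t then proj_op (vee G P s t) h else \<zero>\<^bsub>H\<^esub>)"
    proof
      fix h assume "h \<in> carrier H"
      then show "proj_op s (proj_op t h) = (if bounded_pair G P s t then proj_op (vee G P s t) h else \<zero>\<^bsub>H\<^esub>)"
        using fun_cong[OF e, of h] by (simp add: compose_eq split: if_splits)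
    qed
  next
    assume e: "\<forall>h\<in>carrier H. proj_op s (proj_op t h) = (if bounded_pair G P s t then proj_op (vee G P s t) h else \<zero>\<^bsub>H\<^esub>)"
    show "compose (carrier H) (proj_op s) (proj_op t) = (if bounded_pair G P s t then proj_op (vee G P s t) else \<zero>\<^bsub>Bop H\<^esub>)"
    proof (rule H.bounded_ops_eqI)
      show "compose (carrier H) (proj_op s) (proj_op t) \<in> bounded_ops H"
        using st rep_op_closed unit_op by simp
      show "(if bounded_pair G P s t then proj_op (vee G P s t) else \<zero>\<^bsub>Bop H\<^esub>) \<in> bounded_ops H"
        using rep_op_closed[OF vee_bounds(1) unit_op[OF vee_bounds(1)]] st by simp
    qed (use e in \<open>auto simp: compose_eq\<close>)
  qed
  moreover have "rho_normal E H \<phi> s (\<lambda>x\<in>carrier (fiber E s). x) = proj_op s" if "s \<in> P" for s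
    using rho_normal_eq[OF that unit_op[OF that]] .
  ultimately show ?thesis
    unfolding covariant_on_def using rep vee_bounds(1) by (auto cong: if_cong)
qed

lemma covariant_in_iff:
  "covariant_in G P E (Bop H) \<phi> \<longleftrightarrow> (\<forall>s\<in>P. \<forall>t\<in>P. \<forall>S\<in>compact_ops (fiber E s). \<forall>T\<in>compact_ops (fiber E t). \<forall>h\<in>carrier H.
     rep_op s S (rep_op t T h) = (if bounded_pair G P s t then rep_op s S (proj_op (vee G P s t) (rep_op t T h)) else \<zero>\<^bsub>H\<^esub>))"
proof -
  have "(rho E (Bop H) \<phi> s S \<otimes>\<^bsub>Bop H\<^esub> rho E (Bop H) \<phi> t T =
        (if bounded_pair G P s t then rho E (Bop H) \<phi> (vee G P s t) (amplified_product G P E s t S T) else \<zero>\<^bsub>Bop H\<^esub>))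
     \<longleftrightarrow> (\<forall>h\<in>carrier H. rep_op s S (rep_op t T h) =
        (if bounded_pair G P s t then rep_op s S (proj_op (vee G P s t) (rep_op t T h)) else \<zero>\<^bsub>H\<^esub>))"
    if st: "s \<in> P" "t \<in> P" "S \<in> compact_ops (fiber E s)" "T \<in> compact_ops (fiber E t)" for s t S T
  proof -
    have Sb: "S \<in> bounded_ops (fiber E s)" and Tb: "T \<in> bounded_ops (fiber E t)"
      using st by (auto simp: compact_ops_def)
    have lhs: "rho E (Bop H) \<phi> s S \<otimes>\<^bsub>Bop H\<^esub> rho E (Bop H) \<phi> t T = compose (carrier H) (rep_op s S) (rep_op t T)"
      using rho_eq st by simp
    have lb: "compose (carrier H) (rep_op s S) (rep_op t T) \<in> bounded_ops H" using rep_op_closed st Sb Tb by simp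
    let ?R = "if bounded_pair G P s t then rho E (Bop H) \<phi> (vee G P s t) (amplified_product G P E s t S T) else \<zero>\<^bsub>Bop H\<^esub>"
    have rb: "?R \<in> bounded_ops H \<and> (\<forall>h\<in>carrier H. ?R h =
        (if bounded_pair G P s t then rep_op s S (proj_op (vee G P s t) (rep_op t T h)) else \<zero>\<^bsub>H\<^esub>))"
    proof (cases "bounded_pair G P s t")
      case True
      note v = vee_bounds[OF st(1,2) True]
      have c: "amplified_product G P E s t S T \<in> compact_ops (fiber E (vee G P s t))"
        using product_eq(1)[OF st(1,2) True st(3,4)] H.zero_closed by blast
      then have "amplified_product G P E s t S T \<in> bounded_ops (fiber E (vee G P s t))" by (simp add: compact_ops_def)
      then show ?thesis
        using True rho_eq[OF v(1) c] rep_op_closed[OF v(1)] product_eq(2)[OF st(1,2) True st(3,4)] by simp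
    qed simp
    show ?thesis unfolding lhs
    proof
      assume e: "compose (carrier H) (rep_op s S) (rep_op t T) = ?R"
      show "\<forall>h\<in>carrier H. rep_op s S (rep_op t T h) =
        (if bounded_pair G P s t then rep_op s S (proj_op (vee G P s t) (rep_op t T h)) else \<zero>\<^bsub>H\<^esub>)"
      proof
        fix h assume h: "h \<in> carrier H"
        have "rep_op s S (rep_op t T h) = ?R h" using fun_cong[OF e, of h] h by (simp only: compose_eq)
        then show "rep_op s S (rep_op t T h) =
          (if bounded_pair G P s t then rep_op s S (proj_op (vee G P s t) (rep_op t T h)) else \<zero>\<^bsub>H\<^esub>)"
          using rb h by metis
      qed
    next
      assume e: "\<forall>h\<in>carrier H. rep_op s S (rep_op t T h) =
        (if bounded_pair G P s t then rep_op s S (proj_op (vee G P s t) (rep_op t T h)) else \<zero>\<^bsub>H\<^esub>)"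
      show "compose (carrier H) (rep_op s S) (rep_op t T) = ?R"
      proof (rule H.bounded_ops_eqI[OF lb rb[THEN conjunct1]])
        fix x y assume x: "x \<in> carrier H"
        have "?R x = rep_op s S (rep_op t T x)" using rb e x by metis
        then show "cinner H (compose (carrier H) (rep_op s S) (rep_op t T) x) y = cinner H (?R x) y"
          using x by (simp only: compose_eq)
      qed
    qed
  qed
  then show ?thesis unfolding covariant_in_def using rep by blast
qed

text \<open>One direction inserts \<open>\<rho>\<^sub>s(1)\<close> and \<open>\<rho>\<^sub>t(1)\<close> between \<open>\<rho>\<^sub>s(S)\<close> and \<open>\<rho>\<^sub>t(T)\<close>. For the other one, with
  \<open>R = \<rho>\<^sub>r(1)\<close> or \<open>R = 0\<close>, the operators of rank one suffice to see that \<open>(1 - R) \<phi>(y) k\<close> is orthogonal to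
  all \<open>\<phi>(x) l\<close>, that is, \<open>\<rho>\<^sub>s(1) (1 - R) \<rho>\<^sub>t(1) = 0\<close>.\<close>

theorem covariant_on_iff_in: "covariant_on G P E H \<phi> \<longleftrightarrow> covariant_in G P E (Bop H) \<phi>"
proof
  assume "covariant_on G P E H \<phi>"
  then have on: "proj_op s (proj_op t h) = (if bounded_pair G P s t then proj_op (vee G P s t) h else \<zero>\<^bsub>H\<^esub>)"
    if "s \<in> P" "t \<in> P" "h \<in> carrier H" for s t h using that covariant_on_iff by blast
  show "covariant_in G P E (Bop H) \<phi>"
    unfolding covariant_in_iff
  proof (intro ballI)
    fix s t S T h assume st: "s \<in> P" "t \<in> P" and ST: "S \<in> compact_ops (fiber E s)" "T \<in> compact_ops (fiber E t)"
      and h: "h \<in> carrier H"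
    have b: "S \<in> bounded_ops (fiber E s)" "T \<in> bounded_ops (fiber E t)" using ST by (auto simp: compact_ops_def)
    have Th: "rep_op t T h \<in> carrier H" using rep_op_closed[OF st(2) b(2)] h by (simp add: H.bounded_ops_closed)
    have "rep_op s S (rep_op t T h) = rep_op s S (proj_op s (proj_op t (rep_op t T h)))"
      using rep_op_unit_right[OF st(1) b(1) Th] rep_op_unit_left[OF st(2) b(2) h] by simp
    also have "\<dots> = (if bounded_pair G P s t then rep_op s S (proj_op (vee G P s t) (rep_op t T h)) else \<zero>\<^bsub>H\<^esub>)"
      using on[OF st Th] H.bounded_ops_zero[OF rep_op_closed[OF st(1) b(1)]] by simp
    finally show "rep_op s S (rep_op t T h) = (if bounded_pair G P s t then rep_op s S (proj_op (vee G P s t) (rep_op t T h)) else \<zero>\<^bsub>H\<^esub>)" .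
  qed
next
  assume cin: "covariant_in G P E (Bop H) \<phi>"
  show "covariant_on G P E H \<phi>"
    unfolding covariant_on_iff
  proof (intro ballI)
    fix s t h assume s: "s \<in> P" and t: "t \<in> P" and h: "h \<in> carrier H"
    interpret a: tensor_map "fiber E s" H H \<phi> by (rule rep_tensor_map[OF s])
    interpret c: tensor_map "fiber E t" H H \<phi> by (rule rep_tensor_map[OF t])
    define R where "R = (if bounded_pair G P s t then proj_op (vee G P s t) else H.op_null)"
    have Rb: "R \<in> bounded_ops H"
    proof (cases "bounded_pair G P s t")
      case True
      note v = vee_bounds(1)[OF s t True]
      show ?thesis using rep_op_closed[OF v unit_op[OF v]] True by (simp add: R_def)
    qed (simp add: R_def)
    have eqR: "rep_op s S (rep_op t T h) = rep_op s S (R (rep_op t T h))"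
      if "S \<in> compact_ops (fiber E s)" "T \<in> compact_ops (fiber E t)" "h \<in> carrier H" for S T h
    proof -
      have "S \<in> bounded_ops (fiber E s)" "T \<in> bounded_ops (fiber E t)"
        using that(1,2) a.X.compact_bounded c.X.compact_bounded by blast+
      then have "rep_op t T h \<in> carrier H" "rep_op s S \<in> bounded_ops H"
        using rep_op_closed s t that(3) by (auto simp: H.bounded_ops_closed)
      then show ?thesis
        using cin s t that unfolding covariant_in_iff R_def by (auto simp: H.bounded_ops_zero)
    qed
    define D where "D = H.op_minus (\<lambda>h\<in>carrier H. h) R"
    have D: "D \<in> bounded_ops H" unfolding D_def using Rb by simp
    have Dk: "D k = k \<ominus>\<^bsub>H\<^esub> R k" if "k \<in> carrier H" for k
      using that Rb by (simp add: D_def H.op_minus_apply)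
    have scale: "rep_op r (rank_one (fiber E r) x x) (\<phi> x k) = cinner (fiber E r) x x \<odot>\<^bsub>H\<^esub> \<phi> x k"
      if "r \<in> P" "x \<in> carrier (fiber E r)" "k \<in> carrier H" for r x k
    proof -
      interpret d: tensor_map "fiber E r" H H \<phi> by (rule rep_tensor_map[OF that(1)])
      show ?thesis using that d.X.op_rank_one[of x x] by (simp add: rep_op_def rank_one_def[of "fiber E r" x x] d.m_smult)
    qed
    have kill: "cinner H (D (\<phi> y k)) (\<phi> x l) = 0"
      if y: "y \<in> carrier (fiber E t)" "k \<in> carrier H" and x: "x \<in> carrier (fiber E s)" "l \<in> carrier H" for x y k l
    proof (cases "x = \<zero>\<^bsub>fiber E s\<^esub> \<or> y = \<zero>\<^bsub>fiber E t\<^esub>")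
      case True
      have "\<phi> x l = \<zero>\<^bsub>H\<^esub>" if "x = \<zero>\<^bsub>fiber E s\<^esub>" using a.m_smult[of x l 0] x that by simp
      moreover have "\<phi> y k = \<zero>\<^bsub>H\<^esub>" if "y = \<zero>\<^bsub>fiber E t\<^esub>" using c.m_smult[of y k 0] y that by simp
      ultimately show ?thesis
        using True D x y a.m_closed[OF x] c.m_closed[OF y] by (auto simp: H.bounded_ops_zero H.bounded_ops_closed)
    next
      case False
      let ?X = "rank_one (fiber E s) x x" and ?Y = "rank_one (fiber E t) y y"
      have XY: "?X \<in> compact_ops (fiber E s)" "?Y \<in> compact_ops (fiber E t)"
        using x y a.X.compact_rank_one c.X.compact_rank_one by auto
      have Xb: "rep_op s ?X \<in> bounded_ops H" using rep_op_closed[OF s] XY by simp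
      define v where "v = \<phi> y k"
      have v: "v \<in> carrier H" using c.m_closed[OF y] by (simp add: v_def)
      define cy where "cy = cinner (fiber E t) y y"
      define cx where "cx = cinner (fiber E s) x x"
      have cyx: "cy \<noteq> 0" "cx \<noteq> 0" using False x y a.X.cinner_eq_0 c.X.cinner_eq_0 by (auto simp: cx_def cy_def)
      have Yv: "rep_op t ?Y v = cy \<odot>\<^bsub>H\<^esub> v" using scale[OF t y] by (simp add: v_def cy_def)
      have Xsa: "adjoint_op H (rep_op s ?X) = rep_op s ?X"
        using a.amp_sa[of ?X] x by (simp add: rep_op_def a.X.adjoint_rank_one)
      have e1: "rep_op s ?X (cy \<odot>\<^bsub>H\<^esub> v) = rep_op s ?X (R (cy \<odot>\<^bsub>H\<^esub> v))" using eqR[OF XY v] unfolding Yv .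
      have "rep_op s ?X (D (cy \<odot>\<^bsub>H\<^esub> v)) = \<zero>\<^bsub>H\<^esub>"
        using e1 v Rb Xb Dk[of "cy \<odot>\<^bsub>H\<^esub> v"]
        by (simp add: H.bounded_ops_minus H.minus_eq_zero_iff H.bounded_ops_closed)
      then have "0 = cinner H (rep_op s ?X (D (cy \<odot>\<^bsub>H\<^esub> v))) (\<phi> x l)" using a.m_closed[OF x] by simp
      also have "\<dots> = cinner H (D (cy \<odot>\<^bsub>H\<^esub> v)) (rep_op s ?X (\<phi> x l))"
        using H.adjoint[OF Xb, of "D (cy \<odot>\<^bsub>H\<^esub> v)" "\<phi> x l"] Xsa v D a.m_closed[OF x] by (simp add: H.bounded_ops_closed)
      also have "\<dots> = cy * cnj cx * cinner H (D v) (\<phi> x l)"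
        using scale[OF s x] v D a.m_closed[OF x] by (simp add: cx_def H.cinner_simps H.bounded_opsD)
      finally show ?thesis using cyx by (simp add: v_def)
    qed
    have "compose (carrier H) (proj_op s) (compose (carrier H) D (proj_op t)) = H.op_null"
    proof (rule c.ops_eqI)
      show "compose (carrier H) (proj_op s) (compose (carrier H) D (proj_op t)) \<in> bounded_ops H"
        using rep_op_closed unit_op s t D by simp
      fix y k assume y: "y \<in> carrier (fiber E t)" "k \<in> carrier H"
      have Dyk: "D (\<phi> y k) \<in> carrier H" using D c.m_closed[OF y] by (simp add: H.bounded_ops_closed)
      have "cinner H (\<phi> x l) (D (\<phi> y k)) = 0" if "x \<in> carrier (fiber E s)" "l \<in> carrier H" for x l
        using kill[OF y that] H.cinner_commute[OF Dyk a.m_closed[OF that]] by simp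
      then have "D (\<phi> y k) \<in> a.perp" using Dyk by (simp add: a.perp_def)
      then have "proj_op s (D (\<phi> y k)) = \<zero>\<^bsub>H\<^esub>" unfolding rep_op_def using a.X.op_id by simp
      moreover have "proj_op t (\<phi> y k) = \<phi> y k" unfolding rep_op_def using c.X.op_id y by simp
      ultimately show "compose (carrier H) (proj_op s) (compose (carrier H) D (proj_op t)) (\<phi> y k) = H.op_null (\<phi> y k)"
        using c.m_closed[OF y] by (simp add: compose_eq)
    next
      fix k assume k: "k \<in> c.perp"
      then have "proj_op t k = \<zero>\<^bsub>H\<^esub>" unfolding rep_op_def using c.X.op_id by simp
      then show "compose (carrier H) (proj_op s) (compose (carrier H) D (proj_op t)) k = H.op_null k"
        using c.perp_closed[OF k] D rep_op_closed[OF s unit_op[OF s]] by (simp add: compose_eq H.bounded_ops_zero)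
    qed simp
    from fun_cong[OF this, of h] have z: "proj_op s (D (proj_op t h)) = \<zero>\<^bsub>H\<^esub>" using h by (simp add: compose_eq)
    have Qs: "proj_op s \<in> bounded_ops H" and Qt: "proj_op t \<in> bounded_ops H" using rep_op_closed unit_op s t by auto
    have th: "proj_op t h \<in> carrier H" using Qt h by (simp add: H.bounded_ops_closed)
    have "proj_op s (proj_op t h) = proj_op s (R (proj_op t h))"
      using z th Dk[OF th] Qs Rb by (simp add: H.bounded_ops_minus H.minus_eq_zero_iff H.bounded_ops_closed)
    also have "\<dots> = (if bounded_pair G P s t then proj_op (vee G P s t) h else \<zero>\<^bsub>H\<^esub>)"
    proof (cases "bounded_pair G P s t")
      case True
      note v = vee_bounds[OF s t True]
      show ?thesis using True proj_op_absorb(1)[OF s v(1,2) th] proj_op_absorb(2)[OF t v(1,3) h] by (simp add: R_def)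
    next
      case False
      then show ?thesis using th Qs by (simp add: R_def H.bounded_ops_zero)
    qed
    finally show "proj_op s (proj_op t h) = (if bounded_pair G P s t then proj_op (vee G P s t) h else \<zero>\<^bsub>H\<^esub>)" .
  qed
qed

end


section \<open>C*-algebras and their representations\<close>

lemma geometric_telescope:
  fixes d :: "nat \<Rightarrow> nat \<Rightarrow> real"
  assumes c: "0 \<le> c" "c < 1" and step: "\<And>n k. d (Suc k) n \<le> d k n + M * c ^ k"
    and refl: "\<And>n. d n n = 0" and nk: "n \<le> k" and M: "0 \<le> M"
  shows "d k n \<le> M * c ^ n / (1 - c)"
proof -
  have "d k n \<le> M * (c ^ n - c ^ k) / (1 - c)"
    using nk
  proof (induction k rule: dec_induct)
    case (step k)
    have "d (Suc k) n \<le> M * (c ^ n - c ^ k) / (1 - c) + M * c ^ k" using assms(3)[of k n] step.IH by simp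
    also have "\<dots> = M * (c ^ n - c ^ Suc k) / (1 - c)" using c by (simp add: field_simps)
    finally show ?case .
  qed (simp add: refl)
  also have "\<dots> \<le> M * c ^ n / (1 - c)"
    using c M by (intro divide_right_mono mult_left_mono) auto
  finally show ?thesis .
qed

context unital_cstar_algebra begin

lemma smult_cl [simp, intro]: "x \<in> carrier A \<Longrightarrow> c \<odot> x \<in> carrier A"
  using smult_closed by simp

lemma smult_0 [simp]: "x \<in> carrier A \<Longrightarrow> 0 \<odot> x = \<zero>"
  using smult_l_null by simp

text \<open>The ring and the module structure both provide the group laws, and the scalars have laws of
  the same names; these are the laws of the algebra.\<close>

lemma ring_algebra: "ring A"
  by unfold_locales

lemmas algebra_laws = ring.ring_simprules[OF ring_algebra]

lemma uminus_smult: "x \<in> carrier A \<Longrightarrow> \<ominus> x = (-1) \<odot> x"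
proof -
  assume x: "x \<in> carrier A"
  have "(-1) \<odot> x \<oplus> 1 \<odot> x = ((-1) + 1) \<odot> x" using smult_l_distr[of "-1" 1 x] x by simp
  then have "(-1) \<odot> x \<oplus> x = \<zero>" using smult_one[of x] x by simp
  from abelian_group.minus_equality[OF ring.is_abelian_group[OF ring_algebra] this]
  show ?thesis using x by simp
qed

lemma anorm_uminus: "x \<in> carrier A \<Longrightarrow> anorm A (\<ominus> x) = anorm A x"
  by (simp add: uminus_smult anorm_smult)

lemma minus_cl [simp]: "x \<in> carrier A \<Longrightarrow> y \<in> carrier A \<Longrightarrow> x \<ominus> y \<in> carrier A"
  by (rule algebra_laws)

lemma anorm_minus_commute: "x \<in> carrier A \<Longrightarrow> y \<in> carrier A \<Longrightarrow> anorm A (x \<ominus> y) = anorm A (y \<ominus> x)"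
  using anorm_uminus[of "x \<ominus> y"] by (simp add: algebra_laws)

lemma minus_trans: "x \<in> carrier A \<Longrightarrow> y \<in> carrier A \<Longrightarrow> z \<in> carrier A \<Longrightarrow> (x \<ominus> y) \<oplus> (y \<ominus> z) = x \<ominus> z"
  by (simp add: algebra_laws)

lemma anorm_triangle3: "x \<in> carrier A \<Longrightarrow> y \<in> carrier A \<Longrightarrow> z \<in> carrier A \<Longrightarrow>
    anorm A (x \<ominus> z) \<le> anorm A (x \<ominus> y) + anorm A (y \<ominus> z)"
  using anorm_triangle[of "x \<ominus> y" "y \<ominus> z"] by (simp add: minus_trans)

lemma minus_eq_zero_iff:
  assumes "x \<in> carrier A" "y \<in> carrier A"
  shows "x \<ominus> y = \<zero> \<longleftrightarrow> x = y"
proof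
  note xy = assms
  assume e: "x \<ominus> y = \<zero>"
  have "x = (x \<ominus> y) \<oplus> y" using xy by (simp only: algebra_laws(3,7,9,14,15))
  then show "x = y" unfolding e using xy by (simp add: algebra_laws)
qed (use assms in \<open>simp add: algebra_laws\<close>)

lemma metric: "Metric_space (carrier A) (norm_dist A (anorm A))"
proof
  fix x y show "0 \<le> norm_dist A (anorm A) x y" by (auto simp: norm_dist_def anorm_nonneg)
  show "norm_dist A (anorm A) x y = norm_dist A (anorm A) y x" by (auto simp: norm_dist_def anorm_minus_commute)
next
  fix x y assume "x \<in> carrier A" "y \<in> carrier A"
  then show "norm_dist A (anorm A) x y = 0 \<longleftrightarrow> x = y"
    by (auto simp: norm_dist_def anorm_eq_0 minus_eq_zero_iff)
next
  fix x y z assume "x \<in> carrier A" "y \<in> carrier A" "z \<in> carrier A"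
  then show "norm_dist A (anorm A) x z \<le> norm_dist A (anorm A) x y + norm_dist A (anorm A) y z"
    by (auto simp: norm_dist_def anorm_triangle3)
qed

lemma geometric_converges:
  assumes w: "\<And>n. w n \<in> carrier A" and c: "0 \<le> c" "c < 1"
    and step: "\<And>n. anorm A (w (Suc n) \<ominus> w n) \<le> M * c ^ n" and M: "0 \<le> M"
  obtains a where "a \<in> carrier A" "(\<lambda>n. anorm A (w n \<ominus> a)) \<longlonglongrightarrow> 0"
proof -
  interpret M: Metric_space "carrier A" "norm_dist A (anorm A)" by (rule metric)
  have tele: "anorm A (w k \<ominus> w n) \<le> M * c ^ n / (1 - c)" if "n \<le> k" for n k
  proof (rule geometric_telescope[OF c _ _ that M])
    fix n k
    have "anorm A (w (Suc k) \<ominus> w n) \<le> anorm A (w (Suc k) \<ominus> w k) + anorm A (w k \<ominus> w n)"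
      using w by (intro anorm_triangle3)
    then show "anorm A (w (Suc k) \<ominus> w n) \<le> anorm A (w k \<ominus> w n) + M * c ^ k" using step[of k] by simp
  next
    fix n show "anorm A (w n \<ominus> w n) = 0" using w[of n] by (simp add: anorm_eq_0 minus_eq_zero_iff)
  qed
  have "M.MCauchy w"
    unfolding M.MCauchy_def
  proof (intro conjI allI impI)
    show "range w \<subseteq> carrier A" using w by auto
    fix \<epsilon> :: real assume e: "\<epsilon> > 0"
    have "(\<lambda>n. M * c ^ n / (1 - c)) \<longlonglongrightarrow> M * 0 / (1 - c)"
      using c by (intro tendsto_intros LIMSEQ_power_zero) auto
    then have "\<forall>\<^sub>F n in sequentially. M * c ^ n / (1 - c) < \<epsilon>" using e by (intro order_tendstoD(2)) auto
    then obtain N where N: "\<And>n. n \<ge> N \<Longrightarrow> M * c ^ n / (1 - c) < \<epsilon>" by (auto simp: eventually_sequentially)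
    have "norm_dist A (anorm A) (w k) (w n) < \<epsilon>" if "N \<le> k" "N \<le> n" for k n
    proof (cases "n \<le> k")
      case True
      then show ?thesis using tele[OF True] N[OF that(2)] w by (simp add: norm_dist_def)
    next
      case False
      then have "k \<le> n" by simp
      then show ?thesis using tele[of k n] N[OF that(1)] w anorm_minus_commute[of "w k" "w n"] by (simp add: norm_dist_def)
    qed
    then show "\<exists>N. \<forall>n n'. N \<le> n \<longrightarrow> N \<le> n' \<longrightarrow> norm_dist A (anorm A) (w n) (w n') < \<epsilon>" by blast
  qed
  then obtain a where a: "limitin M.mtopology w a sequentially"
    using complete by (auto simp: M.mcomplete_def)
  then have ac: "a \<in> carrier A" by (simp add: M.limitin_metric)
  have "(\<lambda>n. norm_dist A (anorm A) (w n) a) \<longlonglongrightarrow> 0"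
    using a by (simp add: M.limitin_metric_dist_null)
  then have "(\<lambda>n. anorm A (w n \<ominus> a)) \<longlonglongrightarrow> 0" using w ac by (simp add: norm_dist_def)
  then show ?thesis using that ac by blast
qed

text \<open>The quasi-inverse of an element of norm below 1, as a limit of the partial sums of the
  Neumann series.\<close>

lemma quasi_inverse:
  assumes b: "b \<in> carrier A" and bc: "anorm A b \<le> c" and c: "c < 1"
  obtains y where "y \<in> carrier A" "y = b \<oplus> b \<otimes> y"
proof -
  have c0: "0 \<le> c" using anorm_nonneg[OF b] bc by simp
  define w where "w = rec_nat b (\<lambda>_ y. b \<oplus> b \<otimes> y)"
  have w0: "w 0 = b" and wS: "w (Suc n) = b \<oplus> b \<otimes> w n" for n by (simp_all add: w_def)
  have wc: "w n \<in> carrier A" for n by (induction n) (simp_all add: w0 wS b)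
  have diff: "(b \<oplus> b \<otimes> x) \<ominus> (b \<oplus> b \<otimes> y) = b \<otimes> (x \<ominus> y)" if "x \<in> carrier A" "y \<in> carrier A" for x y
  proof -
    have "b \<otimes> (x \<ominus> y) = b \<otimes> x \<ominus> b \<otimes> y" using that b by (simp add: algebra_laws)
    moreover have "(b \<oplus> b \<otimes> x) \<ominus> (b \<oplus> b \<otimes> y) = b \<otimes> x \<ominus> b \<otimes> y"
      using that b by (simp add: algebra_laws)
    ultimately show ?thesis by simp
  qed
  have mult_le: "anorm A (b \<otimes> x) \<le> c * anorm A x" if "x \<in> carrier A" for x
    using anorm_mult[OF b that] bc mult_right_mono[OF bc anorm_nonneg[OF that]] by simp
  define M where "M = anorm A (w 1 \<ominus> w 0)"
  have M: "0 \<le> M" using wc by (simp add: M_def anorm_nonneg)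
  have step: "anorm A (w (Suc n) \<ominus> w n) \<le> M * c ^ n" for n
  proof (induction n)
    case (Suc n)
    have "w (Suc (Suc n)) \<ominus> w (Suc n) = b \<otimes> (w (Suc n) \<ominus> w n)"
      unfolding wS[of "Suc n"] using diff[OF wc wc, of "Suc n" n] by (simp add: wS[of n, symmetric])
    then have "anorm A (w (Suc (Suc n)) \<ominus> w (Suc n)) \<le> c * anorm A (w (Suc n) \<ominus> w n)" using mult_le wc by simp
    also have "\<dots> \<le> c * (M * c ^ n)" using Suc c0 by (intro mult_left_mono)
    finally show ?case by (simp add: mult_ac)
  qed (simp add: M_def)
  obtain y where y: "y \<in> carrier A" "(\<lambda>n. anorm A (w n \<ominus> y)) \<longlonglongrightarrow> 0"
    using geometric_converges[OF wc c0 c step M] by blast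
  let ?z = "b \<oplus> b \<otimes> y"
  have zc: "?z \<in> carrier A" using b y by simp
  have "anorm A (y \<ominus> ?z) \<le> 0"
  proof (rule LIMSEQ_le_const)
    have "(\<lambda>n. anorm A (w (Suc n) \<ominus> y) + c * anorm A (w n \<ominus> y)) \<longlonglongrightarrow> 0 + c * 0"
      using y(2) by (intro tendsto_intros LIMSEQ_Suc)
    then show "(\<lambda>n. anorm A (w (Suc n) \<ominus> y) + c * anorm A (w n \<ominus> y)) \<longlonglongrightarrow> 0" by simp
    have "anorm A (y \<ominus> ?z) \<le> anorm A (w (Suc n) \<ominus> y) + c * anorm A (w n \<ominus> y)" for n
    proof -
      have "anorm A (y \<ominus> ?z) \<le> anorm A (y \<ominus> w (Suc n)) + anorm A (w (Suc n) \<ominus> ?z)"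
        using y zc wc by (intro anorm_triangle3)
      moreover have "w (Suc n) \<ominus> ?z = b \<otimes> (w n \<ominus> y)" unfolding wS using diff[OF wc y(1)] .
      ultimately show ?thesis using mult_le[of "w n \<ominus> y"] y wc anorm_minus_commute[of y "w (Suc n)"] by simp
    qed
    then show "\<exists>N. \<forall>n\<ge>N. anorm A (y \<ominus> ?z) \<le> anorm A (w (Suc n) \<ominus> y) + c * anorm A (w n \<ominus> y)" by blast
  qed
  then have "anorm A (y \<ominus> ?z) = 0" using anorm_nonneg[of "y \<ominus> ?z"] y zc by simp
  then have "y = ?z" using y zc by (simp add: anorm_eq_0 minus_eq_zero_iff)
  then show ?thesis using that y by blast
qed

lemma star_one: "star A \<one> = \<one>"
proof -
  have "star A \<one> = star A \<one> \<otimes> \<one>" by (simp add: star_closed)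
  also have "\<dots> = star A (star A \<one> \<otimes> \<one>)" using star_mult[of "star A \<one>" \<one>] by (simp add: star_star star_closed)
  also have "\<dots> = \<one>" by (simp add: star_star star_closed)
  finally show ?thesis .
qed

lemma anorm_one: "anorm A \<one> \<le> 1"
proof -
  have "(anorm A \<one>)\<^sup>2 = anorm A \<one>" using cstar_identity[of \<one>] by (simp add: star_one)
  then have "anorm A \<one> = 0 \<or> anorm A \<one> = 1" by (simp add: power2_eq_square)
  then show ?thesis by auto
qed

end

text \<open>A unital representation of a C*-algebra on a Hilbert space.\<close>

locale cstar_hilbert_rep = A: unital_cstar_algebra A + H: hilbert_space H
  for A :: "('b, 'n) cstar_scheme" and H :: "('h, 'k) hilbert_scheme" +
  fixes \<sigma> :: "'b \<Rightarrow> 'h \<Rightarrow> 'h"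
  assumes unital: "unital_rep A H \<sigma>"
begin

lemma hom: "star_hom A (Bop H) \<sigma>" and one: "\<sigma> \<one>\<^bsub>A\<^esub> = (\<lambda>h\<in>carrier H. h)"
  using unital by (auto simp: unital_rep_def)

lemmas homD = star_homD[OF hom, simplified]

lemma hom_minus: "x \<in> carrier A \<Longrightarrow> y \<in> carrier A \<Longrightarrow> \<sigma> (x \<ominus>\<^bsub>A\<^esub> y) = H.op_minus (\<sigma> x) (\<sigma> y)"
  unfolding H.op_minus_def using homD(2)[of x "(-1) \<odot>\<^bsub>A\<^esub> y"] homD(3)[of y "-1"]
  by (simp add: a_minus_def A.uminus_smult)

lemma hom_zero: "\<sigma> \<zero>\<^bsub>A\<^esub> = H.op_null"
proof (rule H.bounded_ops_eqI)
  have e: "\<sigma> \<zero>\<^bsub>A\<^esub> = (\<lambda>h\<in>carrier H. 0 \<odot>\<^bsub>H\<^esub> \<sigma> \<zero>\<^bsub>A\<^esub> h)" using homD(3)[of "\<zero>\<^bsub>A\<^esub>" 0] by simp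
  fix h k assume "h \<in> carrier H"
  then show "cinner H (\<sigma> \<zero>\<^bsub>A\<^esub> h) k = cinner H (H.op_null h) k"
    using fun_cong[OF e, of h] homD(1)[of "\<zero>\<^bsub>A\<^esub>"] by (simp add: H.bounded_ops_closed)
qed (use homD(1) in auto)

text \<open>Representations are contractive, since the algebra contains quasi-inverses.\<close>

lemma contractive:
  assumes a: "a \<in> carrier A"
  shows "op_bound H (\<sigma> a) (anorm A a)"
proof (rule H.norm_bound_from_inverses)
  show "\<sigma> a \<in> bounded_ops H" "0 \<le> anorm A a" using homD(1)[OF a] A.anorm_nonneg[OF a] by auto
  fix t assume t: "t > (anorm A a)\<^sup>2"
  then have t0: "t > 0" using zero_le_power2[of "anorm A a"] by linarith
  define b0 where "b0 = star A a \<otimes>\<^bsub>A\<^esub> a"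
  have b0: "b0 \<in> carrier A" using a by (simp add: b0_def A.star_closed)
  define b where "b = of_real (1 / t) \<odot>\<^bsub>A\<^esub> b0"
  have b: "b \<in> carrier A" using b0 by (simp add: b_def)
  have "anorm A b = (anorm A a)\<^sup>2 / t"
    using b0 a t0 A.cstar_identity[OF a] by (simp add: b_def b0_def A.anorm_smult norm_divide)
  moreover have "(anorm A a)\<^sup>2 / t < 1" using t t0 by simp
  ultimately obtain y where y: "y \<in> carrier A" "y = b \<oplus>\<^bsub>A\<^esub> b \<otimes>\<^bsub>A\<^esub> y"
    using A.quasi_inverse[OF b order_refl] by (metis (no_types))
  have "\<sigma> b0 = compose (carrier H) (adjoint_op H (\<sigma> a)) (\<sigma> a)"
    unfolding b0_def using homD(4)[of "star A a" a] homD(5)[OF a] a by (simp add: A.star_closed)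
  moreover have "\<sigma> b = (\<lambda>h\<in>carrier H. of_real (1 / t) \<odot>\<^bsub>H\<^esub> \<sigma> b0 h)" unfolding b_def by (rule homD(3)[OF b0])
  ultimately have sb: "\<sigma> b h = of_real (1 / t) \<odot>\<^bsub>H\<^esub> adjoint_op H (\<sigma> a) (\<sigma> a h)" if "h \<in> carrier H" for h
    using that by (simp add: compose_eq)
  have yb: "\<sigma> y \<in> bounded_ops H" and bb: "\<sigma> b \<in> bounded_ops H" using homD(1)[OF y(1)] homD(1)[OF b] .
  have "\<sigma> y h = of_real (1 / t) \<odot>\<^bsub>H\<^esub> adjoint_op H (\<sigma> a) (\<sigma> a (h \<oplus>\<^bsub>H\<^esub> \<sigma> y h))" if h: "h \<in> carrier H" for h
  proof -
    have c: "\<sigma> y h \<in> carrier H" using h yb by (simp add: H.bounded_ops_closed)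
    have "\<sigma> y = \<sigma> (b \<oplus>\<^bsub>A\<^esub> b \<otimes>\<^bsub>A\<^esub> y)" using arg_cong[OF y(2), of \<sigma>] .
    also have "\<dots> = (\<lambda>h\<in>carrier H. \<sigma> b h \<oplus>\<^bsub>H\<^esub> compose (carrier H) (\<sigma> b) (\<sigma> y) h)"
      using homD(2)[of b "b \<otimes>\<^bsub>A\<^esub> y"] homD(4)[of b y] y(1) b by (simp add: A.algebra_laws(5))
    finally have "\<sigma> y = (\<lambda>h\<in>carrier H. \<sigma> b h \<oplus>\<^bsub>H\<^esub> compose (carrier H) (\<sigma> b) (\<sigma> y) h)" .
    from fun_cong[OF this, of h] have "\<sigma> y h = \<sigma> b h \<oplus>\<^bsub>H\<^esub> \<sigma> b (\<sigma> y h)" using h by (simp add: compose_eq)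
    also have "\<dots> = \<sigma> b (h \<oplus>\<^bsub>H\<^esub> \<sigma> y h)" using h c bb by (simp add: H.bounded_ops_add)
    also have "\<dots> = of_real (1 / t) \<odot>\<^bsub>H\<^esub> adjoint_op H (\<sigma> a) (\<sigma> a (h \<oplus>\<^bsub>H\<^esub> \<sigma> y h))" using sb h c by simp
    finally show ?thesis .
  qed
  then show "\<exists>Y\<in>bounded_ops H. \<forall>h\<in>carrier H.
      Y h = of_real (1 / t) \<odot>\<^bsub>H\<^esub> adjoint_op H (\<sigma> a) (\<sigma> a (h \<oplus>\<^bsub>H\<^esub> Y h))" using yb by blast
qed

lemma representation_comp:
  assumes "representation E A i"
  shows "representation E (Bop H) (\<sigma> \<circ> i)"
proof -
  have i: "i x \<in> carrier A" if "x \<in> total E" for x using assms that by (auto simp: representation_def)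
  have "compose (carrier H) (adjoint_op H (\<sigma> (i y))) (\<sigma> (i x)) =
      (\<lambda>h\<in>carrier H. cinner (fiber E (proj E x)) x y \<odot>\<^bsub>H\<^esub> (\<lambda>h\<in>carrier H. h) h)"
    if "x \<in> total E" "y \<in> total E" "proj E x = proj E y" for x y
  proof -
    have "compose (carrier H) (adjoint_op H (\<sigma> (i y))) (\<sigma> (i x)) = \<sigma> (star A (i y) \<otimes>\<^bsub>A\<^esub> i x)"
      using homD(4)[of "star A (i y)" "i x"] homD(5)[of "i y"] i that by (simp add: A.star_closed)
    also have "star A (i y) \<otimes>\<^bsub>A\<^esub> i x = cinner (fiber E (proj E x)) x y \<odot>\<^bsub>A\<^esub> \<one>\<^bsub>A\<^esub>"
      using assms that unfolding representation_def by blast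
    also have "\<sigma> \<dots> = (\<lambda>h\<in>carrier H. cinner (fiber E (proj E x)) x y \<odot>\<^bsub>H\<^esub> (\<lambda>h\<in>carrier H. h) h)"
      using homD(3)[of "\<one>\<^bsub>A\<^esub>"] one by simp
    finally show ?thesis .
  qed
  moreover have "\<sigma> (i (pmult E x y)) = compose (carrier H) (\<sigma> (i x)) (\<sigma> (i y))"
    if "x \<in> total E" "y \<in> total E" for x y
    using homD(4)[of "i x" "i y"] i that assms by (simp add: representation_def)
  ultimately show ?thesis using i homD(1) by (auto simp: representation_def)
qed

end

lemma star_hom_comp: "star_hom A B f \<Longrightarrow> star_hom B C g \<Longrightarrow> star_hom A C (g \<circ> f)"
  by (auto simp: star_hom_def Pi_iff)

section \<open>Lifting the homomorphisms of the compact operators\<close>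

text \<open>A product system represented in a C*-algebra that is faithfully represented on \<open>H\<close>.\<close>

locale faithful_rep = qlo_product_system G P E + cstar_hilbert_rep A H \<sigma>
  for G :: "('g, 'm) monoid_scheme" (structure) and P and E :: "('g, 'e) prod_system"
    and A :: "('b, 'n) cstar_scheme" and H :: "('h, 'k) hilbert_scheme" and \<sigma> +
  fixes i :: "'e \<Rightarrow> 'b"
  assumes repA: "representation E A i" and faithful: "inj_on \<sigma> (carrier A)"
begin

sublocale R: hilbert_rep G P E H "\<sigma> \<circ> i"
  by unfold_locales (rule representation_comp[OF repA])

lemma i_closed: "s \<in> P \<Longrightarrow> x \<in> carrier (fiber E s) \<Longrightarrow> i x \<in> carrier A"
  using repA fiber_iff[of s x] by (auto simp: representation_def)

lemma faithfulD: "\<sigma> a = \<sigma> b \<Longrightarrow> a \<in> carrier A \<Longrightarrow> b \<in> carrier A \<Longrightarrow> a = b"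
  using faithful by (simp add: inj_on_def)

text \<open>The sum of \<open>i(x) i(y)\<^sup>*\<close> over a list of pairs \<open>(x, y)\<close>, the element of the algebra that corresponds to the
  operator \<open>fin_rank\<close> of the same list.\<close>

primrec rank_sum :: "('e \<times> 'e) list \<Rightarrow> 'b" where
  "rank_sum [] = \<zero>\<^bsub>A\<^esub>"
| "rank_sum (p # ps) = i (fst p) \<otimes>\<^bsub>A\<^esub> star A (i (snd p)) \<oplus>\<^bsub>A\<^esub> rank_sum ps"

context
  fixes s assumes s: "s \<in> P"
begin

interpretation T: tensor_map "fiber E s" H H "\<sigma> \<circ> i" by (rule R.rep_tensor_map[OF s])

lemma i_norm: "x \<in> carrier (fiber E s) \<Longrightarrow> anorm A (i x) \<le> hnorm (fiber E s) x"
proof -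
  assume x: "x \<in> carrier (fiber E s)"
  have "(anorm A (i x))\<^sup>2 = anorm A (cinner (fiber E s) x x \<odot>\<^bsub>A\<^esub> \<one>\<^bsub>A\<^esub>)"
    using A.cstar_identity[OF i_closed[OF s x]] repA x fiber_iff[OF s] by (auto simp: representation_def)
  also have "\<dots> = (hnorm (fiber E s) x)\<^sup>2 * anorm A \<one>\<^bsub>A\<^esub>"
    using T.X.cinner_self[OF x] by (simp add: A.anorm_smult norm_power)
  also have "\<dots> \<le> (hnorm (fiber E s) x)\<^sup>2 * 1" by (intro mult_left_mono A.anorm_one) simp
  finally have "(anorm A (i x))\<^sup>2 \<le> (hnorm (fiber E s) x)\<^sup>2" by simp
  then show ?thesis by (rule power2_le_imp_le) (use x in simp)
qed

lemma i_star_norm: "x \<in> carrier (fiber E s) \<Longrightarrow> anorm A (star A (i x)) \<le> hnorm (fiber E s) x"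
proof -
  assume x: "x \<in> carrier (fiber E s)"
  let ?a = "star A (i x)"
  have a: "?a \<in> carrier A" and ix: "i x \<in> carrier A" using i_closed[OF s x] A.star_closed by auto
  have "(anorm A ?a)\<^sup>2 = anorm A (i x \<otimes>\<^bsub>A\<^esub> ?a)" using A.cstar_identity[OF a] A.star_star[OF ix] by simp
  also have "\<dots> \<le> anorm A (i x) * anorm A ?a" by (rule A.anorm_mult[OF ix a])
  also have "\<dots> \<le> hnorm (fiber E s) x * anorm A ?a" using i_norm[OF x] A.anorm_nonneg[OF a] by (rule mult_right_mono)
  finally show ?thesis
    using A.anorm_nonneg[OF a] x mult_right_le_imp_le[of "anorm A ?a" "anorm A ?a" "hnorm (fiber E s) x"]
    by (cases "anorm A ?a = 0") (auto simp: power2_eq_square)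
qed

lemma rank_sum_closed [simp]: "ps \<in> T.X.vpairs \<Longrightarrow> rank_sum ps \<in> carrier A"
  by (induction ps) (auto simp: i_closed[OF s] A.star_closed)

lemma hom_rank_sum: "ps \<in> T.X.vpairs \<Longrightarrow> \<sigma> (rank_sum ps) = R.rep_op s (T.X.fin_rank ps)"
proof (induction ps)
  case Nil
  show ?case unfolding R.rep_op_def by (simp add: hom_zero T.amp_null)
next
  case (Cons p ps)
  then have p: "fst p \<in> carrier (fiber E s)" "snd p \<in> carrier (fiber E s)" "ps \<in> T.X.vpairs" by auto
  have c: "i (fst p) \<in> carrier A" "i (snd p) \<in> carrier A" "star A (i (snd p)) \<in> carrier A"
    using i_closed[OF s] p A.star_closed by auto
  have "\<sigma> (i (fst p) \<otimes>\<^bsub>A\<^esub> star A (i (snd p))) = R.rep_op s (rank_one (fiber E s) (fst p) (snd p))"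
    using homD(4)[OF c(1,3)] homD(5)[OF c(2)] R.rep_op_rank_one[OF s p(1,2)] by simp
  then show ?case
    using Cons.IH[OF p(3)] homD(2)[of "i (fst p) \<otimes>\<^bsub>A\<^esub> star A (i (snd p))" "rank_sum ps"] c p
    unfolding R.rep_op_def by (simp add: T.amp_plus H.op_plus_def)
qed

text \<open>Composition of an operator of finite rank with \<open>W\<close> from the left, on the level of lists.\<close>

definition lmap :: "('e \<Rightarrow> 'e) \<Rightarrow> ('e \<times> 'e) list \<Rightarrow> ('e \<times> 'e) list" where
  "lmap W ps = map (\<lambda>p. (W (fst p), snd p)) ps"

lemma lmap_vpairs: "W \<in> bounded_ops (fiber E s) \<Longrightarrow> ps \<in> T.X.vpairs \<Longrightarrow> lmap W ps \<in> T.X.vpairs"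
  by (induction ps) (auto simp: lmap_def T.X.bounded_ops_closed)

lemma fin_rank_lmap:
  assumes W: "W \<in> bounded_ops (fiber E s)" and ps: "ps \<in> T.X.vpairs"
  shows "T.X.fin_rank (lmap W ps) = compose (carrier (fiber E s)) W (T.X.fin_rank ps)"
proof (rule T.X.bounded_ops_eqI)
  fix z y assume z: "z \<in> carrier (fiber E s)"
  have "T.X.fin_rank (lmap W ps) z = W (T.X.fin_rank ps z)"
    using ps
  proof (induction ps)
    case Nil
    then show ?case using W z by (simp add: lmap_def T.X.bounded_ops_zero)
  next
    case (Cons p ps)
    then have p: "fst p \<in> carrier (fiber E s)" "snd p \<in> carrier (fiber E s)" "ps \<in> T.X.vpairs" by auto
    then show ?case using Cons.IH[OF p(3)] W z
      by (simp add: lmap_def rank_one_def T.X.bounded_opsD)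
  qed
  then show "cinner (fiber E s) (T.X.fin_rank (lmap W ps) z) y = cinner (fiber E s) (compose (carrier (fiber E s)) W (T.X.fin_rank ps) z) y"
    using z by (simp add: compose_eq)
qed (use W ps lmap_vpairs in auto)

lemma rank_sum_growth:
  assumes "ps \<in> T.X.vpairs"
  shows "\<exists>M\<ge>0. \<forall>W C. W \<in> bounded_ops (fiber E s) \<longrightarrow> op_bound (fiber E s) W C \<longrightarrow> anorm A (rank_sum (lmap W ps)) \<le> M * C"
  using assms
proof (induction ps)
  case Nil
  show ?case using A.anorm_eq_0[OF A.algebra_laws(2)] by (intro exI[of _ 0]) (simp add: lmap_def)
next
  case (Cons p ps)
  then have p: "fst p \<in> carrier (fiber E s)" "snd p \<in> carrier (fiber E s)" "ps \<in> T.X.vpairs" by auto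
  obtain M where M: "M \<ge> 0" "\<And>W C. W \<in> bounded_ops (fiber E s) \<Longrightarrow> op_bound (fiber E s) W C \<Longrightarrow> anorm A (rank_sum (lmap W ps)) \<le> M * C"
    using Cons.IH[OF p(3)] by blast
  let ?N = "hnorm (fiber E s) (fst p) * hnorm (fiber E s) (snd p)"
  have "anorm A (rank_sum (lmap W (p # ps))) \<le> (?N + M) * C"
    if W: "W \<in> bounded_ops (fiber E s)" "op_bound (fiber E s) W C" for W C
  proof -
    have Wp: "W (fst p) \<in> carrier (fiber E s)" using W p by (simp add: T.X.bounded_ops_closed)
    have c: "i (W (fst p)) \<in> carrier A" "star A (i (snd p)) \<in> carrier A" "rank_sum (lmap W ps) \<in> carrier A"
      using i_closed[OF s] Wp p A.star_closed lmap_vpairs[OF W(1) p(3)] by auto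
    have "anorm A (rank_sum (lmap W (p # ps))) \<le> anorm A (i (W (fst p)) \<otimes>\<^bsub>A\<^esub> star A (i (snd p))) + anorm A (rank_sum (lmap W ps))"
      using A.anorm_triangle[of "i (W (fst p)) \<otimes>\<^bsub>A\<^esub> star A (i (snd p))" "rank_sum (lmap W ps)"] c by (simp add: lmap_def)
    also have "\<dots> \<le> (C * hnorm (fiber E s) (fst p)) * hnorm (fiber E s) (snd p) + M * C"
    proof (intro add_mono M(2)[OF W])
      have "anorm A (i (W (fst p)) \<otimes>\<^bsub>A\<^esub> star A (i (snd p))) \<le> anorm A (i (W (fst p))) * anorm A (star A (i (snd p)))"
        by (rule A.anorm_mult[OF c(1,2)])
      also have "\<dots> \<le> (C * hnorm (fiber E s) (fst p)) * hnorm (fiber E s) (snd p)"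
        using i_norm[OF Wp] T.X.op_boundD[OF W(2) p(1)] i_star_norm[OF p(2)] Wp p A.anorm_nonneg[OF c(2)] 
        by (intro mult_mono) (auto intro: order_trans[OF T.X.hnorm_nonneg])
      finally show "anorm A (i (W (fst p)) \<otimes>\<^bsub>A\<^esub> star A (i (snd p))) \<le> (C * hnorm (fiber E s) (fst p)) * hnorm (fiber E s) (snd p)" .
    qed
    finally show ?thesis by (simp add: algebra_simps)
  qed
  then show ?case using M(1) p by (intro exI[of _ "?N + M"]) auto
  qed

text \<open>The norm in \<open>A\<close> of the element for a finite rank operator is bounded by the norm of this
  operator \<open>F\<close>, by the power trick. Let \<open>S\<^sub>0 = F\<close> and \<open>S\<^sub>k\<^sub>+\<^sub>1 = S\<^sub>k\<^sup>* S\<^sub>k\<close>; all \<open>S\<^sub>k\<close> are of the form \<open>W\<^sub>k F\<close>, so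
  that the norms of the corresponding elements \<open>b\<^sub>k\<close> grow at most like \<open>C\<close> to the power \<open>2\<^sup>k\<close>, and they
  satisfy \<open>\<parallel>b\<^sub>k\<parallel>\<^sup>2 = \<parallel>b\<^sub>k\<^sub>+\<^sub>1\<parallel>\<close> by the C*-identity.\<close>

lemma rank_sum_bound:
  assumes ps: "ps \<in> T.X.vpairs" and C: "op_bound (fiber E s) (T.X.fin_rank ps) C" "C > 0"
  shows "anorm A (rank_sum ps) \<le> C"
proof -
  let ?F = "T.X.fin_rank ps" and ?X = "fiber E s"
  define W where "W = rec_nat T.idX (\<lambda>_ W. compose (carrier ?X) (adjoint_op ?X (compose (carrier ?X) W ?F)) W)"
  define S where "S k = compose (carrier ?X) (W k) ?F" for k
  have W0: "W 0 = T.idX" and WS: "W (Suc k) = compose (carrier ?X) (adjoint_op ?X (S k)) (W k)" for k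
    by (simp_all add: W_def S_def)
  have F: "?F \<in> bounded_ops ?X" using ps by simp
  have Wb: "W k \<in> bounded_ops ?X" for k
    by (induction k) (use F in \<open>auto simp: W0 WS S_def intro!: T.X.op_compose T.X.adjoint_closed\<close>)
  have Sb: "S k \<in> bounded_ops ?X" for k using Wb F by (simp add: S_def)
  have SS: "S (Suc k) = compose (carrier ?X) (adjoint_op ?X (S k)) (S k)" for k
    unfolding S_def[of "Suc k"] WS using Wb F Sb
    by (intro T.X.bounded_ops_eqI) (auto simp: compose_eq S_def T.X.bounded_ops_closed)
  have S0: "S 0 = ?F"
    unfolding S_def W0 using F by (intro T.X.bounded_ops_eqI) (auto simp: compose_eq T.X.bounded_ops_closed)
  have SC: "op_bound ?X (S k) (C ^ (2 ^ k))" for k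
  proof (induction k)
    case (Suc k)
    have "op_bound ?X (S (Suc k)) (C ^ (2 ^ k) * C ^ (2 ^ k))"
      unfolding SS using Suc Sb by (intro T.X.op_bound_compose T.X.adjoint_bound) auto
    then show ?case by (simp add: power_add[symmetric] mult_2)
  qed (simp add: S0 C)
  have WC: "op_bound ?X (W k) (C ^ (2 ^ k) / C)" for k
  proof (induction k)
    case 0
    then show ?case using C by (simp add: W0 op_bound_def)
  next
    case (Suc k)
    have "op_bound ?X (W (Suc k)) (C ^ (2 ^ k) * (C ^ (2 ^ k) / C))"
      unfolding WS using Suc Sb SC Wb by (intro T.X.op_bound_compose T.X.adjoint_bound) auto
    then show ?case by (simp add: power_add[symmetric] mult_2)
  qed
  define b where "b k = rank_sum (lmap (W k) ps)" for k
  have bc: "b k \<in> carrier A" for k unfolding b_def using lmap_vpairs[OF Wb ps] by simp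
  have hb: "\<sigma> (b k) = R.rep_op s (S k)" for k
    unfolding b_def S_def using hom_rank_sum[OF lmap_vpairs[OF Wb ps]] fin_rank_lmap[OF Wb ps] by simp
  have bS: "b (Suc k) = star A (b k) \<otimes>\<^bsub>A\<^esub> b k" for k
  proof (rule faithfulD)
    have "\<sigma> (star A (b k) \<otimes>\<^bsub>A\<^esub> b k) = compose (carrier H) (adjoint_op H (\<sigma> (b k))) (\<sigma> (b k))"
      using homD(4)[of "star A (b k)" "b k"] homD(5)[OF bc] bc by (simp add: A.star_closed)
    then show "\<sigma> (b (Suc k)) = \<sigma> (star A (b k) \<otimes>\<^bsub>A\<^esub> b k)"
      using Sb[of k] by (simp add: hb SS R.rep_op_def T.amp_compose T.amp_adjoint)
  qed (use bc A.star_closed in auto)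
  obtain M where M: "\<forall>W C. W \<in> bounded_ops ?X \<longrightarrow> op_bound ?X W C \<longrightarrow> anorm A (rank_sum (lmap W ps)) \<le> M * C"
    using rank_sum_growth[OF ps] by blast
  have "anorm A (b 0) \<le> C * 1"
  proof (rule squaring_bound[where M = "M / C"])
    fix k
    show "0 \<le> anorm A (b k)" using bc by (rule A.anorm_nonneg)
    show "(anorm A (b k))\<^sup>2 \<le> anorm A (b (Suc k)) * 1" using A.cstar_identity[OF bc] bS by simp
    show "anorm A (b k) \<le> M / C * C ^ 2 ^ k" unfolding b_def using M[rule_format, OF Wb WC, of k] by simp
  qed (use C in auto)
  moreover have "b 0 = rank_sum ps"
    by (rule faithfulD) (use bc ps hb[of 0] hom_rank_sum[OF ps] in \<open>auto simp: S0\<close>)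
  ultimately show ?thesis by simp
qed

lemma rank_sum_dist:
  assumes ps: "ps \<in> T.X.vpairs" and qs: "qs \<in> T.X.vpairs"
    and C: "op_bound (fiber E s) (T.X.op_minus (T.X.fin_rank ps) (T.X.fin_rank qs)) C" "C > 0"
  shows "anorm A (rank_sum ps \<ominus>\<^bsub>A\<^esub> rank_sum qs) \<le> C"
proof -
  define N where "N = (\<lambda>x\<in>carrier (fiber E s). (-1) \<odot>\<^bsub>fiber E s\<^esub> T.idX x)"
  have N: "N \<in> bounded_ops (fiber E s)" unfolding N_def by (rule T.X.op_smult) simp
  have app: "T.X.fin_rank (us @ vs) z = T.X.fin_rank us z \<oplus>\<^bsub>fiber E s\<^esub> T.X.fin_rank vs z"
    if "us \<in> T.X.vpairs" "vs \<in> T.X.vpairs" "z \<in> carrier (fiber E s)" for us vs z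
    using that(1)
  proof (induction us)
    case Nil
    then show ?case using T.X.bounded_ops_closed[OF T.X.fin_rank_bounded] that by simp
  next
    case (Cons p us)
    then have p: "fst p \<in> carrier (fiber E s)" "snd p \<in> carrier (fiber E s)" "us \<in> T.X.vpairs" by auto
    have "rank_one (fiber E s) (fst p) (snd p) z \<in> carrier (fiber E s)" "T.X.fin_rank us z \<in> carrier (fiber E s)"
      "T.X.fin_rank vs z \<in> carrier (fiber E s)"
      using p that T.X.bounded_ops_closed[OF T.X.fin_rank_bounded] T.X.bounded_ops_closed[OF T.X.op_rank_one] by auto
    then show ?case using Cons.IH[OF p(3)] that by (simp add: T.X.a_assoc)
  qed
  define rs where "rs = ps @ lmap N qs"
  have rs: "rs \<in> T.X.vpairs" using ps lmap_vpairs[OF N qs] by (simp add: rs_def T.X.vpairs_def)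
  have fr: "T.X.fin_rank rs = T.X.op_minus (T.X.fin_rank ps) (T.X.fin_rank qs)"
  proof (rule T.X.bounded_ops_eqI)
    fix z y assume z: "z \<in> carrier (fiber E s)" "y \<in> carrier (fiber E s)"
    have c: "T.X.fin_rank ps z \<in> carrier (fiber E s)" "T.X.fin_rank qs z \<in> carrier (fiber E s)"
      using z ps qs T.X.bounded_ops_closed[OF T.X.fin_rank_bounded] by auto
    have "T.X.fin_rank rs z = T.X.fin_rank ps z \<oplus>\<^bsub>fiber E s\<^esub> (-1) \<odot>\<^bsub>fiber E s\<^esub> T.X.fin_rank qs z"
      unfolding rs_def app[OF ps lmap_vpairs[OF N qs] z(1)] fin_rank_lmap[OF N qs]
      using z c by (simp add: compose_eq N_def)
    then show "cinner (fiber E s) (T.X.fin_rank rs z) y = cinner (fiber E s) (T.X.op_minus (T.X.fin_rank ps) (T.X.fin_rank qs) z) y"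
      using z c ps qs by (simp add: T.X.op_minus_apply T.X.cinner_simps)
  qed (use rs ps qs in auto)
  have "rank_sum rs = rank_sum ps \<ominus>\<^bsub>A\<^esub> rank_sum qs"
    by (rule faithfulD)
      (use rs ps qs in \<open>simp_all add: hom_minus hom_rank_sum fr R.rep_op_def T.amp_minus\<close>)
  then show ?thesis using rank_sum_bound[OF rs] C fr by simp
qed

text \<open>Approximating \<open>T\<close> by operators of finite rank at a geometric rate gives a convergent sequence in the
  algebra, whose limit is mapped to \<open>\<rho>\<^sub>s(T)\<close>.\<close>

lemma compact_lift:
  assumes T: "T \<in> compact_ops (fiber E s)"
  shows "\<exists>a\<in>carrier A. \<sigma> a = R.rep_op s T"
proof -
  let ?X = "fiber E s"
  have Tb: "T \<in> bounded_ops ?X" using T by simp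
  have "\<exists>ps\<in>T.X.vpairs. op_bound ?X (T.X.op_minus T (T.X.fin_rank ps)) ((1/2) ^ n)" for n
    by (rule T.X.finite_rank_approx[OF T]) simp
  then obtain ps where ps: "\<And>n. ps n \<in> T.X.vpairs"
    "\<And>n. op_bound ?X (T.X.op_minus T (T.X.fin_rank (ps n))) ((1/2) ^ n)" by metis
  have step: "anorm A (rank_sum (ps (Suc n)) \<ominus>\<^bsub>A\<^esub> rank_sum (ps n)) \<le> 2 * (1/2) ^ n" for n
  proof (rule rank_sum_dist[OF ps(1) ps(1)])
    show "op_bound ?X (T.X.op_minus (T.X.fin_rank (ps (Suc n))) (T.X.fin_rank (ps n))) (2 * (1/2) ^ n)"
      unfolding op_bound_def
    proof (intro conjI ballI)
      fix z assume z: "z \<in> carrier ?X"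
      let ?a = "T.X.fin_rank (ps (Suc n)) z" and ?b = "T.X.fin_rank (ps n) z"
      have c: "T z \<in> carrier ?X" "?a \<in> carrier ?X" "?b \<in> carrier ?X"
        using z ps(1) Tb T.X.bounded_ops_closed[OF T.X.fin_rank_bounded] by (auto simp: T.X.bounded_ops_closed)
      have "hnorm ?X (T z \<ominus>\<^bsub>?X\<^esub> ?a) \<le> (1/2) ^ Suc n * hnorm ?X z"
        and b: "hnorm ?X (T z \<ominus>\<^bsub>?X\<^esub> ?b) \<le> (1/2) ^ n * hnorm ?X z"
        using T.X.op_boundD[OF ps(2) z, of "Suc n"] T.X.op_boundD[OF ps(2) z, of n] z Tb ps(1)
        by (simp_all add: T.X.op_minus_apply)
      moreover have "(1/2) ^ Suc n * hnorm ?X z \<le> (1/2) ^ n * hnorm ?X z"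
        using z by (intro mult_right_mono) auto
      ultimately have "hnorm ?X (T z \<ominus>\<^bsub>?X\<^esub> ?a) \<le> (1/2) ^ n * hnorm ?X z" by linarith
      moreover note b
      moreover have "hnorm ?X (?a \<ominus>\<^bsub>?X\<^esub> ?b) \<le> hnorm ?X (?a \<ominus>\<^bsub>?X\<^esub> T z) + hnorm ?X (T z \<ominus>\<^bsub>?X\<^esub> ?b)"
        using c by (intro T.X.hnorm_triangle3)
      ultimately show "hnorm ?X (T.X.op_minus (T.X.fin_rank (ps (Suc n))) (T.X.fin_rank (ps n)) z) \<le> 2 * (1/2) ^ n * hnorm ?X z"
        using z ps(1) c T.X.hnorm_minus_commute[OF c(1,2)] by (simp add: T.X.op_minus_apply mult.assoc)
    qed simp
  qed simp
  obtain a where a: "a \<in> carrier A" "(\<lambda>n. anorm A (rank_sum (ps n) \<ominus>\<^bsub>A\<^esub> a)) \<longlonglongrightarrow> 0"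
    using A.geometric_converges[of "\<lambda>n. rank_sum (ps n)" "1/2" 2] step ps(1) by auto
  have sa: "\<sigma> a \<in> bounded_ops H" "R.rep_op s T \<in> bounded_ops H" using homD(1) a R.rep_op_closed[OF s Tb] by auto
  have "\<sigma> a h = R.rep_op s T h" if h: "h \<in> carrier H" for h
  proof -
    have c: "\<sigma> a h \<in> carrier H" "R.rep_op s T h \<in> carrier H" using sa h by (auto simp: H.bounded_ops_closed)
    have "hnorm H (\<sigma> a h \<ominus>\<^bsub>H\<^esub> R.rep_op s T h) \<le> 0"
    proof (rule LIMSEQ_le_const)
      have "(\<lambda>n. anorm A (rank_sum (ps n) \<ominus>\<^bsub>A\<^esub> a) * hnorm H h + (1/2) ^ n * hnorm H h) \<longlonglongrightarrow> 0 * hnorm H h + 0 * hnorm H h"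
        by (intro tendsto_intros a LIMSEQ_power_zero) simp
      then show "(\<lambda>n. anorm A (rank_sum (ps n) \<ominus>\<^bsub>A\<^esub> a) * hnorm H h + (1/2) ^ n * hnorm H h) \<longlonglongrightarrow> 0" by simp
      have "hnorm H (\<sigma> a h \<ominus>\<^bsub>H\<^esub> R.rep_op s T h) \<le> anorm A (rank_sum (ps n) \<ominus>\<^bsub>A\<^esub> a) * hnorm H h + (1/2) ^ n * hnorm H h" for n
      proof -
        let ?f = "rank_sum (ps n)"
        have f: "?f \<in> carrier A" "\<sigma> ?f \<in> bounded_ops H" using ps(1) homD(1) by auto
        have fc: "\<sigma> ?f h \<in> carrier H" using f h by (simp add: H.bounded_ops_closed)
        have 1: "hnorm H (\<sigma> ?f h \<ominus>\<^bsub>H\<^esub> \<sigma> a h) \<le> anorm A (?f \<ominus>\<^bsub>A\<^esub> a) * hnorm H h"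
          using H.op_boundD[OF contractive[of "?f \<ominus>\<^bsub>A\<^esub> a"] h] f a sa h by (simp add: hom_minus H.op_minus_apply)
        have "op_bound H (T.amp (T.X.op_minus T (T.X.fin_rank (ps n)))) ((1/2) ^ n)"
          using T.amp_bound[OF _ ps(2)] Tb ps(1) by simp
        then have 2: "hnorm H (R.rep_op s T h \<ominus>\<^bsub>H\<^esub> \<sigma> ?f h) \<le> (1/2) ^ n * hnorm H h"
          using H.op_boundD[of "T.amp (T.X.op_minus T (T.X.fin_rank (ps n)))" "(1/2) ^ n" h] h Tb ps(1)
          by (simp add: hom_rank_sum R.rep_op_def T.amp_minus H.op_minus_apply)
        have "hnorm H (\<sigma> a h \<ominus>\<^bsub>H\<^esub> R.rep_op s T h) \<le> hnorm H (\<sigma> a h \<ominus>\<^bsub>H\<^esub> \<sigma> ?f h) + hnorm H (\<sigma> ?f h \<ominus>\<^bsub>H\<^esub> R.rep_op s T h)"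
          by (rule H.hnorm_triangle3[OF c(1) fc c(2)])
        then show ?thesis using 1 2 H.hnorm_minus_commute[OF c(1) fc] H.hnorm_minus_commute[OF c(2) fc] by simp
      qed
      then show "\<exists>N. \<forall>n\<ge>N. hnorm H (\<sigma> a h \<ominus>\<^bsub>H\<^esub> R.rep_op s T h)
          \<le> anorm A (rank_sum (ps n) \<ominus>\<^bsub>A\<^esub> a) * hnorm H h + (1/2) ^ n * hnorm H h" by blast
    qed
    then have "hnorm H (\<sigma> a h \<ominus>\<^bsub>H\<^esub> R.rep_op s T h) = 0" using c by (intro order_antisym) auto
    then show ?thesis using c by (simp add: H.hnorm_eq_0 H.minus_eq_zero_iff)
  qed
  then have "\<sigma> a = R.rep_op s T" using sa by (intro H.bounded_ops_eqI) auto
  then show ?thesis using a by blast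
qed

text \<open>Hence the homomorphism of the compact operators into \<open>B(H)\<close> lifts to \<open>A\<close>, and its algebraic
  properties follow from the injectivity of \<open>\<sigma>\<close>.\<close>

lemma rho_algebra:
  shows rho_algebra_hom: "star_hom (Kop (fiber E s)) A (rho E A i s)"
    and rho_algebra_rank_one: "\<And>x y. x \<in> carrier (fiber E s) \<Longrightarrow> y \<in> carrier (fiber E s) \<Longrightarrow>
       rho E A i s (rank_one (fiber E s) x y) = i x \<otimes>\<^bsub>A\<^esub> star A (i y)"
    and rho_algebra_hom_eq: "\<And>T. T \<in> compact_ops (fiber E s) \<Longrightarrow> \<sigma> (rho E A i s T) = R.rep_op s T"
proof -
  let ?X = "fiber E s"
  define f where "f = (\<lambda>T\<in>compact_ops ?X. SOME a. a \<in> carrier A \<and> \<sigma> a = R.rep_op s T)"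
  have f: "f T \<in> carrier A \<and> \<sigma> (f T) = R.rep_op s T" if "T \<in> compact_ops ?X" for T
    using someI_ex[of "\<lambda>a. a \<in> carrier A \<and> \<sigma> a = R.rep_op s T"] compact_lift[OF that] that by (auto simp: f_def)
  have feq: "f T = a" if "T \<in> compact_ops ?X" "a \<in> carrier A" "\<sigma> a = R.rep_op s T" for T a
    using faithfulD[of "f T" a] f[OF that(1)] that by simp
  have fin_rank: "f (rank_one ?X x y) = i x \<otimes>\<^bsub>A\<^esub> star A (i y)" if "x \<in> carrier ?X" "y \<in> carrier ?X" for x y
  proof (rule feq)
    have c: "i x \<in> carrier A" "i y \<in> carrier A" "star A (i y) \<in> carrier A" using i_closed[OF s] that A.star_closed by auto
    then show "i x \<otimes>\<^bsub>A\<^esub> star A (i y) \<in> carrier A" by simp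
    show "\<sigma> (i x \<otimes>\<^bsub>A\<^esub> star A (i y)) = R.rep_op s (rank_one ?X x y)"
      using homD(4)[OF c(1,3)] homD(5)[OF c(2)] R.rep_op_rank_one[OF s that] by simp
  qed (use T.X.compact_rank_one that in auto)
  have fhom: "star_hom (Kop ?X) A f"
    unfolding star_hom_def
  proof (intro conjI ballI allI)
    show "f \<in> carrier (Kop ?X) \<rightarrow> carrier A" using f by simp
    fix S assume S: "S \<in> carrier (Kop ?X)"
    then have S: "S \<in> compact_ops ?X" "S \<in> bounded_ops ?X" by auto
    note fS = f[OF S(1), THEN conjunct1] f[OF S(1), THEN conjunct2]
    show "f (c \<odot>\<^bsub>Kop ?X\<^esub> S) = c \<odot>\<^bsub>A\<^esub> f S" for c
      by (rule feq) (use fS S homD(3) T.X.compact_smult T.amp_smult in \<open>simp_all add: R.rep_op_def\<close>)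
    show "f (star (Kop ?X) S) = star A (f S)"
      by (rule feq) (use fS S homD(5) T.X.compact_adjoint T.amp_adjoint A.star_closed in \<open>simp_all add: R.rep_op_def\<close>)
    fix T assume T: "T \<in> carrier (Kop ?X)"
    then have T: "T \<in> compact_ops ?X" "T \<in> bounded_ops ?X" by auto
    note fT = f[OF T(1), THEN conjunct1] f[OF T(1), THEN conjunct2]
    show "f (S \<oplus>\<^bsub>Kop ?X\<^esub> T) = f S \<oplus>\<^bsub>A\<^esub> f T"
      by (rule feq) (use fS fT S T homD(2) T.X.compact_add T.amp_add in \<open>simp_all add: R.rep_op_def T.X.op_plus_def\<close>)
    show "f (S \<otimes>\<^bsub>Kop ?X\<^esub> T) = f S \<otimes>\<^bsub>A\<^esub> f T"
      by (rule feq) (use fS fT S T homD(4) T.X.compact_compose_left T.amp_compose in \<open>simp_all add: R.rep_op_def\<close>)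
  qed
  have "rho E A i s = f"
    unfolding rho_def
  proof (rule the_equality)
    show "f \<in> extensional (carrier (Kop ?X)) \<and> star_hom (Kop ?X) A f \<and>
       (\<forall>x\<in>carrier ?X. \<forall>y\<in>carrier ?X. f (rank_one ?X x y) = i x \<otimes>\<^bsub>A\<^esub> star A (i y))"
      using fhom fin_rank by (simp add: f_def)
    fix g assume g: "g \<in> extensional (carrier (Kop ?X)) \<and> star_hom (Kop ?X) A g \<and>
       (\<forall>x\<in>carrier ?X. \<forall>y\<in>carrier ?X. g (rank_one ?X x y) = i x \<otimes>\<^bsub>A\<^esub> star A (i y))"
    then have gh: "star_hom (Kop ?X) A g" by blast
    show "g = f"
    proof (rule extensionalityI[where A = "compact_ops ?X"])
      fix T assume T: "T \<in> compact_ops ?X"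
      have "(\<sigma> \<circ> g) T = R.rep_op s T"
      proof (rule R.rho_hom_unique[OF s star_hom_comp[OF gh hom] _ T])
        fix x y assume xy: "x \<in> carrier ?X" "y \<in> carrier ?X"
        then have c: "i x \<in> carrier A" "i y \<in> carrier A" "star A (i y) \<in> carrier A" using i_closed[OF s] A.star_closed by auto
        show "(\<sigma> \<circ> g) (rank_one ?X x y) = (\<sigma> \<circ> i) x \<otimes>\<^bsub>Bop H\<^esub> star (Bop H) ((\<sigma> \<circ> i) y)"
          using g xy homD(4)[OF c(1,3)] homD(5)[OF c(2)] by simp
      qed
      moreover have "g T \<in> carrier A" using star_hom_closed[OF gh, of T] T by simp
      ultimately show "g T = f T" using feq[OF T, of "g T"] by simp
    qed (use g f_def in auto)
  qed
  then show "star_hom (Kop ?X) A (rho E A i s)"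
    "\<And>x y. x \<in> carrier ?X \<Longrightarrow> y \<in> carrier ?X \<Longrightarrow> rho E A i s (rank_one ?X x y) = i x \<otimes>\<^bsub>A\<^esub> star A (i y)"
    "\<And>T. T \<in> compact_ops ?X \<Longrightarrow> \<sigma> (rho E A i s T) = R.rep_op s T"
    using fhom fin_rank f by auto
qed

end

end

section \<open>Covariance of the universal representation\<close>

text \<open>Any unital representation, faithful or not, carries \<open>\<rho>\<^sub>s\<close> in the algebra to \<open>\<rho>\<^sub>s\<close> on the Hilbert space.\<close>

lemma (in cstar_hilbert_rep) hom_rho:
  assumes "qlo_product_system G P E" and i: "representation E A i" and s: "s \<in> P"
    and rho: "star_hom (Kop (fiber E s)) A (rho E A i s)"
      "\<And>x y. x \<in> carrier (fiber E s) \<Longrightarrow> y \<in> carrier (fiber E s) \<Longrightarrow>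
       rho E A i s (rank_one (fiber E s) x y) = i x \<otimes>\<^bsub>A\<^esub> star A (i y)"
    and T: "T \<in> compact_ops (fiber E s)"
  shows "\<sigma> (rho E A i s T) = rho E (Bop H) (\<sigma> \<circ> i) s T"
proof -
  interpret qlo_product_system G P E by fact
  interpret R: hilbert_rep G P E H "\<sigma> \<circ> i"
    by unfold_locales (rule representation_comp[OF i])
  have ic: "i x \<in> carrier A" if "x \<in> carrier (fiber E s)" for x
    using i fiber_iff[OF s, of x] that by (auto simp: representation_def)
  have "(\<sigma> \<circ> rho E A i s) T = R.rep_op s T"
  proof (rule R.rho_hom_unique[OF s star_hom_comp[OF rho(1) hom] _ T])
    fix x y assume xy: "x \<in> carrier (fiber E s)" "y \<in> carrier (fiber E s)"
    then have c: "i x \<in> carrier A" "i y \<in> carrier A" "star A (i y) \<in> carrier A" using ic A.star_closed by auto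
    show "(\<sigma> \<circ> rho E A i s) (rank_one (fiber E s) x y) = (\<sigma> \<circ> i) x \<otimes>\<^bsub>Bop H\<^esub> star (Bop H) ((\<sigma> \<circ> i) y)"
      using rho(2)[OF xy] homD(4)[OF c(1,3)] homD(5)[OF c(2)] by simp
  qed
  then show ?thesis using R.rho_eq[OF s T] by simp
qed

theorem proposition1p7:
  fixes G :: "('g, 'm) monoid_scheme" and P :: "'g set"
    and E :: "('g, 'e) prod_system"
    and A :: "'b cstar" and i\<^sub>E :: "'e \<Rightarrow> 'b"
  assumes "quasi_lattice_ordered G P"
    and "countable P"
    and "product_system (G\<lparr>carrier := P\<rparr>) E"
    and "compactly_aligned G P E"
    and "covariant_algebra TYPE('h) TYPE('k) G P E A i\<^sub>E"
  shows "covariant_in G P E A i\<^sub>E \<and>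
    (\<forall>(H :: 'l hilbert) \<sigma>. hilbert_space H \<longrightarrow> unital_rep A H \<sigma> \<longrightarrow>
       covariant_on G P E H (\<sigma> \<circ> i\<^sub>E) \<and> covariant_in G P E (Bop H) (\<sigma> \<circ> i\<^sub>E))"
proof -
  interpret Q: qlo_product_system G P E
    using assms(1,3) by (simp add: qlo_product_system_def)
  have A: "unital_cstar_algebra A" and i: "representation E A i\<^sub>E"
    using assms(5) by (auto simp: covariant_algebra_def)
  obtain H :: "'h hilbert" and \<sigma> where H: "hilbert_space H" and \<sigma>: "unital_rep A H \<sigma>" "inj_on \<sigma> (carrier A)"
    and cov: "covariant_on G P E H (\<sigma> \<circ> i\<^sub>E)"
    using assms(5) unfolding covariant_algebra_def by blast
  interpret A: unital_cstar_algebra A by (rule A)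
  interpret H: hilbert_space H by (rule H)
  interpret F: faithful_rep G P E A H \<sigma> i\<^sub>E
    by unfold_locales (use \<sigma> i in auto)
  interpret FA: aligned_hilbert_rep G P E H "\<sigma> \<circ> i\<^sub>E"
    by unfold_locales (rule assms(4))
  have qps: "qlo_product_system G P E" by unfold_locales
  have prod_compact: "amplified_product G P E s t S T \<in> compact_ops (fiber E (vee G P s t))"
    if "s \<in> P" "t \<in> P" "bounded_pair G P s t" "S \<in> compact_ops (fiber E s)" "T \<in> compact_ops (fiber E t)" for s t S T
    using assms(4) that by (auto simp: compactly_aligned_def)
  \<comment> \<open>Every unital representation maps the two sides of the covariance relation in the algebra to the
    two sides of the relation on its Hilbert space.\<close>
  have transfer: "\<sigma>' (rho E A i\<^sub>E s S \<otimes>\<^bsub>A\<^esub> rho E A i\<^sub>E t T) = rho E (Bop H') (\<sigma>' \<circ> i\<^sub>E) s S \<otimes>\<^bsub>Bop H'\<^esub> rho E (Bop H') (\<sigma>' \<circ> i\<^sub>E) t T"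
    "\<sigma>' (if bounded_pair G P s t then rho E A i\<^sub>E (vee G P s t) (amplified_product G P E s t S T) else \<zero>\<^bsub>A\<^esub>) =
      (if bounded_pair G P s t then rho E (Bop H') (\<sigma>' \<circ> i\<^sub>E) (vee G P s t) (amplified_product G P E s t S T) else \<zero>\<^bsub>Bop H'\<^esub>)"
    if rep: "cstar_hilbert_rep A H' \<sigma>'" and st: "s \<in> P" "t \<in> P"
      and ST: "S \<in> compact_ops (fiber E s)" "T \<in> compact_ops (fiber E t)"
    for s t S T and H' :: "'z hilbert" and \<sigma>'
  proof -
    interpret C: cstar_hilbert_rep A H' \<sigma>' by (rule rep)
    have hr: "\<sigma>' (rho E A i\<^sub>E r U) = rho E (Bop H') (\<sigma>' \<circ> i\<^sub>E) r U" if "r \<in> P" "U \<in> compact_ops (fiber E r)" for r U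
      using C.hom_rho[OF qps i that(1) F.rho_algebra_hom[OF that(1)] F.rho_algebra_rank_one[OF that(1)] that(2)] .
    have cl: "rho E A i\<^sub>E r U \<in> carrier A" if "r \<in> P" "U \<in> compact_ops (fiber E r)" for r U
      using star_hom_closed[OF F.rho_algebra_hom[OF that(1)], of U] that(2) by simp
    show "\<sigma>' (rho E A i\<^sub>E s S \<otimes>\<^bsub>A\<^esub> rho E A i\<^sub>E t T) = rho E (Bop H') (\<sigma>' \<circ> i\<^sub>E) s S \<otimes>\<^bsub>Bop H'\<^esub> rho E (Bop H') (\<sigma>' \<circ> i\<^sub>E) t T"
      using star_hom_mult[OF C.hom cl cl, of s S t T] hr st ST by simp
    show "\<sigma>' (if bounded_pair G P s t then rho E A i\<^sub>E (vee G P s t) (amplified_product G P E s t S T) else \<zero>\<^bsub>A\<^esub>) =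
      (if bounded_pair G P s t then rho E (Bop H') (\<sigma>' \<circ> i\<^sub>E) (vee G P s t) (amplified_product G P E s t S T) else \<zero>\<^bsub>Bop H'\<^esub>)"
      using hr[OF Q.vee_bounds(1)[OF st] prod_compact[OF st _ ST]] C.hom_zero by (simp add: C.H.op_null_def)
  qed
  have covA: "covariant_in G P E A i\<^sub>E"
    unfolding covariant_in_def
  proof (intro conjI ballI i)
    fix s t S T assume st: "s \<in> P" "t \<in> P" and ST: "S \<in> compact_ops (fiber E s)" "T \<in> compact_ops (fiber E t)"
    show "rho E A i\<^sub>E s S \<otimes>\<^bsub>A\<^esub> rho E A i\<^sub>E t T =
      (if bounded_pair G P s t then rho E A i\<^sub>E (vee G P s t) (amplified_product G P E s t S T) else \<zero>\<^bsub>A\<^esub>)"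
    proof (rule F.faithfulD)
      note cl = star_hom_closed[OF F.rho_algebra_hom, simplified]
      show "\<sigma> (rho E A i\<^sub>E s S \<otimes>\<^bsub>A\<^esub> rho E A i\<^sub>E t T) = \<sigma> (if bounded_pair G P s t
          then rho E A i\<^sub>E (vee G P s t) (amplified_product G P E s t S T) else \<zero>\<^bsub>A\<^esub>)"
        unfolding transfer[OF F.cstar_hilbert_rep_axioms st ST]
        using cov[unfolded FA.covariant_on_iff_in] st ST unfolding covariant_in_def by blast
      show "rho E A i\<^sub>E s S \<otimes>\<^bsub>A\<^esub> rho E A i\<^sub>E t T \<in> carrier A"
        using cl st ST by simp
      show "(if bounded_pair G P s t then rho E A i\<^sub>E (vee G P s t) (amplified_product G P E s t S T) else \<zero>\<^bsub>A\<^esub>) \<in> carrier A"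
        using cl[OF Q.vee_bounds(1)[OF st] prod_compact[OF st _ ST]] by simp
    qed
  qed
  moreover have "covariant_on G P E H' (\<sigma>' \<circ> i\<^sub>E) \<and> covariant_in G P E (Bop H') (\<sigma>' \<circ> i\<^sub>E)"
    if H': "hilbert_space H'" and \<sigma>': "unital_rep A H' \<sigma>'" for H' :: "'l hilbert" and \<sigma>'
  proof -
    interpret H': hilbert_space H' by (rule H')
    interpret C: cstar_hilbert_rep A H' \<sigma>' by unfold_locales (rule \<sigma>')
    interpret R: aligned_hilbert_rep G P E H' "\<sigma>' \<circ> i\<^sub>E"
      by unfold_locales (rule C.representation_comp[OF i], rule assms(4))
    have "covariant_in G P E (Bop H') (\<sigma>' \<circ> i\<^sub>E)"
      unfolding covariant_in_def
    proof (intro conjI ballI R.rep)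
      fix s t S T assume st: "s \<in> P" "t \<in> P" and ST: "S \<in> compact_ops (fiber E s)" "T \<in> compact_ops (fiber E t)"
      have "rho E A i\<^sub>E s S \<otimes>\<^bsub>A\<^esub> rho E A i\<^sub>E t T =
        (if bounded_pair G P s t then rho E A i\<^sub>E (vee G P s t) (amplified_product G P E s t S T) else \<zero>\<^bsub>A\<^esub>)"
        using covA st ST unfolding covariant_in_def by blast
      from arg_cong[OF this, of \<sigma>'] show "rho E (Bop H') (\<sigma>' \<circ> i\<^sub>E) s S \<otimes>\<^bsub>Bop H'\<^esub> rho E (Bop H') (\<sigma>' \<circ> i\<^sub>E) t T =
        (if bounded_pair G P s t then rho E (Bop H') (\<sigma>' \<circ> i\<^sub>E) (vee G P s t) (amplified_product G P E s t S T) else \<zero>\<^bsub>Bop H'\<^esub>)"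
        unfolding transfer[OF C.cstar_hilbert_rep_axioms st ST] .
    qed
    then show ?thesis using R.covariant_on_iff_in by blast
  qed
  ultimately show ?thesis by blast
qed


end
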